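(* Let $r:\mathbb{R}\cup i\mathbb{R}\to\mathbb{C}$ satisfy $r(k)\in L^2_z(\mathbb{R})\cap L^\infty_z(\mathbb{R})$, $z=k^2$, and suppose there is $c_0>0$ with $1-|r(k)|^2\ge c_0^2$ for $k\in i\mathbb{R}$. Then for every $x\in\mathbb{R}$ the linear inhomogeneous equation $$G_-(x;k)=\mathcal{P}^-\big(G_-J\big)(z)+\mathcal{P}^-(J)(z),\qquad z\in\mathbb{R},$$ for a $2\times2$ matrix-valued function $G_-$ has a unique solution $G_-(x;k)\in L^2_z(\mathbb{R})$.
   Context: Functions of $k\in\mathbb{R}\cup i\mathbb{R}$ are regarded as functions of $z=k^2\in\mathbb{R}$ (taking $k=\sqrt z\in\mathbb{R}_+\cup i\mathbb{R}_+$), and $L^p_z(\mathbb{R})$ is the $L^p$ space in the variable $z$. The matrix $J=J(x;k)$ is $$J(x;k)=\begin{pmatrix}|r(k)|^2&\overline{r(k)}e^{-2ik^2x}\\ r(k)e^{2ik^2x}&0\end{pmatrix}\ (k\in\mathbb{R}),\qquad J(x;k)=\begin{pmatrix}-|r(k)|^2&-\overline{r(k)}e^{-2ik^2x}\\ r(k)e^{2ik^2x}&0\end{pmatrix}\ (k\in i\mathbb{R}).$$ The Plemelj projections act entrywise on functions of $z\in\mathbb{R}$ by $\mathcal{P}^\pm(h)(z)=\lim_{\varepsilon\downarrow0}\frac1{2\pi i}\int_{\mathbb{R}}\frac{h(s)}{s-(z\pm i\varepsilon)}\,ds$. *)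

theory Defs
  imports "HOL-Analysis.Analysis"
begin

text \<open>
  Functions of \<open>k \<in> \<real> \<union> i\<real>\<close> are total functions \<open>complex \<Rightarrow> complex\<close> of which only the values on
  the two axes matter. They become functions of real \<open>z = k\<^sup>2\<close> by composition with the branch
  below: the principal root \<open>csqrt\<close> takes values in \<open>\<real>\<^sub>+\<close> for \<open>z \<ge> 0\<close> and in \<open>i\<real>\<^sub>+\<close> for \<open>z < 0\<close>.
\<close>

definition kz :: "real \<Rightarrow> complex" where
  "kz z = csqrt (complex_of_real z)"

lemma kz_nonneg: "z \<ge> 0 \<Longrightarrow> kz z = complex_of_real (sqrt z)"
  by (simp add: kz_def)

lemma kz_neg: "z < 0 \<Longrightarrow> kz z = \<i> * complex_of_real (sqrt (- z))"
  by (simp add: kz_def csqrt_of_real_nonpos)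

lemma kz_squared: "(kz z)\<^sup>2 = complex_of_real z"
  by (simp add: kz_def)

text \<open>
  Elements of \<open>L\<^sup>2\<close> and \<open>L\<^sup>\<infinity>\<close> are represented by Lebesgue measurable functions; equality in these
  spaces is equality almost everywhere. For matrix-valued functions the norm in \<open>in_L2\<close> is the
  Frobenius norm, so membership is the same as membership of all entries.
\<close>

definition in_L2 :: "(real \<Rightarrow> 'a::real_normed_vector) \<Rightarrow> bool" where
  "in_L2 f \<longleftrightarrow> f \<in> borel_measurable lebesgue \<and> integrable lebesgue (\<lambda>z. (norm (f z))\<^sup>2)"

definition in_Linf :: "(real \<Rightarrow> 'a::real_normed_vector) \<Rightarrow> bool" where
  "in_Linf f \<longleftrightarrow> f \<in> borel_measurable lebesgue \<and> (\<exists>C. AE z in lebesgue. norm (f z) \<le> C)"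

text \<open>
  At \<open>k = 0\<close>, where the two formulas for \<open>J\<close> conflict, the one for real \<open>k\<close> is used; this concerns
  only the null set \<open>z = 0\<close>.
\<close>

definition J :: "(complex \<Rightarrow> complex) \<Rightarrow> real \<Rightarrow> complex \<Rightarrow> complex^2^2" where
  "J r x k =
    (if k \<in> \<real>
     then vector [vector [(complex_of_real (norm (r k)))\<^sup>2, cnj (r k) * exp (- 2 * \<i> * k\<^sup>2 * complex_of_real x)],
                  vector [r k * exp (2 * \<i> * k\<^sup>2 * complex_of_real x), 0]]
     else vector [vector [- (complex_of_real (norm (r k)))\<^sup>2, - cnj (r k) * exp (- 2 * \<i> * k\<^sup>2 * complex_of_real x)],
                  vector [r k * exp (2 * \<i> * k\<^sup>2 * complex_of_real x), 0]])"

definition cauchy_integral :: "(real \<Rightarrow> complex) \<Rightarrow> complex \<Rightarrow> complex" where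
  "cauchy_integral h w =
    1 / (2 * complex_of_real pi * \<i>) * (LINT s|lebesgue. h s / (complex_of_real s - w))"

text \<open>
  Pointwise boundary values from the lower half plane. For \<open>h\<close> in \<open>L\<^sup>2\<close> the limit exists for almost
  every \<open>z\<close>; elsewhere \<open>Lim\<close> is an unspecified value, which is harmless as the projections are only
  used almost everywhere.
\<close>

definition plemelj_minus :: "(real \<Rightarrow> complex) \<Rightarrow> real \<Rightarrow> complex" where
  "plemelj_minus h z =
    Lim (at_right 0) (\<lambda>\<epsilon>. cauchy_integral h (complex_of_real z - \<i> * complex_of_real \<epsilon>))"

definition plemelj_minus_mat :: "(real \<Rightarrow> complex^2^2) \<Rightarrow> real \<Rightarrow> complex^2^2" where
  "plemelj_minus_mat H z = (\<chi> i j. plemelj_minus (\<lambda>s. H s $ i $ j) z)"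

definition solves_RH_equation ::
  "(complex \<Rightarrow> complex) \<Rightarrow> real \<Rightarrow> (real \<Rightarrow> complex^2^2) \<Rightarrow> bool" where
  "solves_RH_equation r x G \<longleftrightarrow>
    (AE z in lebesgue.
      G z = plemelj_minus_mat (\<lambda>s. G s ** J r x (kz s)) z
          + plemelj_minus_mat (\<lambda>s. J r x (kz s)) z)"

end

theory Submission
  imports Defs "HOL-Real_Asymp.Real_Asymp"
begin

text \<open>
  Write \<open>S = - P\<^sup>-\<close> on square-integrable functions of a real variable. The equation reads
  \<open>G + S (G J) = - S J\<close>. The proof rests on two facts.

  First, \<open>S\<close> is an orthogonal projection (onto the Hardy space of the lower half plane). Hence every
  solution satisfies \<open>S G = G\<close>, and the equation is equivalent to \<open>S (G (1 + J)) = - S J\<close> on the range of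
  \<open>S\<close>.

  Second, the jump matrix \<open>1 + J\<close> has a uniformly positive Hermitian part. For \<open>z \<ge> 0\<close> it is itself
  Hermitian with determinant \<open>1\<close> and bounded trace, since \<open>r\<close> is essentially bounded; for \<open>z < 0\<close> the
  off-diagonal entries are skew and the diagonal is \<open>(1 - \<bar>r\<bar>\<^sup>2, 1)\<close>, which is where the assumption on the
  imaginary axis enters. So \<open>g \<mapsto> S (g (1 + J))\<close> is bounded and coercive on the range of \<open>S\<close>, and the
  argument of Lax and Milgram gives existence and uniqueness
  (\<open>coercive_equation_unique_solution\<close>).

  The work lies in the first fact, because \<open>P\<^sup>-\<close> is given by pointwise boundary values of Cauchy integrals.
  Let \<open>S\<^sub>e f z\<close> (\<open>hardy e f z\<close> below) be the Cauchy integral evaluated at \<open>z - i e\<close>, up to sign. The residue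
  computation \<open>integral_cauchy_kernel_mult\<close> and Fubini's theorem show \<open>S\<^sub>d S\<^sub>e = S\<^bsub>d+e\<^esub>\<close> and that \<open>S\<^sub>e\<close> is
  self-adjoint. Together with a crude a priori bound these properties imply that \<open>S\<^sub>e\<close> is a contraction and that
  \<open>S\<^sub>e f\<close> converges in mean square as \<open>e\<close> tends to \<open>0\<close>, say to \<open>g\<close>
  (\<open>hardy_contraction_L1\<close>, \<open>hardy_limit_L2\<close>).

  To obtain convergence almost everywhere, note that \<open>S\<^sub>e f\<close> is the Poisson integral of \<open>g\<close>. The
  Poisson maximal operator is bounded in mean square: if \<open>T\<close> is the Poisson
  integral with a variable parameter \<open>\<tau> x\<close>, the semigroup law computes the kernel of \<open>T T\<^sup>*\<close> and bounds it
  by twice the kernel of \<open>T + T\<^sup>*\<close>, so that \<open>\<parallel>T\<parallel>\<^sup>2 \<le> 4 \<parallel>T\<parallel>\<close> (\<open>poisson_linearised_step\<close>,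
  \<open>poisson_linearised_bound\<close>). The functions \<open>S\<^sub>d f\<close>, whose Poisson integrals \<open>S\<^bsub>e+d\<^esub> f\<close> are continuous up
  to \<open>e = 0\<close>, serve as the dense class (\<open>hardy_limit_AE\<close>).
\<close>

section \<open>Square-integrable functions as a semi-inner-product space\<close>

text \<open>
  The measure is a parameter because Fubini arguments take place for \<open>lborel\<close>, whereas the
  theorem speaks about \<open>lebesgue\<close>. The values lie in a Euclidean space, so that scalar and matrix-valued
  functions are treated alike.
\<close>

definition L2 :: "'b measure \<Rightarrow> ('b \<Rightarrow> 'a::euclidean_space) \<Rightarrow> bool" where
  "L2 M f \<longleftrightarrow> f \<in> borel_measurable M \<and> integrable M (\<lambda>x. (norm (f x))\<^sup>2)"

definition N2 :: "'b measure \<Rightarrow> ('b \<Rightarrow> 'a::euclidean_space) \<Rightarrow> real" where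
  "N2 M f = sqrt (LINT x|M. (norm (f x))\<^sup>2)"

text \<open>
  The pairing is the real one; for complex values it is the real part of the Hermitian pairing. It
  suffices for self-adjointness and coercivity.
\<close>

definition ip :: "'b measure \<Rightarrow> ('b \<Rightarrow> 'a::euclidean_space) \<Rightarrow> ('b \<Rightarrow> 'a) \<Rightarrow> real" where
  "ip M f g = (LINT x|M. f x \<bullet> g x)"

lemma L2_measurable [measurable_dest]: "L2 M f \<Longrightarrow> f \<in> borel_measurable M"
  by (simp add: L2_def)

lemma L2_integrable: "L2 M f \<Longrightarrow> integrable M (\<lambda>x. (norm (f x))\<^sup>2)"
  by (simp add: L2_def)

lemma N2_nonneg [simp]: "0 \<le> N2 M f"
  by (simp add: N2_def)

lemma N2_squared: "(N2 M f)\<^sup>2 = (LINT x|M. (norm (f x))\<^sup>2)"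
  by (simp add: N2_def)

lemma ip_self: "ip M f f = (N2 M f)\<^sup>2"
  by (simp add: ip_def N2_squared dot_square_norm)

lemma ip_commute: "ip M f g = ip M g f"
  by (simp add: ip_def inner_commute)

lemma nn_integral_N2:
  assumes "L2 M f" shows "(\<integral>\<^sup>+x. ennreal ((norm (f x))\<^sup>2) \<partial>M) = ennreal ((N2 M f)\<^sup>2)"
  using assms unfolding N2_squared L2_def
  by (intro nn_integral_eq_integral) auto

text \<open>
  Membership and norm estimates are obtained from a bound on the nonnegative integral, where no
  integrability has to be known in advance.
\<close>

lemma L2_nn_bound:
  fixes f :: "'b \<Rightarrow> 'a::euclidean_space"
  assumes [measurable]: "f \<in> borel_measurable M"
    and b: "(\<integral>\<^sup>+x. ennreal ((norm (f x))\<^sup>2) \<partial>M) \<le> ennreal (C\<^sup>2)" and "C \<ge> 0"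
  shows "L2 M f" "N2 M f \<le> C"
proof -
  show L: "L2 M f"
    unfolding L2_def using b
    by (auto simp: integrable_iff_bounded intro: le_less_trans)
  have "(N2 M f)\<^sup>2 \<le> C\<^sup>2"
    using b nn_integral_N2[OF L] by (simp add: ennreal_le_iff)
  then show "N2 M f \<le> C" using \<open>C \<ge> 0\<close> by (rule power2_le_imp_le)
qed

lemma L2_mono:
  assumes [measurable]: "f \<in> borel_measurable M" and g: "L2 M g" and "0 \<le> c"
    and le: "AE x in M. norm (f x) \<le> c * norm (g x)"
  shows "L2 M f" "N2 M f \<le> c * N2 M g"
proof -
  have "(\<integral>\<^sup>+x. ennreal ((norm (f x))\<^sup>2) \<partial>M) \<le> (\<integral>\<^sup>+x. ennreal (c\<^sup>2) * ennreal ((norm (g x))\<^sup>2) \<partial>M)"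
    by (intro nn_integral_mono_AE, use le in eventually_elim)
      (simp add: ennreal_mult[symmetric] power_mult_distrib[symmetric] ennreal_leI power_mono)
  also have "\<dots> = ennreal (c\<^sup>2) * (\<integral>\<^sup>+x. ennreal ((norm (g x))\<^sup>2) \<partial>M)"
    using L2_measurable[OF g] by (intro nn_integral_cmult) auto
  also have "\<dots> = ennreal ((c * N2 M g)\<^sup>2)"
    by (simp add: nn_integral_N2[OF g] ennreal_mult[symmetric] power_mult_distrib)
  finally have *: "(\<integral>\<^sup>+x. ennreal ((norm (f x))\<^sup>2) \<partial>M) \<le> ennreal ((c * N2 M g)\<^sup>2)" .
  have "0 \<le> c * N2 M g" using \<open>0 \<le> c\<close> by simp
  from L2_nn_bound[OF assms(1) * this] show "L2 M f" "N2 M f \<le> c * N2 M g" .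
qed

lemma L2_cong_AE:
  assumes "L2 M g" "f \<in> borel_measurable M" "AE x in M. f x = g x"
  shows "L2 M f"
proof -
  have "AE x in M. norm (f x) \<le> 1 * norm (g x)" using assms(3) by eventually_elim simp
  then show ?thesis by (intro L2_mono(1)[OF assms(2,1), of 1]) simp
qed

lemma N2_cong_AE:
  assumes "f \<in> borel_measurable M" "g \<in> borel_measurable M" "AE x in M. f x = g x"
  shows "N2 M f = N2 M g"
proof -
  have "AE x in M. (norm (f x))\<^sup>2 = (norm (g x))\<^sup>2" using assms(3) by eventually_elim simp
  then have "(LINT x|M. (norm (f x))\<^sup>2) = (LINT x|M. (norm (g x))\<^sup>2)"
    using assms(1,2) by (intro integral_cong_AE) auto
  then show ?thesis by (simp add: N2_def)
qed

lemma L2_scaleR: "L2 M f \<Longrightarrow> L2 M (\<lambda>x. c *\<^sub>R f x)"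
  by (rule L2_mono(1)[where c = "\<bar>c\<bar>" and g = f]) auto

lemma N2_scaleR: "N2 M (\<lambda>x. c *\<^sub>R f x) = \<bar>c\<bar> * N2 M f"
  by (simp add: N2_def power_mult_distrib real_sqrt_mult)

lemma L2_minus: "L2 M f \<Longrightarrow> L2 M (\<lambda>x. - f x)"
  using L2_scaleR[of M f "-1"] by simp

lemma L2_norm: "L2 M f \<Longrightarrow> L2 M (\<lambda>x. norm (f x))"
  by (auto simp: L2_def)

lemma L2_zero [simp]: "L2 M (\<lambda>x. 0)"
  by (simp add: L2_def)

lemma L2_add:
  fixes f g :: "'b \<Rightarrow> 'a::euclidean_space"
  assumes "L2 M f" "L2 M g"
  shows "L2 M (\<lambda>x. f x + g x)"
proof -
  have *: "(norm (a + b))\<^sup>2 \<le> 2 * (norm a)\<^sup>2 + 2 * (norm b)\<^sup>2" for a b :: 'a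
  proof -
    have "(norm (a + b))\<^sup>2 \<le> (norm a + norm b)\<^sup>2"
      by (intro power_mono norm_triangle_ineq) auto
    also have "\<dots> \<le> 2 * (norm a)\<^sup>2 + 2 * (norm b)\<^sup>2"
      using sum_squares_bound[of "norm a" "norm b"] by (simp add: power2_sum)
    finally show ?thesis .
  qed
  have [measurable]: "f \<in> borel_measurable M" "g \<in> borel_measurable M"
    using assms by (auto simp: L2_def)
  have "integrable M (\<lambda>x. 2 * (norm (f x))\<^sup>2 + 2 * (norm (g x))\<^sup>2)"
    using assms by (auto simp: L2_def)
  then have "integrable M (\<lambda>x. (norm (f x + g x))\<^sup>2)"
    by (rule Bochner_Integration.integrable_bound) (use * in auto)
  then show ?thesis by (simp add: L2_def)
qed

lemma L2_diff: "L2 M f \<Longrightarrow> L2 M g \<Longrightarrow> L2 M (\<lambda>x. f x - g x)"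
  using L2_add[OF _ L2_minus, of M f g] by simp

lemma ennreal_le_of_power2:
  assumes "X\<^sup>2 \<le> (ennreal b)\<^sup>2" "b \<ge> 0" shows "X \<le> ennreal b"
proof (cases X)
  case (real r)
  then show ?thesis using assms by (auto simp: ennreal_power ennreal_le_iff intro: power2_le_imp_le)
next
  case top
  then show ?thesis using assms by (simp add: ennreal_power top_unique)
qed

lemma L2_mult_integrable:
  assumes f: "L2 M f" and g: "L2 M g"
  shows "integrable M (\<lambda>x. norm (f x) * norm (g x))"
    and "(LINT x|M. norm (f x) * norm (g x)) \<le> N2 M f * N2 M g"
proof -
  note [measurable] = L2_measurable[OF f] L2_measurable[OF g]
  have "(\<integral>\<^sup>+x. ennreal (norm (f x)) * ennreal (norm (g x)) \<partial>M)\<^sup>2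
      \<le> (\<integral>\<^sup>+x. ennreal (norm (f x))^2 \<partial>M) * (\<integral>\<^sup>+x. ennreal (norm (g x))^2 \<partial>M)"
    by (rule Cauchy_Schwarz_nn_integral) auto
  also have "\<dots> = (ennreal (N2 M f * N2 M g))\<^sup>2"
    by (simp add: ennreal_power nn_integral_N2[OF f] nn_integral_N2[OF g] ennreal_mult[symmetric] power_mult_distrib)
  finally have *: "(\<integral>\<^sup>+x. ennreal (norm (f x) * norm (g x)) \<partial>M) \<le> ennreal (N2 M f * N2 M g)"
    by (simp add: ennreal_mult[of "norm (f _)"] ennreal_le_of_power2)
  show I: "integrable M (\<lambda>x. norm (f x) * norm (g x))"
    using * by (auto simp: integrable_iff_bounded intro: le_less_trans)
  have "(\<integral>\<^sup>+x. ennreal (norm (f x) * norm (g x)) \<partial>M) = ennreal (LINT x|M. norm (f x) * norm (g x))"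
    by (intro nn_integral_eq_integral I) auto
  with * show "(LINT x|M. norm (f x) * norm (g x)) \<le> N2 M f * N2 M g"
    by (simp add: ennreal_le_iff)
qed

lemma L2_inner_integrable:
  assumes f: "L2 M f" and g: "L2 M g"
  shows "integrable M (\<lambda>x. f x \<bullet> g x)"
  using L2_measurable[OF f] L2_measurable[OF g]
  by (intro Bochner_Integration.integrable_bound[OF L2_mult_integrable(1)[OF f g]])
     (auto simp: Cauchy_Schwarz_ineq2)

lemma L2_times_integrable:
  fixes f g :: "'b \<Rightarrow> complex"
  assumes f: "L2 M f" and g: "L2 M g"
  shows "integrable M (\<lambda>x. f x * g x)" "norm (LINT x|M. f x * g x) \<le> N2 M f * N2 M g"
proof -
  note [measurable] = L2_measurable[OF f] L2_measurable[OF g]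
  show "integrable M (\<lambda>x. f x * g x)"
    by (intro Bochner_Integration.integrable_bound[OF L2_mult_integrable(1)[OF f g]]) (auto simp: norm_mult)
  have "norm (LINT x|M. f x * g x) \<le> (LINT x|M. norm (f x * g x))" by simp
  also have "\<dots> \<le> N2 M f * N2 M g"
    using L2_mult_integrable(2)[OF f g] by (simp add: norm_mult)
  finally show "norm (LINT x|M. f x * g x) \<le> N2 M f * N2 M g" .
qed

lemma ip_bound:
  assumes f: "L2 M f" and g: "L2 M g"
  shows "\<bar>ip M f g\<bar> \<le> N2 M f * N2 M g"
proof -
  have "\<bar>ip M f g\<bar> \<le> (LINT x|M. \<bar>f x \<bullet> g x\<bar>)"
    unfolding ip_def using integral_norm_bound[of M "\<lambda>x. f x \<bullet> g x"] by simp
  also have "\<dots> \<le> (LINT x|M. norm (f x) * norm (g x))"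
    by (intro integral_mono integrable_abs L2_inner_integrable f g L2_mult_integrable(1) Cauchy_Schwarz_ineq2)
  also have "\<dots> \<le> N2 M f * N2 M g" by (rule L2_mult_integrable(2)[OF f g])
  finally show ?thesis .
qed

lemma ip_add_left: "L2 M f \<Longrightarrow> L2 M g \<Longrightarrow> L2 M h \<Longrightarrow> ip M (\<lambda>x. f x + g x) h = ip M f h + ip M g h"
  by (simp add: ip_def inner_add_left L2_inner_integrable)

lemma ip_diff_left: "L2 M f \<Longrightarrow> L2 M g \<Longrightarrow> L2 M h \<Longrightarrow> ip M (\<lambda>x. f x - g x) h = ip M f h - ip M g h"
  by (simp add: ip_def inner_diff_left L2_inner_integrable)

lemma ip_add_right: "L2 M f \<Longrightarrow> L2 M g \<Longrightarrow> L2 M h \<Longrightarrow> ip M h (\<lambda>x. f x + g x) = ip M h f + ip M h g"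
  by (simp add: ip_def inner_add_right L2_inner_integrable)

lemma ip_diff_right: "L2 M f \<Longrightarrow> L2 M g \<Longrightarrow> L2 M h \<Longrightarrow> ip M h (\<lambda>x. f x - g x) = ip M h f - ip M h g"
  by (simp add: ip_def inner_diff_right L2_inner_integrable)

lemma ip_scaleR_left: "ip M (\<lambda>x. c *\<^sub>R f x) h = c * ip M f h"
  by (simp add: ip_def)

lemma ip_cong_AE:
  assumes "f \<in> borel_measurable M" "f' \<in> borel_measurable M" "g \<in> borel_measurable M"
    "AE x in M. f x = f' x"
  shows "ip M f g = ip M f' g"
proof -
  have "AE x in M. f x \<bullet> g x = f' x \<bullet> g x" using assms(4) by eventually_elim simp
  then show ?thesis
    unfolding ip_def using assms(1-3) by (intro integral_cong_AE) auto
qed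

lemma N2_add_squared:
  assumes "L2 M f" "L2 M g"
  shows "(N2 M (\<lambda>x. f x + g x))\<^sup>2 = (N2 M f)\<^sup>2 + 2 * ip M f g + (N2 M g)\<^sup>2"
  unfolding ip_self[symmetric]
  using assms by (simp add: ip_add_left ip_add_right L2_add ip_commute[of M g f])

lemma N2_diff_squared:
  assumes "L2 M f" "L2 M g"
  shows "(N2 M (\<lambda>x. f x - g x))\<^sup>2 = (N2 M f)\<^sup>2 - 2 * ip M f g + (N2 M g)\<^sup>2"
  unfolding ip_self[symmetric]
  using assms by (simp add: ip_diff_left ip_diff_right L2_diff ip_commute[of M g f])

lemma N2_triangle:
  assumes "L2 M f" "L2 M g"
  shows "N2 M (\<lambda>x. f x + g x) \<le> N2 M f + N2 M g"
proof (rule power2_le_imp_le)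
  show "(N2 M (\<lambda>x. f x + g x))\<^sup>2 \<le> (N2 M f + N2 M g)\<^sup>2"
    using ip_bound[OF assms] by (simp add: N2_add_squared[OF assms] power2_sum)
qed simp

lemma N2_triangle_diff:
  assumes "L2 M f" "L2 M g"
  shows "N2 M (\<lambda>x. f x - g x) \<le> N2 M f + N2 M g"
  using N2_triangle[OF assms(1) L2_minus[OF assms(2)]] N2_scaleR[of M "-1" g] by simp

lemma N2_minus_commute: "N2 M (\<lambda>x. f x - g x) = N2 M (\<lambda>x. g x - f x)"
  by (simp add: N2_def norm_minus_commute)

lemma N2_zero_AE:
  assumes "L2 M f" "N2 M f = 0" shows "AE x in M. f x = 0"
proof -
  have "(LINT x|M. (norm (f x))\<^sup>2) = 0" using assms(2) by (simp add: N2_squared[symmetric])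
  then have "AE x in M. (norm (f x))\<^sup>2 = 0"
    using L2_integrable[OF assms(1)] by (simp add: integral_nonneg_eq_0_iff_AE)
  then show ?thesis by simp
qed

lemma L2_Fatou:
  assumes L: "\<And>n. L2 M (f n)" and [measurable]: "g \<in> borel_measurable M"
    and lim: "AE x in M. (\<lambda>n. f n x) \<longlonglongrightarrow> g x"
    and b: "\<forall>\<^sub>F n in sequentially. N2 M (f n) \<le> C"
  shows "L2 M g" "N2 M g \<le> C"
proof -
  note [measurable] = L2_measurable[OF L]
  obtain n where "N2 M (f n) \<le> C" using eventually_happens'[OF _ b] by auto
  then have "C \<ge> 0" by (rule order_trans[OF N2_nonneg])
  have "(\<integral>\<^sup>+x. ennreal ((norm (g x))\<^sup>2) \<partial>M) = (\<integral>\<^sup>+x. liminf (\<lambda>n. ennreal ((norm (f n x))\<^sup>2)) \<partial>M)"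
  proof (intro nn_integral_cong_AE, use lim in eventually_elim)
    case (elim x)
    then have "(\<lambda>n. ennreal ((norm (f n x))\<^sup>2)) \<longlonglongrightarrow> ennreal ((norm (g x))\<^sup>2)"
      by (intro tendsto_intros tendsto_ennrealI)
    then show ?case by (intro lim_imp_Liminf[symmetric]) simp_all
  qed
  also have "\<dots> \<le> liminf (\<lambda>n. \<integral>\<^sup>+x. ennreal ((norm (f n x))\<^sup>2) \<partial>M)"
    by (rule nn_integral_liminf) auto
  also have "\<dots> \<le> liminf (\<lambda>n. ennreal (C\<^sup>2))"
    by (rule Liminf_mono, use b in eventually_elim)
       (auto simp: nn_integral_N2[OF L] intro!: ennreal_leI power_mono)
  also have "\<dots> = ennreal (C\<^sup>2)" by (simp add: Liminf_const)
  finally have *: "(\<integral>\<^sup>+x. ennreal ((norm (g x))\<^sup>2) \<partial>M) \<le> ennreal (C\<^sup>2)" .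
  from L2_nn_bound[OF assms(2) * \<open>C \<ge> 0\<close>] show "L2 M g" "N2 M g \<le> C" .
qed

text \<open>
  The weight \<open>w\<close> turns an \<open>L\<^sup>2\<close>-Cauchy sequence into an \<open>L\<^sup>1\<close>-Cauchy sequence (Cauchy-Schwarz), for which an
  almost everywhere convergent subsequence is available even though the measure is infinite. Fatou's lemma
  then identifies its limit as the limit in mean square.
\<close>

lemma L2_complete:
  fixes f :: "nat \<Rightarrow> 'b \<Rightarrow> 'a::euclidean_space"
  assumes L: "\<And>n. L2 M (f n)"
    and w: "L2 M w" "\<And>x. w x > (0::real)"
    and C: "\<And>e. e > 0 \<Longrightarrow> \<exists>N. \<forall>m\<ge>N. \<forall>n\<ge>N. N2 M (\<lambda>x. f m x - f n x) < e"
  shows "\<exists>g. L2 M g \<and> (\<lambda>n. N2 M (\<lambda>x. f n x - g x)) \<longlonglongrightarrow> 0"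
proof -
  note [measurable] = L2_measurable[OF L] L2_measurable[OF w(1)]
  define s where "s n x = w x *\<^sub>R f n x" for n x
  have [measurable]: "s n \<in> borel_measurable M" for n unfolding s_def by measurable
  have s_int: "integrable M (s n)" for n
    by (rule Bochner_Integration.integrable_bound[OF L2_mult_integrable(1)[OF w(1) L[of n]]]) (auto simp: s_def)
  have "\<exists>N. \<forall>i\<ge>N. \<forall>j\<ge>N. LINT x|M. norm (s i x - s j x) < e" if "e > 0" for e
  proof -
    obtain N where N: "N2 M (\<lambda>x. f i x - f j x) < e / (N2 M w + 1)" if "i \<ge> N" "j \<ge> N" for i j
      using C[of "e / (N2 M w + 1)"] \<open>e > 0\<close> by (auto simp: add_nonneg_pos)
    have "LINT x|M. norm (s i x - s j x) < e" if ij: "i \<ge> N" "j \<ge> N" for i j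
    proof -
      have "LINT x|M. norm (s i x - s j x) = LINT x|M. norm (w x) * norm (f i x - f j x)"
        by (simp add: s_def scaleR_diff_right[symmetric])
      also have "\<dots> \<le> N2 M w * N2 M (\<lambda>x. f i x - f j x)"
        by (rule L2_mult_integrable(2)[OF w(1) L2_diff[OF L L]])
      also have "\<dots> \<le> N2 M w * (e / (N2 M w + 1))"
        using N[OF ij] by (intro mult_left_mono) auto
      also have "\<dots> < e" using \<open>e > 0\<close> by (simp add: add_pos_nonneg pos_divide_less_eq algebra_simps)
      finally show ?thesis .
    qed
    then show ?thesis by blast
  qed
  from cauchy_L1_AE_cauchy_subseq[OF s_int this]
  obtain r where r: "strict_mono r" and ae: "AE x in M. Cauchy (\<lambda>i. s (r i) x)" by blast
  define g where "g x = lim (\<lambda>i. f (r i) x)" for x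
  have gm [measurable]: "g \<in> borel_measurable M" unfolding g_def by measurable
  have lim: "AE x in M. (\<lambda>i. f (r i) x) \<longlonglongrightarrow> g x"
    using ae
  proof eventually_elim
    case (elim x)
    then have "convergent (\<lambda>i. s (r i) x)" by (simp add: Cauchy_convergent_iff)
    then obtain L where "(\<lambda>i. s (r i) x) \<longlonglongrightarrow> L" by (auto simp: convergent_def)
    then have "(\<lambda>i. (1 / w x) *\<^sub>R s (r i) x) \<longlonglongrightarrow> (1 / w x) *\<^sub>R L" by (intro tendsto_intros)
    then have "convergent (\<lambda>i. (1 / w x) *\<^sub>R s (r i) x)" by (rule convergentI)
    moreover have "(\<lambda>i. (1 / w x) *\<^sub>R s (r i) x) = (\<lambda>i. f (r i) x)"
      using w(2)[of x] by (auto simp: s_def)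
    ultimately show ?case by (simp add: g_def convergent_LIMSEQ_iff)
  qed
  have dist: "\<exists>N. \<forall>n\<ge>N. L2 M (\<lambda>x. f n x - g x) \<and> N2 M (\<lambda>x. f n x - g x) \<le> e" if "e > 0" for e
  proof -
    obtain N where N: "N2 M (\<lambda>x. f i x - f j x) < e" if "i \<ge> N" "j \<ge> N" for i j
      using C[OF \<open>e > 0\<close>] by blast
    have "L2 M (\<lambda>x. f n x - g x)" "N2 M (\<lambda>x. f n x - g x) \<le> e" if n: "n \<ge> N" for n
    proof -
      have A: "AE x in M. (\<lambda>i. f n x - f (r i) x) \<longlonglongrightarrow> f n x - g x"
        using lim by eventually_elim (intro tendsto_intros)
      have B: "\<forall>\<^sub>F i in sequentially. N2 M (\<lambda>x. f n x - f (r i) x) \<le> e"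
        using eventually_ge_at_top[of N]
      proof eventually_elim
        case (elim i)
        then have "r i \<ge> N" using seq_suble[OF r, of i] by simp
        then show ?case using N[OF n] by (simp add: less_imp_le)
      qed
      show "L2 M (\<lambda>x. f n x - g x)" "N2 M (\<lambda>x. f n x - g x) \<le> e"
        using L2_Fatou[OF L2_diff[OF L L] _ A B] by auto
    qed
    then show ?thesis by blast
  qed
  obtain n where "L2 M (\<lambda>x. f n x - g x)" using dist[of 1] by auto
  from L2_diff[OF L[of n] this] have "L2 M g" by simp
  moreover have "(\<lambda>n. N2 M (\<lambda>x. f n x - g x)) \<longlonglongrightarrow> 0"
  proof (rule LIMSEQ_I)
    fix e :: real assume "e > 0"
    then obtain N where "\<forall>n\<ge>N. N2 M (\<lambda>x. f n x - g x) \<le> e / 2" using dist[of "e/2"] by auto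
    then show "\<exists>N. \<forall>n\<ge>N. norm (N2 M (\<lambda>x. f n x - g x) - 0) < e"
      using \<open>e > 0\<close> by (intro exI[of _ N]) fastforce
  qed
  ultimately show ?thesis by blast
qed

section \<open>Integrals of products of Cauchy kernels\<close>

definition cauchy_kernel :: "complex \<Rightarrow> real \<Rightarrow> complex" where
  "cauchy_kernel a s = 1 / (complex_of_real s - a)"

lemma cauchy_kernel_measurable [measurable]: 
  assumes [measurable]: "f \<in> borel_measurable M" "g \<in> borel_measurable M"
  shows "(\<lambda>x. cauchy_kernel (f x) (g x)) \<in> borel_measurable M"
  unfolding cauchy_kernel_def by measurable

lemma norm_cauchy_kernel_squared:
  assumes "Im a \<noteq> 0"
  shows "(norm (cauchy_kernel a s))\<^sup>2 = 1 / ((s - Re a)\<^sup>2 + (Im a)\<^sup>2)"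
  by (simp add: cauchy_kernel_def norm_divide power_divide cmod_power2)

lemma norm_cauchy_kernel_le:
  assumes "Im a \<noteq> 0" shows "norm (cauchy_kernel a s) \<le> 1 / \<bar>Im a\<bar>"
proof -
  have "\<bar>Im a\<bar> \<le> norm (complex_of_real s - a)"
    using abs_Im_le_cmod[of "complex_of_real s - a"] by simp
  then show ?thesis using assms by (simp add: cauchy_kernel_def norm_divide frac_le)
qed

lemma arctan_at_top: "q > 0 \<Longrightarrow> ((\<lambda>x. arctan ((x - p) / q)) \<longlongrightarrow> pi / 2) at_top"
  by real_asymp
lemma arctan_at_bot: "q > 0 \<Longrightarrow> ((\<lambda>x. arctan ((x - p) / q)) \<longlongrightarrow> - (pi / 2)) at_bot"
  by real_asymp

lemma inverse_quadratic_integral: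
  fixes p q :: real assumes "q \<noteq> 0"
  shows "integrable lborel (\<lambda>s. 1 / ((s - p)\<^sup>2 + q\<^sup>2))"
    and "(LINT s|lborel. 1 / ((s - p)\<^sup>2 + q\<^sup>2)) = pi / \<bar>q\<bar>"
proof -
  define r where "r = \<bar>q\<bar>"
  have r: "r > 0" "q\<^sup>2 = r\<^sup>2" using assms by (auto simp: r_def)
  define F where "F x = arctan ((x - p) / r) / r" for x
  have d: "DERIV F x :> 1 / ((x - p)\<^sup>2 + q\<^sup>2)" for x
    unfolding F_def using r
    by (auto intro!: derivative_eq_intros simp: power_divide power2_eq_square divide_simps)
  have pos: "(x - p)\<^sup>2 + q\<^sup>2 > 0" for x using assms by (simp add: add_nonneg_pos)
  have c: "isCont (\<lambda>x. 1 / ((x - p)\<^sup>2 + q\<^sup>2)) x" for x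
    using pos[of x] by (intro continuous_intros) auto
  have l: "(F \<longlongrightarrow> - (pi / 2) / r) at_bot" "(F \<longlongrightarrow> (pi / 2) / r) at_top"
    unfolding F_def using r by (intro tendsto_divide arctan_at_top arctan_at_bot tendsto_const; simp)+
  have ne: "set_integrable lborel (einterval (-\<infinity>) \<infinity>) (\<lambda>s. 1 / ((s - p)\<^sup>2 + q\<^sup>2))"
    "(LBINT s=-\<infinity>..\<infinity>. 1 / ((s - p)\<^sup>2 + q\<^sup>2)) = (pi / 2) / r - (- (pi / 2) / r)"
    by (rule interval_integral_FTC_nonneg[where F = F and f = "\<lambda>s. 1 / ((s - p)\<^sup>2 + q\<^sup>2)" and a = "-\<infinity>" and b = "\<infinity>"];
        use d c l pos in \<open>auto simp: ereal_tendsto_simps less_imp_le\<close>)+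
  show "integrable lborel (\<lambda>s. 1 / ((s - p)\<^sup>2 + q\<^sup>2))"
    using ne(1) by (simp add: set_integrable_def einterval_def)
  show "(LINT s|lborel. 1 / ((s - p)\<^sup>2 + q\<^sup>2)) = pi / \<bar>q\<bar>"
    using ne(2) by (simp add: interval_lebesgue_integral_def set_lebesgue_integral_def einterval_def r_def)
qed

lemma L2_cauchy_kernel:
  assumes "Im a \<noteq> 0"
  shows "L2 lborel (cauchy_kernel a)" "N2 lborel (cauchy_kernel a) = sqrt (pi / \<bar>Im a\<bar>)"
proof -
  have "cauchy_kernel a \<in> borel_measurable lborel"
    using cauchy_kernel_measurable[of "\<lambda>_. a" lborel "\<lambda>x. x"] by simp
  then show "L2 lborel (cauchy_kernel a)" "N2 lborel (cauchy_kernel a) = sqrt (pi / \<bar>Im a\<bar>)"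
    using assms inverse_quadratic_integral[OF assms, of "Re a"]
    by (simp_all add: L2_def N2_def norm_cauchy_kernel_squared)
qed

text \<open>
  The logarithm of the modulus and an arctangent are smooth on the whole real line, whereas a branch of the
  complex logarithm of \<open>x - a\<close> would have to be chosen for each half plane.
\<close>

definition cauchy_primitive :: "complex \<Rightarrow> real \<Rightarrow> complex" where
  "cauchy_primitive a x = Complex (ln ((x - Re a)\<^sup>2 + (Im a)\<^sup>2) / 2) (arctan ((x - Re a) / Im a))"

lemma cauchy_primitive_deriv:
  assumes "Im a \<noteq> 0"
  shows "(cauchy_primitive a has_vector_derivative cauchy_kernel a x) (at x)"
proof -
  define p q where "p = Re a" and "q = Im a"
  have q: "q \<noteq> 0" and a: "a = Complex p q" using assms by (auto simp: p_def q_def)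
  have pos: "(x - p)\<^sup>2 + q\<^sup>2 > 0" using q by (simp add: add_nonneg_pos)
  have 1: "((\<lambda>x. ln ((x - p)\<^sup>2 + q\<^sup>2) / 2) has_real_derivative (x - p) / ((x - p)\<^sup>2 + q\<^sup>2)) (at x)"
    using pos by (auto intro!: derivative_eq_intros simp: divide_simps) (simp_all add: algebra_simps)
  have 2: "((\<lambda>x. arctan ((x - p) / q)) has_real_derivative q / ((x - p)\<^sup>2 + q\<^sup>2)) (at x)"
    using pos q by (auto intro!: derivative_eq_intros simp: divide_simps power2_eq_square)
  have k: "cauchy_kernel a x = Complex ((x - p) / ((x - p)\<^sup>2 + q\<^sup>2)) (q / ((x - p)\<^sup>2 + q\<^sup>2))"
    by (simp add: cauchy_kernel_def a complex_eq_iff Re_divide Im_divide)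
  show ?thesis
    unfolding k cauchy_primitive_def p_def[symmetric] q_def[symmetric]
    unfolding Complex_eq
    by (intro has_vector_derivative_add has_vector_derivative_mult_right has_vector_derivative_of_real 1 2)
qed

text \<open>
  The logarithms of the moduli cancel at infinity, while each arctangent runs through a half turn whose
  direction depends on the half plane containing the pole. This is the source of the residues below.
\<close>

lemma cauchy_primitive_limit:
  assumes "Im a \<noteq> 0" "Im b \<noteq> 0"
  shows "((\<lambda>x. cauchy_primitive a x - cauchy_primitive b x) \<longlongrightarrow> \<i> * (pi / 2 * (sgn (Im a) - sgn (Im b)))) at_top"
    and "((\<lambda>x. cauchy_primitive a x - cauchy_primitive b x) \<longlongrightarrow> - (\<i> * (pi / 2 * (sgn (Im a) - sgn (Im b))))) at_bot"
proof -
  have at: "((\<lambda>x. arctan ((x - p) / q)) \<longlongrightarrow> pi / 2 * sgn q) at_top"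
    "((\<lambda>x. arctan ((x - p) / q)) \<longlongrightarrow> - (pi / 2 * sgn q)) at_bot" if q: "q \<noteq> 0" for p q :: real
  proof -
    consider "q > 0" | "q < 0" using q by linarith
    then have "((\<lambda>x. arctan ((x - p) / q)) \<longlongrightarrow> pi / 2 * sgn q) at_top \<and>
      ((\<lambda>x. arctan ((x - p) / q)) \<longlongrightarrow> - (pi / 2 * sgn q)) at_bot"
    proof cases
      case 1 then show ?thesis using arctan_at_top[of q p] arctan_at_bot[of q p] by simp
    next
      case 2
      have "arctan ((x - p) / q) = - arctan ((x - p) / (- q))" for x by (simp add: arctan_minus[symmetric] del: arctan_minus)
      with 2 show ?thesis
        using tendsto_minus[OF arctan_at_top[of "-q" p]] tendsto_minus[OF arctan_at_bot[of "-q" p]] by simp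
    qed
    then show "((\<lambda>x. arctan ((x - p) / q)) \<longlongrightarrow> pi / 2 * sgn q) at_top"
      "((\<lambda>x. arctan ((x - p) / q)) \<longlongrightarrow> - (pi / 2 * sgn q)) at_bot" by auto
  qed
  define p q p' q' where defs: "p = Re a" "q = Im a" "p' = Re b" "q' = Im b"
  have l: "((\<lambda>x. ln ((x - p)\<^sup>2 + q\<^sup>2) / 2 - ln ((x - p')\<^sup>2 + q'\<^sup>2) / 2) \<longlongrightarrow> 0) at_top"
    "((\<lambda>x. ln ((x - p)\<^sup>2 + q\<^sup>2) / 2 - ln ((x - p')\<^sup>2 + q'\<^sup>2) / 2) \<longlongrightarrow> 0) at_bot"
    by real_asymp+
  have e: "cauchy_primitive a x - cauchy_primitive b x =
     complex_of_real (ln ((x - p)\<^sup>2 + q\<^sup>2) / 2 - ln ((x - p')\<^sup>2 + q'\<^sup>2) / 2)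
      + \<i> * complex_of_real (arctan ((x - p) / q) - arctan ((x - p') / q'))" for x
    by (simp add: cauchy_primitive_def defs complex_eq_iff)
  have "((\<lambda>x. cauchy_primitive a x - cauchy_primitive b x) \<longlongrightarrow>
      complex_of_real 0 + \<i> * complex_of_real (pi / 2 * sgn q - pi / 2 * sgn q')) at_top"
    unfolding e using assms by (intro tendsto_intros l at) (auto simp: defs)
  then show "((\<lambda>x. cauchy_primitive a x - cauchy_primitive b x) \<longlongrightarrow> \<i> * (pi / 2 * (sgn (Im a) - sgn (Im b)))) at_top"
    by (simp add: defs algebra_simps)
  have "((\<lambda>x. cauchy_primitive a x - cauchy_primitive b x) \<longlongrightarrow>
      complex_of_real 0 + \<i> * complex_of_real (- (pi / 2 * sgn q) - - (pi / 2 * sgn q'))) at_bot"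
    unfolding e using assms by (intro tendsto_intros l at) (auto simp: defs)
  then show "((\<lambda>x. cauchy_primitive a x - cauchy_primitive b x) \<longlongrightarrow> - (\<i> * (pi / 2 * (sgn (Im a) - sgn (Im b))))) at_bot"
    by (simp add: defs algebra_simps)
qed

text \<open>
  Residue calculus for two simple poles, by partial fractions and the fundamental theorem of calculus. The
  integral vanishes when both poles lie in the same half plane. All algebraic properties of the regularised
  projections and of the Poisson kernel are instances of this formula.
\<close>

lemma integral_cauchy_kernel_mult:
  assumes a: "Im a \<noteq> 0" and b: "Im b \<noteq> 0"
  shows "integrable lborel (\<lambda>s. cauchy_kernel a s * cauchy_kernel b s)"
    and "a \<noteq> b \<Longrightarrow> (LINT s|lborel. cauchy_kernel a s * cauchy_kernel b s) = \<i> * pi * (sgn (Im a) - sgn (Im b)) / (a - b)"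
    and "a = b \<Longrightarrow> (LINT s|lborel. cauchy_kernel a s * cauchy_kernel b s) = 0"
proof -
  show I: "integrable lborel (\<lambda>s. cauchy_kernel a s * cauchy_kernel b s)"
    by (intro L2_times_integrable(1) L2_cauchy_kernel a b)
  have nz: "complex_of_real s - a \<noteq> 0" "complex_of_real s - b \<noteq> 0" for s
    using a b by (auto simp: complex_eq_iff)
  have cont: "isCont (\<lambda>s. cauchy_kernel a s * cauchy_kernel b s) s" for s
    unfolding cauchy_kernel_def using nz[of s] by (intro continuous_intros) auto
  have *: "(LINT s|lborel. cauchy_kernel a s * cauchy_kernel b s) = B - A"
    if "\<And>x. (F has_vector_derivative (cauchy_kernel a x * cauchy_kernel b x)) (at x)"
       "(F \<longlongrightarrow> A) at_bot" "(F \<longlongrightarrow> B) at_top" for F A B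
  proof -
    have "(LBINT s=-\<infinity>..\<infinity>. cauchy_kernel a s * cauchy_kernel b s) = B - A"
      by (rule interval_integral_FTC_integrable[where F = F])
        (use that cont I in \<open>auto simp: ereal_tendsto_simps set_integrable_def einterval_def\<close>)
    then show ?thesis
      by (simp add: interval_lebesgue_integral_def set_lebesgue_integral_def einterval_def)
  qed
  show "(LINT s|lborel. cauchy_kernel a s * cauchy_kernel b s) = \<i> * pi * (sgn (Im a) - sgn (Im b)) / (a - b)" if "a \<noteq> b"
  proof -
    have k: "cauchy_kernel a x * cauchy_kernel b x = (cauchy_kernel a x - cauchy_kernel b x) / (a - b)" for x
      unfolding cauchy_kernel_def using nz[of x] that by (simp add: divide_simps)
    have "(LINT s|lborel. cauchy_kernel a s * cauchy_kernel b s) =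
      (\<i> * (pi / 2 * (sgn (Im a) - sgn (Im b)))) / (a - b) - (- (\<i> * (pi / 2 * (sgn (Im a) - sgn (Im b))))) / (a - b)"
    proof (rule *[where F = "\<lambda>x. (cauchy_primitive a x - cauchy_primitive b x) / (a - b)"])
      show "((\<lambda>x. (cauchy_primitive a x - cauchy_primitive b x) / (a - b)) has_vector_derivative
          cauchy_kernel a x * cauchy_kernel b x) (at x)" for x
        unfolding k by (intro has_vector_derivative_divide has_vector_derivative_diff cauchy_primitive_deriv a b)
    qed (use that in \<open>intro tendsto_divide cauchy_primitive_limit a b tendsto_const; simp\<close>)+
    also have "\<dots> = \<i> * pi * (sgn (Im a) - sgn (Im b)) / (a - b)"
      using that by (simp add: divide_simps)
    finally show ?thesis .
  qed
  show "(LINT s|lborel. cauchy_kernel a s * cauchy_kernel b s) = 0" if "a = b"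
  proof -
    have d: "((\<lambda>x. - cauchy_kernel a x) has_vector_derivative (cauchy_kernel a x * cauchy_kernel b x)) (at x)" for x
      unfolding cauchy_kernel_def that[symmetric] using nz[of x]
      by (auto intro!: derivative_eq_intros has_vector_derivative_real_field simp: divide_simps power2_eq_square)
    have "((\<lambda>x. 1 / ((x - Re a)\<^sup>2 + (Im a)\<^sup>2)) \<longlongrightarrow> 0) at_top" "((\<lambda>x. 1 / ((x - Re a)\<^sup>2 + (Im a)\<^sup>2)) \<longlongrightarrow> 0) at_bot"
      by real_asymp+
    then have "((\<lambda>x. sqrt ((norm (cauchy_kernel a x))\<^sup>2)) \<longlongrightarrow> sqrt 0) at_top" "((\<lambda>x. sqrt ((norm (cauchy_kernel a x))\<^sup>2)) \<longlongrightarrow> sqrt 0) at_bot"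
      unfolding norm_cauchy_kernel_squared[OF a] by (intro tendsto_real_sqrt; simp)+
    then have "((\<lambda>x. - cauchy_kernel a x) \<longlongrightarrow> 0) at_top" "((\<lambda>x. - cauchy_kernel a x) \<longlongrightarrow> 0) at_bot"
      by (simp_all add: tendsto_norm_zero_iff tendsto_minus_cancel_left[symmetric])
    from *[OF d this(2,1)] show ?thesis by simp
  qed
qed

section \<open>Regularised Szego projections on integrable functions\<close>

definition cauchy_transform :: "(real \<Rightarrow> complex) \<Rightarrow> complex \<Rightarrow> complex" where
  "cauchy_transform f a = (LINT s|lborel. f s * cauchy_kernel a s)"

text \<open>
  The Cauchy integral of \<open>f\<close> at depth \<open>e\<close> below the real line, with the sign for which the limit \<open>e \<rightarrow> 0\<close> is a
  projection: the factor \<open>\<i> / (2 * pi)\<close> is \<open>- 1 / (2 * pi * \<i>)\<close>.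
\<close>

definition hardy :: "real \<Rightarrow> (real \<Rightarrow> complex) \<Rightarrow> real \<Rightarrow> complex" where
  "hardy e f z = \<i> / (2 * pi) * cauchy_transform f (complex_of_real z - \<i> * e)"

lemma cauchy_transform_add:
  assumes "L2 lborel f" "L2 lborel g" "Im a \<noteq> 0"
  shows "cauchy_transform (\<lambda>s. f s + g s) a = cauchy_transform f a + cauchy_transform g a"
  unfolding cauchy_transform_def
  using L2_times_integrable(1)[OF assms(1) L2_cauchy_kernel(1)[OF assms(3)]]
    L2_times_integrable(1)[OF assms(2) L2_cauchy_kernel(1)[OF assms(3)]]
  by (simp add: distrib_right)

lemma cauchy_transform_cmult: "cauchy_transform (\<lambda>s. c * f s) a = c * cauchy_transform f a"
  by (simp add: cauchy_transform_def mult.assoc)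

lemma cauchy_transform_diff:
  assumes "L2 lborel f" "L2 lborel g" "Im a \<noteq> 0"
  shows "cauchy_transform (\<lambda>s. f s - g s) a = cauchy_transform f a - cauchy_transform g a"
  using cauchy_transform_add[OF assms(1) L2_minus[OF assms(2)] assms(3)]
    cauchy_transform_cmult[of "-1" g a] by simp

lemma cauchy_transform_bound:
  assumes "L2 lborel f" "Im a \<noteq> 0"
  shows "norm (cauchy_transform f a) \<le> N2 lborel f * sqrt (pi / \<bar>Im a\<bar>)"
  unfolding cauchy_transform_def
  using L2_times_integrable(2)[OF assms(1) L2_cauchy_kernel(1)[OF assms(2)]]
  by (simp add: L2_cauchy_kernel(2)[OF assms(2)])

lemma hardy_add:
  assumes "L2 lborel f" "L2 lborel g" "e > 0"
  shows "hardy e (\<lambda>s. f s + g s) z = hardy e f z + hardy e g z"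
  using assms by (simp add: hardy_def cauchy_transform_add algebra_simps)

lemma hardy_diff:
  assumes "L2 lborel f" "L2 lborel g" "e > 0"
  shows "hardy e (\<lambda>s. f s - g s) z = hardy e f z - hardy e g z"
  using assms by (simp add: hardy_def cauchy_transform_diff algebra_simps)

lemma hardy_cmult: "hardy e (\<lambda>s. c * f s) z = c * hardy e f z"
  by (simp add: hardy_def cauchy_transform_cmult)

lemma hardy_measurable [measurable]:
  assumes [measurable]: "f \<in> borel_measurable lborel"
  shows "hardy e f \<in> borel_measurable lborel"
proof -
  have "(\<lambda>z. LINT s|lborel. f s * cauchy_kernel (complex_of_real z - \<i> * e) s) \<in> borel_measurable lborel"
    by measurable
  then show ?thesis unfolding hardy_def cauchy_transform_def by simp
qed

text \<open>
  The transpose of the regularised projection evaluates the Cauchy integral above the real line. Integrability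
  of \<open>f\<close> is what makes Fubini's theorem applicable, as the Cauchy kernel itself is only square-integrable.
\<close>

lemma hardy_pairing:
  assumes f: "integrable lborel f" and g: "L2 lborel g" and e: "e > 0"
  shows "(LINT w|lborel. hardy e f w * g w)
       = - \<i> / (2 * pi) * (LINT s|lborel. f s * cauchy_transform g (complex_of_real s + \<i> * e))"
proof -
  have [measurable]: "f \<in> borel_measurable lborel" "g \<in> borel_measurable lborel"
    using f g by (auto simp: L2_def)
  define k where "k s w = f s * (cauchy_kernel (complex_of_real w - \<i> * e) s * g w)" for s w
  have [measurable]: "case_prod k \<in> borel_measurable (lborel \<Otimes>\<^sub>M lborel)"
    unfolding k_def by measurable
  have sw: "cauchy_kernel (complex_of_real w - \<i> * e) s = - cauchy_kernel (complex_of_real s + \<i> * e) w" for s w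
    unfolding cauchy_kernel_def by (metis (no_types, lifting) add.commute diff_diff_eq2 minus_diff_eq minus_divide_right diff_add_eq)
  have Im: "Im (complex_of_real s + \<i> * e) \<noteq> 0" for s using e by simp
  have int_w: "integrable lborel (\<lambda>w. g w * cauchy_kernel (complex_of_real s + \<i> * e) w)" for s
    by (intro L2_times_integrable(1) g L2_cauchy_kernel Im)
  have int_k: "integrable lborel (\<lambda>w. k s w)" for s
    using int_w[of s] unfolding k_def sw by (auto simp: mult.commute)
  have bnd: "(LINT w|lborel. norm (k s w)) \<le> norm (f s) * (N2 lborel g * sqrt (pi / e))" for s
  proof -
    have "(LINT w|lborel. norm (k s w))
        = norm (f s) * (LINT w|lborel. norm (g w) * norm (cauchy_kernel (complex_of_real s + \<i> * e) w))"
      by (simp add: k_def sw norm_mult mult.commute)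
    also have "\<dots> \<le> norm (f s) * (N2 lborel g * N2 lborel (cauchy_kernel (complex_of_real s + \<i> * e)))"
      by (intro mult_left_mono L2_mult_integrable(2) g L2_cauchy_kernel Im) auto
    finally show ?thesis using e by (simp add: L2_cauchy_kernel(2)[OF Im])
  qed
  have int_out: "integrable lborel (\<lambda>s. LINT w|lborel. norm (k s w))"
    by (rule Bochner_Integration.integrable_bound[of lborel "\<lambda>s. norm (f s) * (N2 lborel g * sqrt (pi / e))"])
       (use f bnd in \<open>auto intro!: AE_I2 order_trans[OF _ abs_ge_self]\<close>)
  have K: "integrable (lborel \<Otimes>\<^sub>M lborel) (case_prod k)"
    by (rule lborel_pair.Fubini_integrable) (use int_out int_k in auto)
  have "(LINT s|lborel. k s w) = cauchy_transform f (complex_of_real w - \<i> * e) * g w" for w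
    by (simp add: k_def cauchy_transform_def mult.assoc[symmetric])
  then have "(LINT w|lborel. hardy e f w * g w) = \<i> / (2 * pi) * (LINT w|lborel. LINT s|lborel. k s w)"
    by (simp add: hardy_def mult.assoc)
  also have "(LINT w|lborel. LINT s|lborel. k s w) = (LINT s|lborel. LINT w|lborel. k s w)"
    by (rule lborel_pair.Fubini_integral[OF K])
  also have "(\<lambda>s. LINT w|lborel. k s w) = (\<lambda>s. - (f s * cauchy_transform g (complex_of_real s + \<i> * e)))"
    unfolding k_def sw cauchy_transform_def by (simp add: mult.commute)
  finally show ?thesis by simp
qed

text \<open>
  The function \<open>hardy e f\<close> is, up to a factor, the Cauchy integral of \<open>f\<close> translated upwards by \<open>e\<close>, and thus
  holomorphic in the lower half plane. So its own Cauchy integral reproduces this translate in the lower half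
  plane and vanishes in the upper one.
\<close>

lemma cauchy_transform_hardy_L1:
  assumes f: "integrable lborel f" and e: "e > 0" and a: "Im a \<noteq> 0"
  shows "cauchy_transform (hardy e f) a = (if Im a < 0 then cauchy_transform f (a - \<i> * e) else 0)"
proof -
  have "cauchy_transform (cauchy_kernel a) (complex_of_real s + \<i> * e)
      = (if Im a < 0 then 2 * pi * \<i> * cauchy_kernel (a - \<i> * e) s else 0)" for s
  proof (cases "a = complex_of_real s + \<i> * e")
    case True
    then show ?thesis
      using integral_cauchy_kernel_mult(3)[of a "complex_of_real s + \<i> * e"] a e by (simp add: cauchy_transform_def)
  next
    case False
    have "cauchy_transform (cauchy_kernel a) (complex_of_real s + \<i> * e)
       = \<i> * pi * (sgn (Im a) - sgn (Im (complex_of_real s + \<i> * e))) / (a - (complex_of_real s + \<i> * e))"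
      unfolding cauchy_transform_def using a e False by (intro integral_cauchy_kernel_mult(2)) auto
    also have "\<dots> = (if Im a < 0 then 2 * pi * \<i> * cauchy_kernel (a - \<i> * e) s else 0)"
    proof (cases "Im a < 0")
      case True
      have "a - (complex_of_real s + \<i> * e) = - (complex_of_real s - (a - \<i> * e))" by simp
      moreover have "\<i> * pi * complex_of_real (sgn (Im a) - sgn (Im (complex_of_real s + \<i> * e))) = - (2 * pi * \<i>)"
        using True e by simp
      ultimately show ?thesis using True unfolding cauchy_kernel_def by (simp only: minus_divide_divide) simp
    next
      case False
      then show ?thesis using a e by simp
    qed
    finally show ?thesis .
  qed
  moreover have "cauchy_transform (hardy e f) a
     = - \<i> / (2 * pi) * (LINT s|lborel. f s * cauchy_transform (cauchy_kernel a) (complex_of_real s + \<i> * e))"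
    unfolding cauchy_transform_def[of "hardy e f"]
    by (rule hardy_pairing[OF f L2_cauchy_kernel(1)[OF a] e])
  ultimately show ?thesis
    by (simp add: cauchy_transform_def mult.left_commute[of "f _"])
qed

lemma cauchy_transform_cnj: "cauchy_transform (\<lambda>s. cnj (f s)) (cnj a) = cnj (cauchy_transform f a)"
proof -
  have "cnj (cauchy_transform f a) = (LINT s|lborel. cnj (f s * cauchy_kernel a s))"
    unfolding cauchy_transform_def
    using Bochner_Integration.integral_cnj[of lborel "\<lambda>s. f s * cauchy_kernel a s"] by (rule sym)
  then show ?thesis by (simp add: cauchy_transform_def cauchy_kernel_def)
qed

lemma L2_cnj: "L2 M f \<Longrightarrow> L2 M (\<lambda>s. cnj (f s))"
  unfolding L2_def
  by (auto intro: measurable_compose[OF _ borel_measurable_continuous_onI[OF continuous_on_cnj[OF continuous_on_id]]])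

lemma inner_complex_cnj: "x \<bullet> y = Re (x * cnj y)" for x y :: complex
  by (simp add: inner_complex_def)

lemma ip_complex:
  assumes "L2 M f" "L2 M g"
  shows "ip M f g = Re (LINT s|M. f s * cnj (g s))"
  unfolding ip_def inner_complex_cnj
  by (rule integral_Re) (rule L2_times_integrable(1)[OF assms(1) L2_cnj[OF assms(2)]])

lemma integrable_mult_cauchy_kernel:
  assumes "integrable lborel f" "Im a \<noteq> 0"
  shows "integrable lborel (\<lambda>s. f s * cauchy_kernel a s)"
proof (rule Bochner_Integration.integrable_bound)
  show "integrable lborel (\<lambda>s. norm (f s) * (1 / \<bar>Im a\<bar>))" using assms(1) by simp
  have "norm (f s * cauchy_kernel a s) \<le> norm (f s) * (1 / \<bar>Im a\<bar>)" for s
    unfolding norm_mult by (intro mult_left_mono norm_cauchy_kernel_le assms) simp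
  then show "AE s in lborel. norm (f s * cauchy_kernel a s) \<le> norm (norm (f s) * (1 / \<bar>Im a\<bar>))"
    by (auto intro!: AE_I2)
qed (use assms(1) in auto)

text \<open>
  A crude bound, from Cauchy-Schwarz with the finite measure \<open>\<bar>f s\<bar> ds\<close>. What
  matters for the contraction property is that it stays bounded as \<open>e\<close> grows.
\<close>

lemma hardy_L1_L2:
  assumes f: "integrable lborel f" and e: "e > 0"
  shows "L2 lborel (hardy e f)" "N2 lborel (hardy e f) \<le> (LINT s|lborel. norm (f s)) * sqrt (pi / e)"
proof -
  have [measurable]: "f \<in> borel_measurable lborel" using f by auto
  define A where "A = (LINT s|lborel. norm (f s))"
  have A0: "A \<ge> 0" by (simp add: A_def)
  have A: "(\<integral>\<^sup>+s. ennreal (norm (f s)) \<partial>lborel) = ennreal A"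
    unfolding A_def using f by (intro nn_integral_eq_integral) auto
  define k where "k z s = norm (cauchy_kernel (complex_of_real z - \<i> * e) s)" for z s :: real
  have [measurable]: "case_prod k \<in> borel_measurable (lborel \<Otimes>\<^sub>M lborel)"
    unfolding k_def by measurable
  have ksq: "(k z s)\<^sup>2 = 1 / ((z - s)\<^sup>2 + e\<^sup>2)" for z s
    unfolding k_def using e by (subst norm_cauchy_kernel_squared) (auto simp: power2_commute)
  have kint: "(\<integral>\<^sup>+z. ennreal ((k z s)\<^sup>2) \<partial>lborel) = ennreal (pi / e)" for s
    unfolding ksq using inverse_quadratic_integral[of e s] e
    by (subst nn_integral_eq_integral) auto
  have pt: "ennreal ((norm (hardy e f z))\<^sup>2) \<le> ennreal A * (\<integral>\<^sup>+s. ennreal (norm (f s) * (k z s)\<^sup>2) \<partial>lborel)" for z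
  proof -
    have "norm (hardy e f z) \<le> 1 * norm (cauchy_transform f (complex_of_real z - \<i> * e))"
      unfolding hardy_def norm_mult using pi_gt3 by (intro mult_right_mono) (auto simp: norm_divide norm_mult)
    then have "ennreal (norm (hardy e f z)) \<le> ennreal (norm (cauchy_transform f (complex_of_real z - \<i> * e)))"
      by (simp add: ennreal_leI)
    also have "\<dots> \<le> (\<integral>\<^sup>+s. ennreal (norm (f s * cauchy_kernel (complex_of_real z - \<i> * e) s)) \<partial>lborel)"
      unfolding cauchy_transform_def by (rule integral_norm_bound_ennreal)
        (rule integrable_mult_cauchy_kernel, use f e in auto)
    also have "\<dots> = (\<integral>\<^sup>+s. ennreal (sqrt (norm (f s))) * ennreal (sqrt (norm (f s)) * k z s) \<partial>lborel)"
      by (intro nn_integral_cong) (simp add: norm_mult k_def ennreal_mult[symmetric] mult.assoc[symmetric])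
    finally have "(ennreal (norm (hardy e f z)))\<^sup>2 \<le>
        (\<integral>\<^sup>+s. ennreal (sqrt (norm (f s))) * ennreal (sqrt (norm (f s)) * k z s) \<partial>lborel)\<^sup>2"
      by (rule power_mono) simp
    also have "\<dots> \<le> (\<integral>\<^sup>+s. (ennreal (sqrt (norm (f s))))\<^sup>2 \<partial>lborel) * (\<integral>\<^sup>+s. (ennreal (sqrt (norm (f s)) * k z s))\<^sup>2 \<partial>lborel)"
      by (rule Cauchy_Schwarz_nn_integral) auto
    also have "\<dots> = ennreal A * (\<integral>\<^sup>+s. ennreal (norm (f s) * (k z s)\<^sup>2) \<partial>lborel)"
      by (simp add: ennreal_power A[symmetric] k_def power_mult_distrib)
    finally show ?thesis by (simp add: ennreal_power)
  qed
  have "(\<integral>\<^sup>+z. ennreal ((norm (hardy e f z))\<^sup>2) \<partial>lborel)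
      \<le> (\<integral>\<^sup>+z. ennreal A * (\<integral>\<^sup>+s. ennreal (norm (f s) * (k z s)\<^sup>2) \<partial>lborel) \<partial>lborel)"
    by (intro nn_integral_mono pt)
  also have "\<dots> = ennreal A * (\<integral>\<^sup>+z. (\<integral>\<^sup>+s. ennreal (norm (f s) * (k z s)\<^sup>2) \<partial>lborel) \<partial>lborel)"
    by (rule nn_integral_cmult) measurable
  also have "(\<integral>\<^sup>+z. (\<integral>\<^sup>+s. ennreal (norm (f s) * (k z s)\<^sup>2) \<partial>lborel) \<partial>lborel)
      = (\<integral>\<^sup>+s. (\<integral>\<^sup>+z. ennreal (norm (f s) * (k z s)\<^sup>2) \<partial>lborel) \<partial>lborel)"
    by (rule lborel_pair.Fubini'[symmetric]) measurable
  also have "\<dots> = (\<integral>\<^sup>+s. ennreal (norm (f s)) * ennreal (pi / e) \<partial>lborel)"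
    by (simp add: ennreal_mult nn_integral_cmult kint)
  also have "\<dots> = ennreal A * ennreal (pi / e)"
    by (simp add: nn_integral_multc A)
  also have "ennreal A * (ennreal A * ennreal (pi / e)) = ennreal ((A * sqrt (pi / e))\<^sup>2)"
  proof -
    have "(A * sqrt (pi / e))\<^sup>2 = A\<^sup>2 * (pi / e)" using e by (simp add: power_mult_distrib)
    also have "\<dots> = A * (A * (pi / e))" by (simp add: power2_eq_square)
    finally show ?thesis using A0 e by (simp add: ennreal_mult[symmetric])
  qed
  finally have *: "(\<integral>\<^sup>+z. ennreal ((norm (hardy e f z))\<^sup>2) \<partial>lborel) \<le> ennreal ((A * sqrt (pi / e))\<^sup>2)" .
  have "A * sqrt (pi / e) \<ge> 0" using A0 e by simp
  from L2_nn_bound[OF _ * this]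
  show "L2 lborel (hardy e f)" "N2 lborel (hardy e f) \<le> (LINT s|lborel. norm (f s)) * sqrt (pi / e)"
    by (simp_all add: A_def)
qed

lemma hardy_selfadjoint_L1:
  assumes f: "integrable lborel f" "L2 lborel f" and g: "L2 lborel g" "L2 lborel (hardy e g)" and e: "e > 0"
  shows "ip lborel (hardy e f) g = ip lborel f (hardy e g)"
proof -
  have "cauchy_transform (\<lambda>s. cnj (g s)) (complex_of_real s + \<i> * e)
     = cnj (cauchy_transform g (complex_of_real s - \<i> * e))" for s
    using cauchy_transform_cnj[of g "complex_of_real s - \<i> * e"] by simp
  then have "(LINT w|lborel. hardy e f w * cnj (g w)) = (LINT s|lborel. f s * cnj (hardy e g s))"
    using hardy_pairing[OF f(1) L2_cnj[OF g(1)] e]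
    by (simp add: hardy_def mult.left_commute[of "f _"] )
  then show ?thesis
    using ip_complex[OF hardy_L1_L2(1)[OF f(1) e] g(1)] ip_complex[OF f(2) g(2)] by simp
qed

lemma hardy_hardy_L1:
  assumes f: "integrable lborel f" and "d > 0" "e > 0"
  shows "hardy d (hardy e f) z = hardy (d + e) f z"
proof -
  have *: "complex_of_real z - \<i> * d - \<i> * e = complex_of_real z - \<i> * complex_of_real (d + e)"
    by (simp add: algebra_simps)
  show ?thesis
    using cauchy_transform_hardy_L1[OF f, of e "complex_of_real z - \<i> * d"] assms
    unfolding hardy_def[of d] hardy_def[of "d + e"] * by simp
qed

text \<open>
  If \<open>F > 0\<close> and \<open>u 0 = q F\<close> with \<open>q > 1\<close>, the recursion forces \<open>u k\<close> to grow at least like \<open>F q\<^sup>k\<close>.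
\<close>

lemma squaring_sequence_bound:
  fixes u :: "nat \<Rightarrow> real"
  assumes u: "\<And>k. (u k)\<^sup>2 \<le> F * u (Suc k)" "\<And>k. u k \<le> B" and F: "F \<ge> 0"
  shows "u 0 \<le> F"
proof (rule ccontr)
  assume "\<not> u 0 \<le> F"
  then have gt: "u 0 > F" by simp
  show False
  proof (cases "F = 0")
    case True
    then show ?thesis using u(1)[of 0] gt by simp
  next
    case False
    then have F: "F > 0" using F by simp
    define q where "q = u 0 / F"
    have q: "q > 1" using gt F by (simp add: q_def)
    have *: "F * q ^ Suc k \<le> u k" for k
    proof (induction k)
      case 0 then show ?case using F by (simp add: q_def)
    next
      case (Suc k)
      have "F * (F * q ^ Suc (Suc k)) \<le> F * (F * q ^ (Suc k + Suc k))"
        using F q by (intro mult_left_mono power_increasing) auto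
      also have "\<dots> = (F * q ^ Suc k)\<^sup>2" by (simp add: power2_eq_square power_add algebra_simps)
      also have "\<dots> \<le> (u k)\<^sup>2" using Suc F q by (intro power_mono) auto
      also have "\<dots> \<le> F * u (Suc k)" by (rule u)
      finally show ?case using F by simp
    qed
    obtain k where "B / F < q ^ k" using real_arch_pow[OF q] by blast
    also have "\<dots> \<le> q ^ Suc k" using q by (intro power_increasing) auto
    finally have "B < F * q ^ Suc k" using F by (simp add: divide_less_eq mult.commute)
    then show False using *[of k] u(2)[of k] by simp
  qed
qed

text \<open>
  By self-adjointness and the semigroup law, \<open>\<parallel>S\<^sub>d f\<parallel>\<^sup>2\<close> is the pairing of \<open>f\<close> with \<open>S\<^bsub>2d\<^esub> f\<close>, hence at most
  \<open>\<parallel>f\<parallel> \<parallel>S\<^bsub>2d\<^esub> f\<parallel>\<close>. Repeated doubling of the parameter, together with the a priori bound, removes every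
  constant.
\<close>

lemma hardy_contraction_L1:
  assumes f: "integrable lborel f" "L2 lborel f" and e: "e > 0"
  shows "N2 lborel (hardy e f) \<le> N2 lborel f"
proof -
  define u where "u k = N2 lborel (hardy (2 ^ k * e) f)" for k :: nat
  have pos: "2 ^ k * e > 0" for k :: nat using e by simp
  have "(u k)\<^sup>2 \<le> N2 lborel f * u (Suc k)" for k
  proof -
    let ?d = "2 ^ k * e"
    have L: "L2 lborel (hardy ?d f)" by (rule hardy_L1_L2[OF f(1) pos])
    have hh: "hardy ?d (hardy ?d f) = hardy (2 ^ Suc k * e) f"
      using hardy_hardy_L1[OF f(1) pos pos] by (auto simp: fun_eq_iff algebra_simps)
    have "(u k)\<^sup>2 = ip lborel (hardy ?d f) (hardy ?d f)" by (simp add: u_def ip_self)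
    also have "\<dots> = ip lborel f (hardy (2 ^ Suc k * e) f)"
      unfolding hh[symmetric]
      by (rule hardy_selfadjoint_L1[OF f L _ pos]) (use hardy_L1_L2[OF f(1) pos] hh in metis)
    also have "\<dots> \<le> N2 lborel f * u (Suc k)"
      unfolding u_def using ip_bound[OF f(2) hardy_L1_L2(1)[OF f(1) pos[of "Suc k"]]] by linarith
    finally show ?thesis .
  qed
  moreover have "u k \<le> (LINT s|lborel. norm (f s)) * sqrt (pi / e)" for k
  proof -
    have "u k \<le> (LINT s|lborel. norm (f s)) * sqrt (pi / (2 ^ k * e))"
      unfolding u_def by (rule hardy_L1_L2[OF f(1) pos])
    also have "\<dots> \<le> (LINT s|lborel. norm (f s)) * sqrt (pi / e)"
      using e by (intro mult_left_mono real_sqrt_le_mono divide_left_mono) auto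
    finally show ?thesis .
  qed
  ultimately have "u 0 \<le> N2 lborel f" by (rule squaring_sequence_bound) simp
  then show ?thesis by (simp add: u_def)
qed

section \<open>Regularised Szego projections on square-integrable functions\<close>

text \<open>
  Cutting off at \<open>\<plusminus> n\<close> makes a square-integrable function integrable; all identities proved for integrable
  functions pass to the limit, because the regularised projections are contractions.
\<close>

definition truncate_to :: "nat \<Rightarrow> (real \<Rightarrow> complex) \<Rightarrow> real \<Rightarrow> complex" where
  "truncate_to n f s = indicator {- real n..real n} s * f s"

lemma truncate_to_integrable:
  assumes f: "L2 lborel f"
  shows "integrable lborel (truncate_to n f)" "L2 lborel (truncate_to n f)"
    "N2 lborel (truncate_to n f) \<le> N2 lborel f"
proof -
  have [measurable]: "f \<in> borel_measurable lborel" using f by (rule L2_measurable)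
  have "L2 lborel (indicator {- real n..real n} :: real \<Rightarrow> complex)"
  proof -
    have "integrable lborel (indicator {- real n..real n} :: real \<Rightarrow> real)" by simp
    moreover have "(norm (indicator {- real n..real n} s :: complex))\<^sup>2 = indicator {- real n..real n} s" for s
      by (simp add: indicator_def)
    ultimately show ?thesis by (simp add: L2_def)
  qed
  from L2_times_integrable(1)[OF this f] show "integrable lborel (truncate_to n f)"
    by (simp add: truncate_to_def[abs_def])
  have "truncate_to n f \<in> borel_measurable lborel" unfolding truncate_to_def[abs_def] by measurable
  moreover have "AE s in lborel. norm (truncate_to n f s) \<le> 1 * norm (f s)"
    by (auto simp: truncate_to_def indicator_def)
  ultimately show "L2 lborel (truncate_to n f)" "N2 lborel (truncate_to n f) \<le> N2 lborel f"
    using L2_mono[of "truncate_to n f" lborel f 1] f by auto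
qed

lemma truncate_to_tendsto:
  assumes f: "L2 lborel f"
  shows "(\<lambda>n. N2 lborel (\<lambda>s. truncate_to n f s - f s)) \<longlonglongrightarrow> 0"
proof -
  have [measurable]: "f \<in> borel_measurable lborel" using f by (rule L2_measurable)
  have "(\<lambda>n. LINT s|lborel. (norm (truncate_to n f s - f s))\<^sup>2) \<longlonglongrightarrow> (LINT (s::real)|lborel. (0::real))"
  proof (rule Bochner_Integration.integral_dominated_convergence[where w = "\<lambda>s. (norm (f s))\<^sup>2"])
    show "integrable lborel (\<lambda>s. (norm (f s))\<^sup>2)" by (rule L2_integrable[OF f])
    show "AE s in lborel. norm ((norm (truncate_to n f s - f s))\<^sup>2) \<le> (norm (f s))\<^sup>2" for n
      by (auto simp: truncate_to_def indicator_def)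
    show "AE s in lborel. (\<lambda>n. (norm (truncate_to n f s - f s))\<^sup>2) \<longlonglongrightarrow> 0"
    proof (rule AE_I2)
      fix s :: real
      obtain N where N: "\<bar>s\<bar> \<le> real N" using real_arch_simple by blast
      have "\<forall>\<^sub>F n in sequentially. (norm (truncate_to n f s - f s))\<^sup>2 = 0"
        using eventually_ge_at_top[of N]
      proof eventually_elim
        case (elim n)
        then have "s \<in> {- real n..real n}" using N by auto
        then show ?case by (simp add: truncate_to_def)
      qed
      then show "(\<lambda>n. (norm (truncate_to n f s - f s))\<^sup>2) \<longlonglongrightarrow> 0" by (rule tendsto_eventually)
    qed
  qed (auto simp: truncate_to_def[abs_def])
  then have "(\<lambda>n. sqrt (LINT s|lborel. (norm (truncate_to n f s - f s))\<^sup>2)) \<longlonglongrightarrow> sqrt 0"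
    by (intro tendsto_real_sqrt) simp
  then show ?thesis by (simp add: N2_def)
qed

lemma cauchy_transform_tendsto:
  assumes "\<And>n. L2 lborel (g n)" "L2 lborel f" "Im a \<noteq> 0"
    and "((\<lambda>n. N2 lborel (\<lambda>s. g n s - f s)) \<longlongrightarrow> 0) F"
  shows "((\<lambda>n. cauchy_transform (g n) a) \<longlongrightarrow> cauchy_transform f a) F"
proof -
  have "((\<lambda>n. N2 lborel (\<lambda>s. g n s - f s) * sqrt (pi / \<bar>Im a\<bar>)) \<longlongrightarrow> 0) F"
    by (rule tendsto_mult_left_zero[OF assms(4)])
  then have "((\<lambda>n. cauchy_transform (g n) a - cauchy_transform f a) \<longlongrightarrow> 0) F"
    by (rule Lim_null_comparison[rotated])
      (simp add: cauchy_transform_diff[symmetric] assms cauchy_transform_bound L2_diff)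
  then show ?thesis by (simp add: LIM_zero_iff)
qed

lemma hardy_tendsto:
  assumes "\<And>n. L2 lborel (g n)" "L2 lborel f" "e > 0"
    and "((\<lambda>n. N2 lborel (\<lambda>s. g n s - f s)) \<longlongrightarrow> 0) F"
  shows "((\<lambda>n. hardy e (g n) z) \<longlongrightarrow> hardy e f z) F"
  unfolding hardy_def
  by (intro tendsto_intros cauchy_transform_tendsto) (use assms in auto)

lemma ip_tendsto_left:
  assumes "\<And>n. L2 M (g n)" "L2 M f" "L2 M h"
    and "((\<lambda>n. N2 M (\<lambda>s. g n s - f s)) \<longlongrightarrow> 0) F"
  shows "((\<lambda>n. ip M (g n) h) \<longlongrightarrow> ip M f h) F"
proof -
  have "((\<lambda>n. N2 M (\<lambda>s. g n s - f s) * N2 M h) \<longlongrightarrow> 0) F"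
    by (rule tendsto_mult_left_zero[OF assms(4)])
  then have "((\<lambda>n. ip M (g n) h - ip M f h) \<longlongrightarrow> 0) F"
    by (rule Lim_null_comparison[rotated])
      (simp add: ip_diff_left[symmetric] assms ip_bound L2_diff)
  then show ?thesis by (simp add: LIM_zero_iff)
qed

lemma hardy_contraction:
  assumes f: "L2 lborel f" and e: "e > 0"
  shows "L2 lborel (hardy e f)" "N2 lborel (hardy e f) \<le> N2 lborel f"
proof -
  have m: "hardy e f \<in> borel_measurable lborel" using L2_measurable[OF f] by measurable
  have a: "AE z in lborel. (\<lambda>n. hardy e (truncate_to n f) z) \<longlonglongrightarrow> hardy e f z"
    by (intro AE_I2 hardy_tendsto truncate_to_integrable truncate_to_tendsto f e)
  have b: "\<forall>\<^sub>F n in sequentially. N2 lborel (hardy e (truncate_to n f)) \<le> N2 lborel f"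
    by (intro always_eventually allI order_trans[OF hardy_contraction_L1[OF truncate_to_integrable(1,2)[OF f] e] truncate_to_integrable(3)[OF f]])
  show "L2 lborel (hardy e f)" "N2 lborel (hardy e f) \<le> N2 lborel f"
    using L2_Fatou[OF hardy_L1_L2(1)[OF truncate_to_integrable(1)[OF f] e] m a b] by auto
qed

lemma hardy_tendsto_L2:
  assumes "\<And>n. L2 lborel (g n)" "L2 lborel f" "e > 0"
    and "((\<lambda>n. N2 lborel (\<lambda>s. g n s - f s)) \<longlongrightarrow> 0) F"
  shows "((\<lambda>n. N2 lborel (\<lambda>z. hardy e (g n) z - hardy e f z)) \<longlongrightarrow> 0) F"
proof -
  have "N2 lborel (\<lambda>z. hardy e (g n) z - hardy e f z) \<le> N2 lborel (\<lambda>s. g n s - f s)" for n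
  proof -
    have "(\<lambda>z. hardy e (g n) z - hardy e f z) = hardy e (\<lambda>s. g n s - f s)"
      using assms by (simp add: fun_eq_iff hardy_diff)
    then show ?thesis using hardy_contraction(2)[OF L2_diff[OF assms(1,2)] assms(3)] by simp
  qed
  then show ?thesis by (intro Lim_null_comparison[OF _ assms(4)]) simp
qed

lemma cauchy_transform_hardy:
  assumes f: "L2 lborel f" and e: "e > 0" and a: "Im a \<noteq> 0"
  shows "cauchy_transform (hardy e f) a = (if Im a < 0 then cauchy_transform f (a - \<i> * e) else 0)"
proof (rule LIMSEQ_unique)
  note t = truncate_to_integrable[OF f] truncate_to_tendsto[OF f]
  show "(\<lambda>n. cauchy_transform (hardy e (truncate_to n f)) a) \<longlonglongrightarrow> cauchy_transform (hardy e f) a"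
    by (intro cauchy_transform_tendsto hardy_tendsto_L2 hardy_contraction t f e a)
  have "(\<lambda>n. cauchy_transform (truncate_to n f) (a - \<i> * e)) \<longlonglongrightarrow> cauchy_transform f (a - \<i> * e)" if "Im a < 0"
    by (intro cauchy_transform_tendsto t f) (use that e in auto)
  then show "(\<lambda>n. cauchy_transform (hardy e (truncate_to n f)) a) \<longlonglongrightarrow>
      (if Im a < 0 then cauchy_transform f (a - \<i> * e) else 0)"
    by (simp add: cauchy_transform_hardy_L1[OF t(1) e a])
qed

lemma hardy_hardy:
  assumes f: "L2 lborel f" and "d > 0" "e > 0"
  shows "hardy d (hardy e f) z = hardy (d + e) f z"
proof -
  have *: "complex_of_real z - \<i> * d - \<i> * e = complex_of_real z - \<i> * complex_of_real (d + e)"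
    by (simp add: algebra_simps)
  show ?thesis
    using cauchy_transform_hardy[OF f, of e "complex_of_real z - \<i> * d"] assms
    unfolding hardy_def[of d] hardy_def[of "d + e"] * by simp
qed

lemma hardy_selfadjoint:
  assumes f: "L2 lborel f" and g: "L2 lborel g" and e: "e > 0"
  shows "ip lborel (hardy e f) g = ip lborel f (hardy e g)"
proof (rule LIMSEQ_unique)
  note t = truncate_to_integrable[OF f] truncate_to_tendsto[OF f]
  show "(\<lambda>n. ip lborel (hardy e (truncate_to n f)) g) \<longlonglongrightarrow> ip lborel (hardy e f) g"
    by (intro ip_tendsto_left hardy_tendsto_L2 hardy_contraction t f e g)
  have "(\<lambda>n. ip lborel (truncate_to n f) (hardy e g)) \<longlonglongrightarrow> ip lborel f (hardy e g)"
    by (intro ip_tendsto_left t f hardy_contraction g e)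
  then show "(\<lambda>n. ip lborel (hardy e (truncate_to n f)) g) \<longlonglongrightarrow> ip lborel f (hardy e g)"
    by (simp add: hardy_selfadjoint_L1[OF t(1,2) g hardy_contraction(1)[OF g e] e])
qed

lemma hardy_inner_hardy:
  assumes f: "L2 lborel f" and "d > 0" "e > 0"
  shows "ip lborel (hardy d f) (hardy e f) = ip lborel f (hardy (d + e) f)"
proof -
  have "hardy d (hardy e f) = hardy (d + e) f" using hardy_hardy[OF assms] by (rule ext)
  then show ?thesis
    using hardy_selfadjoint[OF f hardy_contraction(1)[OF f \<open>e > 0\<close>] \<open>d > 0\<close>] by simp
qed

text \<open>
  The pairing equals \<open>\<parallel>S\<^bsub>t/2\<^esub> f\<parallel>\<^sup>2\<close>, and \<open>S\<^bsub>t/2\<^esub>\<close> is \<open>S\<^bsub>s/2\<^esub>\<close> followed by a contraction.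
\<close>

lemma hardy_energy_antimono:
  assumes f: "L2 lborel f" and "0 < s" "s \<le> t"
  shows "ip lborel f (hardy t f) \<le> ip lborel f (hardy s f)"
proof (cases "s = t")
  case False
  have sq: "ip lborel f (hardy u f) = (N2 lborel (hardy (u / 2) f))\<^sup>2" if "u > 0" for u
    using hardy_inner_hardy[OF f, of "u / 2" "u / 2"] that by (simp add: ip_self[symmetric])
  have "hardy (t / 2) f = hardy (t / 2 - s / 2) (hardy (s / 2) f)"
    using hardy_hardy[OF f, of "t / 2 - s / 2" "s / 2"] False assms by auto
  then have "N2 lborel (hardy (t / 2) f) \<le> N2 lborel (hardy (s / 2) f)"
    using False assms hardy_contraction(2)[OF hardy_contraction(1)[OF f, of "s / 2"], of "t / 2 - s / 2"] by auto
  then show ?thesis using assms by (simp add: sq power_mono)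
qed simp

text \<open>
  With \<open>\<phi> t\<close> the pairing of \<open>f\<close> with \<open>S\<^sub>t f\<close>, the squared distance of \<open>S\<^sub>s f\<close> and \<open>S\<^sub>t f\<close> is
  \<open>\<phi> (2 s) - 2 \<phi> (s + t) + \<phi> (2 t)\<close>. As \<open>\<phi>\<close> is monotone and bounded, it has a limit at \<open>0\<close>, and this second
  difference tends to \<open>0\<close>.
\<close>

lemma hardy_limit_L2:
  assumes f: "L2 lborel f"
  shows "\<exists>g. L2 lborel g \<and> ((\<lambda>e. N2 lborel (\<lambda>z. hardy e f z - g z)) \<longlongrightarrow> 0) (at_right 0)"
proof -
  define \<phi> where "\<phi> t = ip lborel f (hardy t f)" for t
  define l where "l = (SUP t\<in>{0<..}. \<phi> t)"
  have anti: "\<phi> t \<le> \<phi> s" if "0 < s" "s \<le> t" for s t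
    unfolding \<phi>_def using hardy_energy_antimono[OF f that] .
  have bdd: "bdd_above (\<phi> ` {0<..})"
  proof (rule bdd_aboveI2)
    fix t :: real assume "t \<in> {0<..}"
    then have "\<phi> t \<le> N2 lborel f * N2 lborel (hardy t f)"
      unfolding \<phi>_def using ip_bound[OF f hardy_contraction(1)[OF f]] by fastforce
    also have "\<dots> \<le> N2 lborel f * N2 lborel f"
      using \<open>t \<in> {0<..}\<close> by (intro mult_left_mono hardy_contraction f) auto
    finally show "\<phi> t \<le> N2 lborel f * N2 lborel f" .
  qed
  have le_l: "\<phi> t \<le> l" if "t > 0" for t
    unfolding l_def using that by (intro cSUP_upper bdd) auto
  have near: "\<exists>t0>0. \<forall>t. 0 < t \<and> t \<le> t0 \<longrightarrow> l - \<phi> t < e" if "e > 0" for e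
  proof -
    obtain t0 where "t0 > 0" "l - e < \<phi> t0"
      using less_cSUP_iff[OF _ bdd, of "l - e"] \<open>e > 0\<close> by (auto simp: l_def[symmetric])
    then show ?thesis using anti by (intro exI[of _ t0]) (force simp: algebra_simps)
  qed
  have dist: "(N2 lborel (\<lambda>z. hardy s f z - hardy t f z))\<^sup>2 = \<phi> (2 * s) - 2 * \<phi> (s + t) + \<phi> (2 * t)"
    if "s > 0" "t > 0" for s t
    using N2_diff_squared[OF hardy_contraction(1)[OF f that(1)] hardy_contraction(1)[OF f that(2)]]
      hardy_inner_hardy[OF f that(1) that(1)] hardy_inner_hardy[OF f that(2) that(2)] hardy_inner_hardy[OF f that]
    by (simp add: ip_self \<phi>_def)
  have cauchy: "\<exists>t0>0. \<forall>s t. 0 < s \<and> s \<le> t0 \<and> 0 < t \<and> t \<le> t0 \<longrightarrow> N2 lborel (\<lambda>z. hardy s f z - hardy t f z) < e"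
    if e: "e > 0" for e
  proof -
    obtain t0 where t0: "t0 > 0" "\<And>t. 0 < t \<Longrightarrow> t \<le> t0 \<Longrightarrow> l - \<phi> t < e\<^sup>2 / 2"
      using near[of "e\<^sup>2 / 2"] e by auto
    have "N2 lborel (\<lambda>z. hardy s f z - hardy t f z) < e" if st: "0 < s" "s \<le> t0 / 2" "0 < t" "t \<le> t0 / 2" for s t
    proof (rule power2_less_imp_less)
      have "l - \<phi> (s + t) < e\<^sup>2 / 2" using st by (intro t0(2)) auto
      moreover have "\<phi> (2 * s) \<le> l" "\<phi> (2 * t) \<le> l" using st by (auto intro!: le_l)
      ultimately show "(N2 lborel (\<lambda>z. hardy s f z - hardy t f z))\<^sup>2 < e\<^sup>2"
        unfolding dist[OF st(1,3)] by linarith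
    qed (use e in auto)
    then show ?thesis using t0(1) by (intro exI[of _ "t0 / 2"]) auto
  qed
  define h where "h n = hardy (1 / real (Suc n)) f" for n
  have hL: "L2 lborel (h n)" for n unfolding h_def by (intro hardy_contraction f) simp
  have inv: "\<exists>N. \<forall>n\<ge>N. 1 / real (Suc n) \<le> t0" if "t0 > 0" for t0 :: real
  proof -
    obtain N where "inverse (real (Suc N)) < t0" using reals_Archimedean[OF \<open>t0 > 0\<close>] by blast
    moreover have "1 / real (Suc n) \<le> inverse (real (Suc N))" if "n \<ge> N" for n
      using that by (simp add: divide_simps)
    ultimately show ?thesis by (intro exI[of _ N]) (auto intro: order_trans less_imp_le)
  qed
  have "\<exists>N. \<forall>m\<ge>N. \<forall>n\<ge>N. N2 lborel (\<lambda>x. h m x - h n x) < e" if e: "e > 0" for e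
  proof -
    obtain t0 where t0: "t0 > 0" "\<And>s t. 0 < s \<Longrightarrow> s \<le> t0 \<Longrightarrow> 0 < t \<Longrightarrow> t \<le> t0 \<Longrightarrow> N2 lborel (\<lambda>z. hardy s f z - hardy t f z) < e"
      using cauchy[OF e] by blast
    obtain N where "\<forall>n\<ge>N. 1 / real (Suc n) \<le> t0" using inv[OF t0(1)] by blast
    then show ?thesis unfolding h_def by (intro exI[of _ N]) (auto intro!: t0(2))
  qed
  moreover have "L2 lborel (\<lambda>x. norm (cauchy_kernel \<i> x))" by (intro L2_norm L2_cauchy_kernel) simp
  moreover have "norm (cauchy_kernel \<i> x) > 0" for x
  proof -
    have "complex_of_real x - \<i> \<noteq> 0" by (simp add: complex_eq_iff)
    then show ?thesis by (simp add: cauchy_kernel_def)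
  qed
  ultimately obtain g where g: "L2 lborel g" and hg: "(\<lambda>n. N2 lborel (\<lambda>x. h n x - g x)) \<longlonglongrightarrow> 0"
    using L2_complete[of lborel h "\<lambda>x. norm (cauchy_kernel \<i> x)"] hL by blast
  have "((\<lambda>e. N2 lborel (\<lambda>z. hardy e f z - g z)) \<longlongrightarrow> 0) (at_right 0)"
  proof (rule tendstoI)
    fix e :: real assume e: "e > 0"
    obtain t0 where t0: "t0 > 0" "\<And>s t. 0 < s \<Longrightarrow> s \<le> t0 \<Longrightarrow> 0 < t \<Longrightarrow> t \<le> t0 \<Longrightarrow> N2 lborel (\<lambda>z. hardy s f z - hardy t f z) < e / 2"
      using cauchy[of "e / 2"] e by auto
    obtain N where N: "\<forall>n\<ge>N. 1 / real (Suc n) \<le> t0" using inv[OF t0(1)] by blast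
    have "\<forall>\<^sub>F n in sequentially. N2 lborel (\<lambda>x. h n x - g x) < e / 2"
      using order_tendstoD(2)[OF hg, of "e / 2"] e by simp
    then obtain n where n: "n \<ge> N" "N2 lborel (\<lambda>x. h n x - g x) < e / 2"
      using eventually_happens'[OF _ eventually_conj[OF eventually_ge_at_top[of N]]] by (auto simp: eventually_sequentially)
    have "dist (N2 lborel (\<lambda>z. hardy s f z - g z)) 0 < e" if s: "0 < s" "s < t0" for s
    proof -
      have "N2 lborel (\<lambda>z. hardy s f z - g z) = N2 lborel (\<lambda>z. (hardy s f z - h n z) + (h n z - g z))" by simp
      also have "\<dots> \<le> N2 lborel (\<lambda>z. hardy s f z - h n z) + N2 lborel (\<lambda>z. h n z - g z)"
        by (intro N2_triangle L2_diff hL g hardy_contraction f s)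
      also have "N2 lborel (\<lambda>z. hardy s f z - h n z) < e / 2"
        unfolding h_def using s n(1) N by (intro t0(2)) auto
      finally show ?thesis using n(2) by simp
    qed
    then show "\<forall>\<^sub>F x in at_right 0. dist (N2 lborel (\<lambda>z. hardy x f z - g z)) 0 < e"
      unfolding eventually_at_right_field using t0(1) by blast
  qed
  with g show ?thesis by blast
qed

section \<open>The Poisson kernel\<close>

definition poisson_kernel :: "real \<Rightarrow> real \<Rightarrow> real" where
  "poisson_kernel t u = t / (pi * (u\<^sup>2 + t\<^sup>2))"

text \<open>
  Poisson integrals of nonnegative functions are taken with values in \<open>ennreal\<close>, so that Tonelli's theorem and
  monotone limits apply unconditionally.
\<close>

definition poisson :: "real \<Rightarrow> (real \<Rightarrow> ennreal) \<Rightarrow> real \<Rightarrow> ennreal" where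
  "poisson t f x = (\<integral>\<^sup>+s. ennreal (poisson_kernel t (x - s)) * f s \<partial>lborel)"

lemma poisson_kernel_measurable [measurable]:
  assumes [measurable]: "f \<in> borel_measurable M" "g \<in> borel_measurable M"
  shows "(\<lambda>x. poisson_kernel (f x) (g x)) \<in> borel_measurable M"
  unfolding poisson_kernel_def by measurable

lemma poisson_kernel_nonneg: "t \<ge> 0 \<Longrightarrow> 0 \<le> poisson_kernel t u"
  by (simp add: poisson_kernel_def)

lemma poisson_kernel_commute: "poisson_kernel t (x - y) = poisson_kernel t (y - x)"
  by (simp add: poisson_kernel_def power2_commute)

lemma poisson_measurable [measurable]:
  assumes [measurable]: "\<tau> \<in> borel_measurable lborel" "f \<in> borel_measurable lborel"
  shows "(\<lambda>x. poisson (\<tau> x) f x) \<in> borel_measurable lborel"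
  unfolding poisson_def by measurable

lemma poisson_kernel_integral:
  assumes "t > 0" shows "(\<integral>\<^sup>+s. ennreal (poisson_kernel t (x - s)) \<partial>lborel) = 1"
proof -
  have e: "poisson_kernel t (x - s) = t / pi * (1 / ((s - x)\<^sup>2 + t\<^sup>2))" for s
    by (simp add: poisson_kernel_def power2_commute)
  have "(\<integral>\<^sup>+s. ennreal (poisson_kernel t (x - s)) \<partial>lborel) = ennreal (LINT s|lborel. poisson_kernel t (x - s))"
  proof (rule nn_integral_eq_integral)
    show "integrable lborel (\<lambda>s. poisson_kernel t (x - s))"
      unfolding e using assms by (intro integrable_mult_right inverse_quadratic_integral(1)) simp
  qed (use assms in \<open>simp add: poisson_kernel_nonneg\<close>)
  also have "\<dots> = 1" using assms by (simp only: e integral_mult_right_zero inverse_quadratic_integral(2)) simp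
  finally show ?thesis .
qed

lemma poisson_kernel_cauchy:
  assumes "t > 0"
  shows "complex_of_real (poisson_kernel t (x - s)) =
    (cauchy_kernel (complex_of_real x + \<i> * t) s - cauchy_kernel (complex_of_real x - \<i> * t) s) / (2 * pi * \<i>)"
proof -
  define d where "d = s - x"
  have nz: "complex_of_real d - \<i> * t \<noteq> 0" "complex_of_real d + \<i> * t \<noteq> 0"
    using assms by (auto simp: complex_eq_iff)
  have "(complex_of_real d - \<i> * t) * (complex_of_real d + \<i> * t) = complex_of_real (d\<^sup>2 + t\<^sup>2)"
    by (simp add: algebra_simps power2_eq_square)
  moreover have "1 / (complex_of_real d - \<i> * t) - 1 / (complex_of_real d + \<i> * t)
    = 2 * \<i> * t / ((complex_of_real d - \<i> * t) * (complex_of_real d + \<i> * t))"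
    using nz by (simp add: divide_simps)
  moreover have k: "cauchy_kernel (complex_of_real x + \<i> * t) s = 1 / (complex_of_real d - \<i> * t)"
     "cauchy_kernel (complex_of_real x - \<i> * t) s = 1 / (complex_of_real d + \<i> * t)"
    by (simp_all add: cauchy_kernel_def d_def algebra_simps)
  moreover have "poisson_kernel t (x - s) = t / (pi * (d\<^sup>2 + t\<^sup>2))"
    by (simp add: poisson_kernel_def d_def power2_commute)
  ultimately show ?thesis unfolding k by simp
qed

text \<open>
  The semigroup law. Of the four products of Cauchy kernels only the two with poles on opposite sides
  contribute.
\<close>

lemma poisson_kernel_convolution:
  assumes "a > 0" "b > 0"
  shows "(\<integral>\<^sup>+u. ennreal (poisson_kernel a (x - u)) * ennreal (poisson_kernel b (y - u)) \<partial>lborel)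
     = ennreal (poisson_kernel (a + b) (x - y))"
proof -
  let ?xp = "complex_of_real x + \<i> * a" and ?xm = "complex_of_real x - \<i> * a"
  let ?yp = "complex_of_real y + \<i> * b" and ?ym = "complex_of_real y - \<i> * b"
  let ?I = "\<lambda>p q. LINT u|lborel. cauchy_kernel p u * cauchy_kernel q u"
  have int: "integrable lborel (\<lambda>u. cauchy_kernel p u * cauchy_kernel q u)" if "Im p \<noteq> 0" "Im q \<noteq> 0" for p q
    using integral_cauchy_kernel_mult(1)[OF that] .
  have e: "complex_of_real (poisson_kernel a (x - u) * poisson_kernel b (y - u)) =
    - 1 / (4 * pi\<^sup>2) * (cauchy_kernel ?xp u * cauchy_kernel ?yp u - cauchy_kernel ?xp u * cauchy_kernel ?ym u
      - cauchy_kernel ?xm u * cauchy_kernel ?yp u + cauchy_kernel ?xm u * cauchy_kernel ?ym u)" for u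
    using assms by (simp add: poisson_kernel_cauchy power2_eq_square field_simps)
  have ic: "integrable lborel (\<lambda>u. complex_of_real (poisson_kernel a (x - u) * poisson_kernel b (y - u)))"
    unfolding e using assms
    by (intro integrable_mult_right Bochner_Integration.integrable_add Bochner_Integration.integrable_diff int)
      simp_all
  then have i: "integrable lborel (\<lambda>u. poisson_kernel a (x - u) * poisson_kernel b (y - u))"
    using integrable_Re[OF ic] by simp
  have same: "?I p q = 0" if "Im p \<noteq> 0" "Im q \<noteq> 0" "sgn (Im p) = sgn (Im q)" for p q
    using integral_cauchy_kernel_mult(2,3)[OF that(1,2)] that(3) by (cases "p = q") auto
  have "complex_of_real (LINT u|lborel. poisson_kernel a (x - u) * poisson_kernel b (y - u))
     = - 1 / (4 * pi\<^sup>2) * (?I ?xp ?yp - ?I ?xp ?ym - ?I ?xm ?yp + ?I ?xm ?ym)"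
    unfolding integral_complex_of_real[symmetric] e integral_mult_right_zero
    using assms
    by (simp add: int Bochner_Integration.integrable_diff Bochner_Integration.integral_add Bochner_Integration.integral_diff)
  also have "?I ?xp ?yp = 0" using assms by (intro same) auto
  also have "?I ?xm ?ym = 0" using assms by (intro same) auto
  also have "?I ?xp ?ym = \<i> * pi * (sgn (Im ?xp) - sgn (Im ?ym)) / (?xp - ?ym)"
    using assms by (intro integral_cauchy_kernel_mult(2)) (auto simp: complex_eq_iff)
  also have "\<dots> = 2 * pi * \<i> * cauchy_kernel (complex_of_real y - \<i> * (a + b)) x"
    using assms by (simp add: cauchy_kernel_def algebra_simps)
  also have "?I ?xm ?yp = \<i> * pi * (sgn (Im ?xm) - sgn (Im ?yp)) / (?xm - ?yp)"
    using assms by (intro integral_cauchy_kernel_mult(2)) (auto simp: complex_eq_iff)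
  also have "\<dots> = - 2 * pi * \<i> * cauchy_kernel (complex_of_real y + \<i> * (a + b)) x"
    using assms by (simp add: cauchy_kernel_def algebra_simps)
  also have "- 1 / (4 * pi\<^sup>2) * (0 - 2 * pi * \<i> * cauchy_kernel (complex_of_real y - \<i> * (a + b)) x
      - - 2 * pi * \<i> * cauchy_kernel (complex_of_real y + \<i> * (a + b)) x + 0)
     = - 1 / (4 * pi\<^sup>2) * (2 * pi * \<i> * (cauchy_kernel (complex_of_real y + \<i> * (a + b)) x
          - cauchy_kernel (complex_of_real y - \<i> * (a + b)) x))"
    by (simp add: algebra_simps)
  also have "cauchy_kernel (complex_of_real y + \<i> * (a + b)) x - cauchy_kernel (complex_of_real y - \<i> * (a + b)) x
     = 2 * pi * \<i> * complex_of_real (poisson_kernel (a + b) (y - x))"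
    using assms poisson_kernel_cauchy[of "a + b" y x] by simp
  also have "- 1 / (4 * pi\<^sup>2) * (2 * pi * \<i> * (2 * pi * \<i> * complex_of_real (poisson_kernel (a + b) (y - x))))
     = complex_of_real (poisson_kernel (a + b) (y - x))"
    by (simp add: power2_eq_square divide_simps)
  finally have "(LINT u|lborel. poisson_kernel a (x - u) * poisson_kernel b (y - u)) = poisson_kernel (a + b) (x - y)"
    unfolding of_real_eq_iff by (simp add: poisson_kernel_commute[of _ y])
  moreover have "(\<integral>\<^sup>+u. ennreal (poisson_kernel a (x - u) * poisson_kernel b (y - u)) \<partial>lborel)
     = ennreal (LINT u|lborel. poisson_kernel a (x - u) * poisson_kernel b (y - u))"
    using assms by (intro nn_integral_eq_integral i) (auto simp: poisson_kernel_nonneg)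
  ultimately show ?thesis using assms by (simp add: ennreal_mult poisson_kernel_nonneg)
qed

text \<open>
  Comparison of kernels with comparable parameters. It allows a continuum of parameters to be
  replaced by a sequence, and bounds the kernel of \<open>T T\<^sup>*\<close> in the maximal inequality.
\<close>

lemma poisson_kernel_le:
  assumes "0 < s" "0 < t"
  shows "poisson_kernel s u \<le> max (s / t) (t / s) * poisson_kernel t u"
proof -
  define m where "m = max (s / t) (t / s)"
  have m: "s / t \<le> m" "t / s \<le> m" by (auto simp: m_def)
  have "s * u\<^sup>2 \<le> m * t * u\<^sup>2" using m(1) assms by (intro mult_right_mono) (auto simp: field_simps)
  moreover have "s * t\<^sup>2 \<le> m * t * s\<^sup>2"
  proof -
    have "t \<le> m * s" using m(2) assms by (simp add: field_simps)
    then have "t * (s * t) \<le> (m * s) * (s * t)" using assms by (intro mult_right_mono) auto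
    then show ?thesis by (simp add: power2_eq_square algebra_simps)
  qed
  ultimately have "s * (u\<^sup>2 + t\<^sup>2) \<le> m * t * (u\<^sup>2 + s\<^sup>2)" by (simp add: algebra_simps)
  then have "s / (u\<^sup>2 + s\<^sup>2) \<le> m * t / (u\<^sup>2 + t\<^sup>2)"
    using assms by (simp add: divide_simps add_nonneg_pos)
  then have "s / (u\<^sup>2 + s\<^sup>2) / pi \<le> m * t / (u\<^sup>2 + t\<^sup>2) / pi" by (intro divide_right_mono) auto
  then show ?thesis unfolding m_def[symmetric] poisson_kernel_def by (simp add: mult.commute)
qed

lemma poisson_le:
  assumes "0 < s" "0 < t" "s \<le> c * t" "t \<le> c * s" and [measurable]: "f \<in> borel_measurable lborel"
  shows "poisson s f x \<le> ennreal c * poisson t f x"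
proof -
  have c: "max (s / t) (t / s) \<le> c" using assms(1-4) by (simp add: field_simps)
  then have "0 \<le> c" using assms(1,2) by (smt (verit) divide_pos_pos max.cobounded1)
  have "poisson s f x \<le> (\<integral>\<^sup>+y. ennreal c * (ennreal (poisson_kernel t (x - y)) * f y) \<partial>lborel)"
    unfolding poisson_def
  proof (rule nn_integral_mono)
    fix y
    have "poisson_kernel s (x - y) \<le> c * poisson_kernel t (x - y)"
      using assms(1,2) by (intro order_trans[OF poisson_kernel_le[of s t]] mult_right_mono c poisson_kernel_nonneg) auto
    then have "ennreal (poisson_kernel s (x - y)) \<le> ennreal c * ennreal (poisson_kernel t (x - y))"
      using \<open>0 \<le> c\<close> assms(2) by (simp add: ennreal_mult[symmetric] poisson_kernel_nonneg ennreal_leI)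
    then show "ennreal (poisson_kernel s (x - y)) * f y \<le> ennreal c * (ennreal (poisson_kernel t (x - y)) * f y)"
      unfolding mult.assoc[symmetric] by (intro mult_right_mono) auto
  qed
  also have "\<dots> = ennreal c * poisson t f x"
    unfolding poisson_def by (rule nn_integral_cmult) measurable
  finally show ?thesis .
qed

lemma poisson_contraction:
  assumes [measurable]: "f \<in> borel_measurable lborel" and "t > 0"
  shows "(\<integral>\<^sup>+x. (poisson t f x)\<^sup>2 \<partial>lborel) \<le> (\<integral>\<^sup>+x. (f x)\<^sup>2 \<partial>lborel)"
proof -
  let ?k = "\<lambda>x s. ennreal (poisson_kernel t (x - s))"
  have k0: "0 \<le> poisson_kernel t u" for u using assms by (simp add: poisson_kernel_nonneg)
  have sq: "?k x s = ennreal (sqrt (poisson_kernel t (x - s))) * ennreal (sqrt (poisson_kernel t (x - s)))" for x s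
    by (simp add: ennreal_mult[symmetric] k0)
  have "(poisson t f x)\<^sup>2 \<le> (\<integral>\<^sup>+s. ?k x s * (f s)\<^sup>2 \<partial>lborel)" for x
  proof -
    have "poisson t f x = (\<integral>\<^sup>+s. ennreal (sqrt (poisson_kernel t (x - s))) * (ennreal (sqrt (poisson_kernel t (x - s))) * f s) \<partial>lborel)"
      unfolding poisson_def sq by (simp add: mult.assoc)
    also have "\<dots>\<^sup>2 \<le> (\<integral>\<^sup>+s. (ennreal (sqrt (poisson_kernel t (x - s))))\<^sup>2 \<partial>lborel) *
       (\<integral>\<^sup>+s. (ennreal (sqrt (poisson_kernel t (x - s))) * f s)\<^sup>2 \<partial>lborel)"
      by (rule Cauchy_Schwarz_nn_integral) auto
    also have "(\<integral>\<^sup>+s. (ennreal (sqrt (poisson_kernel t (x - s))))\<^sup>2 \<partial>lborel) = 1"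
      using poisson_kernel_integral[OF assms(2), of x] by (simp add: ennreal_power k0)
    finally show ?thesis by (simp add: power_mult_distrib ennreal_power k0)
  qed
  then have "(\<integral>\<^sup>+x. (poisson t f x)\<^sup>2 \<partial>lborel) \<le> (\<integral>\<^sup>+x. \<integral>\<^sup>+s. ?k x s * (f s)\<^sup>2 \<partial>lborel \<partial>lborel)"
    by (intro nn_integral_mono)
  also have "\<dots> = (\<integral>\<^sup>+s. \<integral>\<^sup>+x. ?k x s * (f s)\<^sup>2 \<partial>lborel \<partial>lborel)"
    by (rule lborel_pair.Fubini'[symmetric]) measurable
  also have "\<dots> = (\<integral>\<^sup>+s. (f s)\<^sup>2 \<partial>lborel)"
  proof (rule nn_integral_cong)
    fix s
    have "(\<integral>\<^sup>+x. ?k x s * (f s)\<^sup>2 \<partial>lborel) = (\<integral>\<^sup>+x. ?k x s \<partial>lborel) * (f s)\<^sup>2"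
      by (rule nn_integral_multc) measurable
    also have "(\<integral>\<^sup>+x. ?k x s \<partial>lborel) = 1"
      using poisson_kernel_integral[OF assms(2), of s] by (simp add: poisson_kernel_commute[of t s])
    finally show "(\<integral>\<^sup>+x. ?k x s * (f s)\<^sup>2 \<partial>lborel) = (f s)\<^sup>2" by simp
  qed
  finally show ?thesis .
qed

section \<open>The linearised Poisson maximal operator\<close>

lemma poisson_kernel_sum_le:
  assumes "a > 0" "b > 0"
  shows "poisson_kernel (a + b) u \<le> 2 * (poisson_kernel a u + poisson_kernel b u)"
proof -
  have "poisson_kernel (a + b) u \<le> 2 * poisson_kernel c u" if "c > 0" "c \<le> a + b" "a + b \<le> 2 * c" for c
  proof -
    have "max ((a + b) / c) (c / (a + b)) \<le> 2" using that assms by (simp add: field_simps)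
    then show ?thesis
      using that assms by (intro order_trans[OF poisson_kernel_le[of "a + b" c u]] mult_right_mono poisson_kernel_nonneg) auto
  qed
  from this[of a] this[of b] show ?thesis
    using assms poisson_kernel_nonneg[of a u] poisson_kernel_nonneg[of b u] by (cases "a \<le> b") auto
qed

text \<open>
  One step of bootstrapping for \<open>T f x = poisson (\<tau> x) f x\<close>. Put \<open>G = T f\<close>. By duality \<open>\<parallel>G\<parallel>\<^sup>2\<close> is at most
  \<open>\<parallel>T\<^sup>* G\<parallel> \<parallel>f\<parallel>\<close>, and \<open>\<parallel>T\<^sup>* G\<parallel>\<^sup>2\<close> is the pairing of \<open>G\<close> with \<open>T T\<^sup>* G\<close>. By the semigroup law the kernel of
  \<open>T T\<^sup>*\<close> is the Poisson kernel with parameter \<open>\<tau> x + \<tau> y\<close>, hence at most twice the sum of the kernels of \<open>T\<close> and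
  \<open>T\<^sup>*\<close>; so the pairing is at most \<open>4 \<parallel>G\<parallel> \<parallel>T G\<parallel>\<close>. Inserting the known bound for \<open>\<parallel>T G\<parallel>\<close> improves the
  constant \<open>C\<close> to \<open>4 * sqrt C\<close>.
\<close>

lemma poisson_linearised_step:
  assumes [measurable]: "\<tau> \<in> borel_measurable lborel" and pos: "\<And>x. \<tau> x > 0" and "C \<ge> 0"
    and bound: "\<And>f. f \<in> borel_measurable lborel \<Longrightarrow>
      (\<integral>\<^sup>+x. (poisson (\<tau> x) f x)\<^sup>2 \<partial>lborel) \<le> ennreal C * (\<integral>\<^sup>+x. (f x)\<^sup>2 \<partial>lborel)"
    and [measurable]: "f \<in> borel_measurable lborel" and fin: "(\<integral>\<^sup>+x. (f x)\<^sup>2 \<partial>lborel) = ennreal \<phi>" "\<phi> \<ge> 0"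
  shows "(\<integral>\<^sup>+x. (poisson (\<tau> x) f x)\<^sup>2 \<partial>lborel) \<le> ennreal (4 * sqrt C * \<phi>)"
proof -
  define G where "G x = poisson (\<tau> x) f x" for x
  have [measurable]: "G \<in> borel_measurable lborel" unfolding G_def by measurable
  define k where "k x s = ennreal (poisson_kernel (\<tau> x) (x - s))" for x s
  have [measurable]: "case_prod k \<in> borel_measurable (lborel \<Otimes>\<^sub>M lborel)" unfolding k_def by measurable
  define S where "S s = (\<integral>\<^sup>+x. G x * k x s \<partial>lborel)" for s
  have [measurable]: "S \<in> borel_measurable lborel" unfolding S_def by measurable
  have G2: "(\<integral>\<^sup>+x. (G x)\<^sup>2 \<partial>lborel) \<le> ennreal (C * \<phi>)"
    using bound[of f] fin \<open>C \<ge> 0\<close> by (simp add: G_def ennreal_mult)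
  then have "(\<integral>\<^sup>+x. (G x)\<^sup>2 \<partial>lborel) < \<infinity>" by (rule le_less_trans) simp
  then obtain g where g: "(\<integral>\<^sup>+x. (G x)\<^sup>2 \<partial>lborel) = ennreal g" "g \<ge> 0"
    by (cases "\<integral>\<^sup>+x. (G x)\<^sup>2 \<partial>lborel") auto
  \<comment> \<open>Duality: moving the operator from \<open>f\<close> to \<open>G\<close> turns it into its adjoint, applied in \<open>S\<close>.\<close>
  have "(\<integral>\<^sup>+x. (G x)\<^sup>2 \<partial>lborel) = (\<integral>\<^sup>+x. \<integral>\<^sup>+s. G x * (k x s * f s) \<partial>lborel \<partial>lborel)"
  proof (rule nn_integral_cong)
    fix x
    have "(\<integral>\<^sup>+s. G x * (k x s * f s) \<partial>lborel) = G x * (\<integral>\<^sup>+s. k x s * f s \<partial>lborel)"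
      by (rule nn_integral_cmult) measurable
    then show "(G x)\<^sup>2 = (\<integral>\<^sup>+s. G x * (k x s * f s) \<partial>lborel)"
      by (simp add: power2_eq_square G_def[of x] poisson_def k_def)
  qed
  also have "\<dots> = (\<integral>\<^sup>+s. \<integral>\<^sup>+x. G x * (k x s * f s) \<partial>lborel \<partial>lborel)"
    by (rule lborel_pair.Fubini'[symmetric]) measurable
  also have "\<dots> = (\<integral>\<^sup>+s. S s * f s \<partial>lborel)"
  proof (rule nn_integral_cong)
    fix s
    show "(\<integral>\<^sup>+x. G x * (k x s * f s) \<partial>lborel) = S s * f s"
      unfolding S_def mult.assoc[symmetric] by (rule nn_integral_multc) measurable
  qed
  finally have gS: "ennreal g = (\<integral>\<^sup>+s. S s * f s \<partial>lborel)" using g by simp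
  have g_sq: "(ennreal g)\<^sup>2 \<le> (\<integral>\<^sup>+s. (S s)\<^sup>2 \<partial>lborel) * ennreal \<phi>"
    unfolding gS fin(1)[symmetric] by (rule Cauchy_Schwarz_nn_integral) auto
  \<comment> \<open>Expanding the square and integrating out \<open>s\<close> first exhibits the kernel of the operator times its adjoint.\<close>
  have "(\<integral>\<^sup>+s. (S s)\<^sup>2 \<partial>lborel) = (\<integral>\<^sup>+s. \<integral>\<^sup>+x. \<integral>\<^sup>+y. (G x * G y) * (k x s * k y s) \<partial>lborel \<partial>lborel \<partial>lborel)"
  proof (rule nn_integral_cong)
    fix s
    have "(\<integral>\<^sup>+x. \<integral>\<^sup>+y. (G x * G y) * (k x s * k y s) \<partial>lborel \<partial>lborel)
        = (\<integral>\<^sup>+x. (\<integral>\<^sup>+y. (G x * k x s) * (G y * k y s) \<partial>lborel) \<partial>lborel)"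
      by (intro nn_integral_cong) (simp add: ac_simps)
    also have "\<dots> = (\<integral>\<^sup>+x. (G x * k x s) * S s \<partial>lborel)"
      unfolding S_def by (intro nn_integral_cong nn_integral_cmult) measurable
    also have "\<dots> = S s * S s"
      unfolding S_def by (rule nn_integral_multc) measurable
    finally show "(S s)\<^sup>2 = (\<integral>\<^sup>+x. \<integral>\<^sup>+y. (G x * G y) * (k x s * k y s) \<partial>lborel \<partial>lborel)"
      by (simp add: power2_eq_square)
  qed
  also have "\<dots> = (\<integral>\<^sup>+x. \<integral>\<^sup>+s. \<integral>\<^sup>+y. (G x * G y) * (k x s * k y s) \<partial>lborel \<partial>lborel \<partial>lborel)"
    by (rule lborel_pair.Fubini') measurable
  also have "\<dots> = (\<integral>\<^sup>+x. \<integral>\<^sup>+y. \<integral>\<^sup>+s. (G x * G y) * (k x s * k y s) \<partial>lborel \<partial>lborel \<partial>lborel)"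
    by (intro nn_integral_cong lborel_pair.Fubini') measurable
  also have "\<dots> \<le> (\<integral>\<^sup>+x. \<integral>\<^sup>+y. 2 * (G x * (k x y * G y)) + 2 * (G y * (k y x * G x)) \<partial>lborel \<partial>lborel)"
  proof (intro nn_integral_mono)
    fix x y
    have "(\<integral>\<^sup>+s. k x s * k y s \<partial>lborel) = ennreal (poisson_kernel (\<tau> x + \<tau> y) (x - y))"
      unfolding k_def by (rule poisson_kernel_convolution[OF pos pos])
    also have "\<dots> \<le> ennreal (2 * (poisson_kernel (\<tau> x) (x - y) + poisson_kernel (\<tau> y) (x - y)))"
      by (intro ennreal_leI poisson_kernel_sum_le pos)
    also have "\<dots> = 2 * k x y + 2 * k y x"
      using pos[of x] pos[of y] unfolding k_def poisson_kernel_commute[of _ y x]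
      by (simp add: ennreal_mult poisson_kernel_nonneg ennreal_plus distrib_left)
    finally have k_le: "(\<integral>\<^sup>+s. k x s * k y s \<partial>lborel) \<le> 2 * k x y + 2 * k y x" .
    have "(\<integral>\<^sup>+s. (G x * G y) * (k x s * k y s) \<partial>lborel) = (G x * G y) * (\<integral>\<^sup>+s. k x s * k y s \<partial>lborel)"
      by (rule nn_integral_cmult) measurable
    also have "\<dots> \<le> (G x * G y) * (2 * k x y + 2 * k y x)"
      by (intro mult_left_mono k_le) simp
    also have "\<dots> = 2 * (G x * (k x y * G y)) + 2 * (G y * (k y x * G x))"
      by (simp add: distrib_left ac_simps)
    finally show "(\<integral>\<^sup>+s. (G x * G y) * (k x s * k y s) \<partial>lborel)
        \<le> 2 * (G x * (k x y * G y)) + 2 * (G y * (k y x * G x))" .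
  qed
  also have "\<dots> = (\<integral>\<^sup>+x. \<integral>\<^sup>+y. 2 * (G x * (k x y * G y)) \<partial>lborel \<partial>lborel) + (\<integral>\<^sup>+x. \<integral>\<^sup>+y. 2 * (G y * (k y x * G x)) \<partial>lborel \<partial>lborel)"
    by (subst nn_integral_add[symmetric], measurable)
       (intro nn_integral_cong nn_integral_add, measurable)
  also have "(\<integral>\<^sup>+x. \<integral>\<^sup>+y. 2 * (G y * (k y x * G x)) \<partial>lborel \<partial>lborel) = (\<integral>\<^sup>+y. \<integral>\<^sup>+x. 2 * (G y * (k y x * G x)) \<partial>lborel \<partial>lborel)"
    by (rule lborel_pair.Fubini'[symmetric]) measurable
  also have "(\<integral>\<^sup>+x. \<integral>\<^sup>+y. 2 * (G x * (k x y * G y)) \<partial>lborel \<partial>lborel) = (\<integral>\<^sup>+x. 2 * (G x * poisson (\<tau> x) G x) \<partial>lborel)"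
  proof (rule nn_integral_cong)
    fix x
    have "(\<integral>\<^sup>+y. 2 * (G x * (k x y * G y)) \<partial>lborel) = (\<integral>\<^sup>+y. (2 * G x) * (k x y * G y) \<partial>lborel)"
      by (simp add: mult.assoc)
    also have "\<dots> = (2 * G x) * (\<integral>\<^sup>+y. k x y * G y \<partial>lborel)"
      by (rule nn_integral_cmult) measurable
    finally show "(\<integral>\<^sup>+y. 2 * (G x * (k x y * G y)) \<partial>lborel) = 2 * (G x * poisson (\<tau> x) G x)"
      by (simp add: poisson_def k_def mult.assoc)
  qed
  also have "(\<integral>\<^sup>+x. 2 * (G x * poisson (\<tau> x) G x) \<partial>lborel) = 2 * (\<integral>\<^sup>+x. G x * poisson (\<tau> x) G x \<partial>lborel)"
    by (rule nn_integral_cmult) measurable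
  finally have S_le: "(\<integral>\<^sup>+s. (S s)\<^sup>2 \<partial>lborel) \<le> 4 * (\<integral>\<^sup>+x. G x * poisson (\<tau> x) G x \<partial>lborel)"
    by (simp add: distrib_right[symmetric])
  have "(\<integral>\<^sup>+x. G x * poisson (\<tau> x) G x \<partial>lborel)\<^sup>2 \<le>
      (\<integral>\<^sup>+x. (G x)\<^sup>2 \<partial>lborel) * (\<integral>\<^sup>+x. (poisson (\<tau> x) G x)\<^sup>2 \<partial>lborel)"
    by (rule Cauchy_Schwarz_nn_integral) measurable
  also have "\<dots> \<le> ennreal g * (ennreal C * ennreal g)"
    using bound[of G] g by (simp add: mult_left_mono)
  also have "\<dots> = (ennreal (sqrt C * g))\<^sup>2"
    using g(2) \<open>C \<ge> 0\<close> by (simp add: ennreal_mult[symmetric] ennreal_power power_mult_distrib) (simp add: power2_eq_square ac_simps)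
  finally have "(\<integral>\<^sup>+x. G x * poisson (\<tau> x) G x \<partial>lborel) \<le> ennreal (sqrt C * g)"
    by (rule ennreal_le_of_power2) (use g(2) \<open>C \<ge> 0\<close> in simp)
  then have "(\<integral>\<^sup>+s. (S s)\<^sup>2 \<partial>lborel) \<le> 4 * ennreal (sqrt C * g)"
    by (intro order_trans[OF S_le] mult_left_mono) auto
  also have "\<dots> = ennreal (4 * sqrt C * g)"
    using ennreal_mult[of 4 "sqrt C * g"] g(2) \<open>C \<ge> 0\<close> by (simp add: mult.assoc)
  finally have "(ennreal g)\<^sup>2 \<le> ennreal (4 * sqrt C * g) * ennreal \<phi>"
    by (intro order_trans[OF g_sq] mult_right_mono) auto
  then have "g\<^sup>2 \<le> 4 * sqrt C * g * \<phi>"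
    using g(2) fin(2) \<open>C \<ge> 0\<close> by (simp add: ennreal_power ennreal_mult[symmetric])
  then have "g * g \<le> g * (4 * sqrt C * \<phi>)" by (simp add: power2_eq_square ac_simps)
  then have "g \<le> 4 * sqrt C * \<phi>"
    using g(2) fin(2) \<open>C \<ge> 0\<close> by (cases "g = 0") auto
  then show ?thesis using g(1) by (simp add: G_def ennreal_leI)
qed

text \<open>
  The bounds \<open>a\<close> and \<open>b\<close> on \<open>\<tau>\<close> yield a first finite constant by comparison with \<open>poisson a\<close>; the infimum of the admissible
  constants does not exceed \<open>16\<close>, the fixed point of \<open>C \<mapsto> 4 * sqrt C\<close>.
\<close>

lemma poisson_linearised_bound:
  assumes [measurable]: "\<tau> \<in> borel_measurable lborel" and ab: "0 < a" "\<And>x. a \<le> \<tau> x" "\<And>x. \<tau> x \<le> b"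
    and [measurable]: "f \<in> borel_measurable lborel"
  shows "(\<integral>\<^sup>+x. (poisson (\<tau> x) f x)\<^sup>2 \<partial>lborel) \<le> 16 * (\<integral>\<^sup>+x. (f x)\<^sup>2 \<partial>lborel)"
proof -
  define E where "E f = (\<integral>\<^sup>+x. (f x)\<^sup>2 \<partial>lborel)" for f :: "real \<Rightarrow> ennreal"
  define T where "T f x = poisson (\<tau> x) f x" for f x
  define V where "V = {C. 0 \<le> C \<and> (\<forall>f\<in>borel_measurable lborel. E (T f) \<le> ennreal C * E f)}"
  have pos: "\<tau> x > 0" for x using ab(1) ab(2)[of x] by simp
  have "a \<le> b" using ab(2,3)[of 0] by simp
  have "(b / a)\<^sup>2 \<in> V"
  proof -
    have "E (T f) \<le> ennreal ((b / a)\<^sup>2) * E f" if [measurable]: "f \<in> borel_measurable lborel" for f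
    proof -
      have "T f x \<le> ennreal (b / a) * poisson a f x" for x
        unfolding T_def
      proof (rule poisson_le)
        have "b / a * a \<le> b / a * \<tau> x" using ab \<open>a \<le> b\<close> by (intro mult_left_mono) auto
        then show "\<tau> x \<le> b / a * a" "a \<le> b / a * \<tau> x" using ab ab(3)[of x] \<open>a \<le> b\<close> by auto
      qed (use ab pos in auto)
      then have "E (T f) \<le> (\<integral>\<^sup>+x. (ennreal (b / a))\<^sup>2 * (poisson a f x)\<^sup>2 \<partial>lborel)"
        unfolding E_def power_mult_distrib[symmetric] by (intro nn_integral_mono power_mono) auto
      also have "\<dots> = (ennreal (b / a))\<^sup>2 * E (\<lambda>x. poisson a f x)"
        unfolding E_def by (rule nn_integral_cmult) measurable
      also have "\<dots> \<le> (ennreal (b / a))\<^sup>2 * E f"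
        unfolding E_def by (intro mult_left_mono poisson_contraction ab) auto
      finally show ?thesis using ab(1) \<open>a \<le> b\<close> by (simp add: ennreal_power)
    qed
    then show ?thesis by (simp add: V_def)
  qed
  then have V: "V \<noteq> {}" by auto
  have bdd: "bdd_below V" by (rule bdd_belowI[of _ 0]) (simp add: V_def)
  define K where "K = Inf V"
  have K0: "K \<ge> 0" unfolding K_def using V by (intro cInf_greatest) (auto simp: V_def)
  have step: "4 * sqrt C \<in> V" if "C \<in> V" and "C > 0" for C
  proof -
    have "E (T f) \<le> ennreal (4 * sqrt C) * E f" if [measurable]: "f \<in> borel_measurable lborel" for f
    proof (cases "E f")
      case (real \<phi>)
      have "E (T f) \<le> ennreal (4 * sqrt C * \<phi>)"
        unfolding E_def T_def
        by (rule poisson_linearised_step[of \<tau> C]) (use \<open>C \<in> V\<close> pos real in \<open>auto simp: V_def E_def T_def\<close>)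
      then show ?thesis using real \<open>C > 0\<close> by (simp add: ennreal_mult)
    next
      case top
      then show ?thesis using \<open>C > 0\<close> by (simp add: ennreal_mult_top)
    qed
    then show ?thesis using \<open>C > 0\<close> by (simp add: V_def)
  qed
  have K16: "K \<le> 16"
  proof (rule ccontr)
    assume "\<not> K \<le> 16"
    then have "K > 16" by simp
    then have "4 * sqrt K < sqrt K * sqrt K"
      using real_sqrt_less_mono[of 16 K] by (intro mult_strict_right_mono) auto
    then have lt: "4 * sqrt K < K" using \<open>K > 16\<close> by simp
    \<comment> \<open>Some admissible constant is so close to \<open>K\<close> that its successor drops below \<open>K\<close>.\<close>
    have "K < (K / 4)\<^sup>2"
    proof -
      have "16 * K < K * K" using \<open>K > 16\<close> by (intro mult_strict_right_mono) auto
      then show ?thesis by (simp add: power2_eq_square)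
    qed
    then obtain C where C: "C \<in> V" "C < (K / 4)\<^sup>2"
      using cInf_less_iff[OF V bdd, of "(K / 4)\<^sup>2"] by (auto simp: K_def)
    have "C \<ge> K" unfolding K_def using C(1) bdd by (rule cInf_lower)
    have "sqrt C < K / 4" using C(2) \<open>K > 16\<close> real_sqrt_less_mono[of C "(K / 4)\<^sup>2"] by simp
    then have "4 * sqrt C < K" by simp
    moreover have "K \<le> 4 * sqrt C"
      unfolding K_def using step[OF C(1)] \<open>C \<ge> K\<close> \<open>K > 16\<close> bdd by (intro cInf_lower) auto
    ultimately show False by simp
  qed
  have le: "E (T f) \<le> ennreal C * E f" if C: "C > 16" for C
  proof -
    obtain D where D: "D \<in> V" "D < C" using cInf_less_iff[OF V bdd, of C] K16 C by (auto simp: K_def)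
    have "E (T f) \<le> ennreal D * E f" using D(1) by (simp add: V_def)
    also have "\<dots> \<le> ennreal C * E f" using D(2) by (intro mult_right_mono ennreal_leI) auto
    finally show ?thesis .
  qed
  show ?thesis
  proof (cases "E f")
    case (real \<phi>)
    have le': "E (T f) \<le> ennreal (C * \<phi>)" if "C > 16" for C
      using le[OF that] real that by (simp add: ennreal_mult)
    then have "E (T f) < \<infinity>" using le_less_trans[OF le'[of 17]] by simp
    then obtain t where t: "E (T f) = ennreal t" "t \<ge> 0" by (cases "E (T f)") auto
    have "t \<le> 16 * \<phi>"
    proof (rule field_le_epsilon)
      fix e :: real assume e: "e > 0"
      have "t \<le> (16 + e / (\<phi> + 1)) * \<phi>"
        using le'[of "16 + e / (\<phi> + 1)"] e real(1) t by (simp add: add_nonneg_pos ennreal_le_iff)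
      also have "\<dots> \<le> 16 * \<phi> + e" using e real(1) by (simp add: field_simps)
      finally show "t \<le> 16 * \<phi> + e" .
    qed
    then have "ennreal t \<le> 16 * ennreal \<phi>"
      using real(1) ennreal_mult[of 16 \<phi>] ennreal_leI[of t "16 * \<phi>"] by simp
    then show ?thesis using real t by (simp add: E_def T_def)
  next
    case top
    then show ?thesis by (simp add: E_def ennreal_mult_top)
  qed
qed

section \<open>Almost everywhere boundary values\<close>

text \<open>
  The maximal inequality, with \<open>H\<close> a majorant of the squares. The supremum over the parameters \<open>1, 1/2, 1/3, \<dots>\<close>
  is the increasing limit of linearised operators whose \<open>\<tau>\<close> selects the best of the first parameters; every
  parameter in \<open>(0, 1]\<close> is within a factor two of one of these, which costs the factor \<open>4\<close>.
\<close>

lemma poisson_maximal: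
  assumes f [measurable]: "f \<in> borel_measurable lborel"
  shows "\<exists>H\<in>borel_measurable lborel. (\<forall>x e. 0 < e \<and> e \<le> 1 \<longrightarrow> (poisson e f x)\<^sup>2 \<le> 4 * H x)
     \<and> (\<integral>\<^sup>+x. H x \<partial>lborel) \<le> 16 * (\<integral>\<^sup>+x. (f x)\<^sup>2 \<partial>lborel)"
proof -
  define t where "t n = 1 / real (Suc n)" for n
  have t_pos: "t n > 0" "t n \<le> 1" for n by (auto simp: t_def)
  \<comment> \<open>\<open>\<tau> n x\<close> is a parameter among \<open>t 0, \<dots>, t n\<close> at which the Poisson integral is largest at \<open>x\<close>.\<close>
  define \<tau> where "\<tau> = rec_nat (\<lambda>x. t 0) (\<lambda>n s x. if poisson (s x) f x < poisson (t (Suc n)) f x then t (Suc n) else s x)"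
  have \<tau>_0: "\<tau> 0 x = t 0" and \<tau>_Suc: "\<tau> (Suc n) x = (if poisson (\<tau> n x) f x < poisson (t (Suc n)) f x then t (Suc n) else \<tau> n x)" for n x
    by (simp_all add: \<tau>_def)
  have \<tau>_meas [measurable]: "\<tau> n \<in> borel_measurable lborel" for n
  proof (induction n)
    case 0
    have "\<tau> 0 = (\<lambda>x. t 0)" using \<tau>_0 by (rule ext)
    then show ?case by simp
  next
    case (Suc n)
    note [measurable] = Suc
    have "(\<lambda>x. if poisson (\<tau> n x) f x < poisson (t (Suc n)) f x then t (Suc n) else \<tau> n x) \<in> borel_measurable lborel"
      by measurable
    moreover have "\<tau> (Suc n) = (\<lambda>x. if poisson (\<tau> n x) f x < poisson (t (Suc n)) f x then t (Suc n) else \<tau> n x)"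
      using \<tau>_Suc by (rule ext)
    ultimately show ?case by simp
  qed
  have t_anti: "t (Suc n) \<le> t n" for n by (simp add: t_def frac_le)
  have \<tau>_range: "t n \<le> \<tau> n x" "\<tau> n x \<le> 1" for n x
  proof -
    have "t n \<le> \<tau> n x \<and> \<tau> n x \<le> 1"
      by (induction n) (auto simp: \<tau>_0 \<tau>_Suc t_pos intro: order_trans[OF t_anti])
    then show "t n \<le> \<tau> n x" "\<tau> n x \<le> 1" by auto
  qed
  define M where "M n x = (poisson (\<tau> n x) f x)\<^sup>2" for n x
  have [measurable]: "M n \<in> borel_measurable lborel" for n unfolding M_def by measurable
  have M_step: "poisson (\<tau> n x) f x \<le> poisson (\<tau> (Suc n) x) f x" "poisson (t (Suc n)) f x \<le> poisson (\<tau> (Suc n) x) f x" for n x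
    by (auto simp: \<tau>_Suc not_less)
  have M_inc: "incseq M"
    unfolding M_def by (intro incseq_SucI le_funI power_mono M_step) simp
  have M_ge: "(poisson (t n) f x)\<^sup>2 \<le> M n x" for n x
    unfolding M_def by (cases n) (auto simp: \<tau>_0 intro!: power_mono M_step)
  define H where "H x = (SUP n. M n x)" for x
  have "(\<integral>\<^sup>+x. H x \<partial>lborel) = (SUP n. \<integral>\<^sup>+x. M n x \<partial>lborel)"
    unfolding H_def by (rule nn_integral_monotone_convergence_SUP[OF M_inc]) measurable
  also have "\<dots> \<le> 16 * (\<integral>\<^sup>+x. (f x)\<^sup>2 \<partial>lborel)"
    unfolding M_def by (intro SUP_least poisson_linearised_bound[OF \<tau>_meas t_pos(1) \<tau>_range f])
  finally have "(\<integral>\<^sup>+x. H x \<partial>lborel) \<le> 16 * (\<integral>\<^sup>+x. (f x)\<^sup>2 \<partial>lborel)" .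
  moreover have "H \<in> borel_measurable lborel" unfolding H_def by measurable
  moreover have "(poisson e f x)\<^sup>2 \<le> 4 * H x" if e: "0 < e" "e \<le> 1" for x e
  proof -
    define n where "n = nat \<lfloor>1 / e\<rfloor>"
    have n: "real n \<le> 1 / e" "1 / e < real n + 1" 
    proof -
      have "real n = of_int \<lfloor>1 / e\<rfloor>" using e by (simp add: n_def)
      then show "real n \<le> 1 / e" "1 / e < real n + 1" by linarith+
    qed
    have n': "real n * e \<le> 1" "1 < (real n + 1) * e" using n e by (simp_all add: field_simps)
    have "poisson e f x \<le> ennreal 2 * poisson (t n) f x"
    proof (rule poisson_le)
      show "e \<le> 2 * t n" using n' e by (simp add: t_def field_simps)
      show "t n \<le> 2 * e" using n' e by (simp add: t_def field_simps)
    qed (use e t_pos in auto)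
    then have "(poisson e f x)\<^sup>2 \<le> (2 * poisson (t n) f x)\<^sup>2" by (intro power_mono) auto
    also have "\<dots> = 4 * (poisson (t n) f x)\<^sup>2" by (simp add: power_mult_distrib)
    also have "\<dots> \<le> 4 * H x"
      unfolding H_def by (intro mult_left_mono order_trans[OF M_ge] SUP_upper) auto
    finally show ?thesis .
  qed
  ultimately show ?thesis by blast
qed

text \<open>
  The resolvent identity for the Cauchy kernels.
\<close>

lemma cauchy_transform_lipschitz:
  assumes f: "L2 lborel f" and a: "Im a \<noteq> 0" and b: "Im b \<noteq> 0"
  shows "norm (cauchy_transform f a - cauchy_transform f b)
      \<le> norm (a - b) / \<bar>Im b\<bar> * (N2 lborel f * sqrt (pi / \<bar>Im a\<bar>))"
proof -
  note [measurable] = L2_measurable[OF f]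
  have resolvent: "cauchy_kernel a s - cauchy_kernel b s = (a - b) * (cauchy_kernel a s * cauchy_kernel b s)" for s
  proof -
    have "complex_of_real s - a \<noteq> 0" "complex_of_real s - b \<noteq> 0" using a b by (auto simp: complex_eq_iff)
    then show ?thesis by (simp add: cauchy_kernel_def divide_simps)
  qed
  define h where "h s = f s * cauchy_kernel b s" for s
  have hm: "h \<in> borel_measurable lborel" unfolding h_def by measurable
  have "norm (h s) \<le> 1 / \<bar>Im b\<bar> * norm (f s)" for s
    using mult_left_mono[OF norm_cauchy_kernel_le[OF b, of s], of "norm (f s)"]
    by (simp add: h_def norm_mult mult.commute)
  then have h: "L2 lborel h" "N2 lborel h \<le> 1 / \<bar>Im b\<bar> * N2 lborel f"
    using L2_mono[OF hm f, of "1 / \<bar>Im b\<bar>"] by auto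
  have "cauchy_transform f a - cauchy_transform f b = (LINT s|lborel. f s * cauchy_kernel a s - f s * cauchy_kernel b s)"
    unfolding cauchy_transform_def
    by (intro Bochner_Integration.integral_diff[symmetric] L2_times_integrable(1) L2_cauchy_kernel f a b)
  also have "\<dots> = (LINT s|lborel. (a - b) * (h s * cauchy_kernel a s))"
    by (intro Bochner_Integration.integral_cong refl)
       (simp add: right_diff_distrib[symmetric] resolvent h_def mult_ac)
  also have "\<dots> = (a - b) * cauchy_transform h a"
    by (simp add: cauchy_transform_def)
  finally have "norm (cauchy_transform f a - cauchy_transform f b) = norm (a - b) * norm (cauchy_transform h a)"
    by (simp add: norm_mult)
  also have "\<dots> \<le> norm (a - b) * (1 / \<bar>Im b\<bar> * N2 lborel f * sqrt (pi / \<bar>Im a\<bar>))"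
    by (intro mult_left_mono order_trans[OF cauchy_transform_bound[OF h(1) a]] mult_right_mono h(2)) auto
  finally show ?thesis by (simp add: mult_ac)
qed

lemma cauchy_transform_vertical_limit:
  assumes f: "L2 lborel f" and a: "Im a < 0"
  shows "((\<lambda>e. cauchy_transform f (a - \<i> * complex_of_real e)) \<longlongrightarrow> cauchy_transform f a) (at_right 0)"
proof -
  let ?c = "1 / \<bar>Im a\<bar> * (N2 lborel f * sqrt (pi / \<bar>Im a\<bar>))"
  have "((\<lambda>e. e * ?c) \<longlongrightarrow> 0) (at_right 0)"
    by (intro tendsto_mult_left_zero tendsto_ident_at)
  moreover have "\<forall>\<^sub>F e in at_right 0. norm (cauchy_transform f (a - \<i> * complex_of_real e) - cauchy_transform f a) \<le> e * ?c"
    unfolding eventually_at_right_field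
  proof (intro exI[of _ 1] conjI allI impI)
    fix e :: real assume e: "e > 0"
    have "norm (cauchy_transform f (a - \<i> * complex_of_real e) - cauchy_transform f a)
       \<le> norm (a - (a - \<i> * complex_of_real e)) / \<bar>Im (a - \<i> * complex_of_real e)\<bar> * (N2 lborel f * sqrt (pi / \<bar>Im a\<bar>))"
      using cauchy_transform_lipschitz[OF f, of a "a - \<i> * complex_of_real e"] a e by (simp add: norm_minus_commute)
    also have "\<dots> \<le> e / \<bar>Im a\<bar> * (N2 lborel f * sqrt (pi / \<bar>Im a\<bar>))"
    proof (rule mult_right_mono)
      have "\<bar>Im (a - \<i> * complex_of_real e)\<bar> = \<bar>Im a\<bar> + e" "norm (a - (a - \<i> * complex_of_real e)) = e"
        using a e by (simp_all add: norm_mult)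
      then show "norm (a - (a - \<i> * complex_of_real e)) / \<bar>Im (a - \<i> * complex_of_real e)\<bar> \<le> e / \<bar>Im a\<bar>"
        using a e by (simp only:) (intro frac_le; simp)
    qed simp
    finally show "norm (cauchy_transform f (a - \<i> * complex_of_real e) - cauchy_transform f a) \<le> e * ?c" by simp
  qed simp
  ultimately have "((\<lambda>e. cauchy_transform f (a - \<i> * complex_of_real e) - cauchy_transform f a) \<longlongrightarrow> 0) (at_right 0)"
    by (rule Lim_null_comparison[rotated])
  then show ?thesis by (simp add: LIM_zero_iff)
qed

lemma hardy_vertical_limit:
  assumes f: "L2 lborel f" and d: "d > 0"
  shows "((\<lambda>e. hardy (e + d) f z) \<longlongrightarrow> hardy d f z) (at_right 0)"
proof -
  have *: "complex_of_real z - \<i> * complex_of_real (e + d) = (complex_of_real z - \<i> * d) - \<i> * complex_of_real e" for e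
    by (simp add: algebra_simps)
  show ?thesis
    unfolding hardy_def[of "_ + d"] hardy_def[of d] * 
    by (intro tendsto_mult tendsto_const cauchy_transform_vertical_limit f) (use d in simp)
qed

text \<open>
  The boundary function \<open>g\<close> carries the same Cauchy integrals as \<open>f\<close> in the lower half plane, and none in the
  upper one.
\<close>

lemma cauchy_transform_hardy_limit:
  assumes f: "L2 lborel f" and g: "L2 lborel g" and a: "Im a < 0"
    and lim: "((\<lambda>e. N2 lborel (\<lambda>z. hardy e f z - g z)) \<longlongrightarrow> 0) (at_right 0)"
  shows "cauchy_transform g a = cauchy_transform f a" "cauchy_transform g (cnj a) = 0"
proof -
  \<comment> \<open>Extending by the limit to \<open>e \<le> 0\<close> gives a family that is square-integrable for all \<open>e\<close>.\<close>
  define u where "u e = (if e > 0 then hardy e f else g)" for e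
  have u: "L2 lborel (u e)" for e unfolding u_def using f g by (simp add: hardy_contraction)
  have ev: "\<forall>\<^sub>F e in at_right 0. (e::real) > 0" by (simp add: eventually_at_right_less)
  have "((\<lambda>e. N2 lborel (\<lambda>z. u e z - g z)) \<longlongrightarrow> 0) (at_right 0)"
    by (rule Lim_transform_eventually[OF lim], use ev in eventually_elim) (simp add: u_def)
  then have ct: "((\<lambda>e. cauchy_transform (u e) b) \<longlongrightarrow> cauchy_transform g b) (at_right 0)" if "Im b \<noteq> 0" for b
    by (intro cauchy_transform_tendsto u g that)
  have "((\<lambda>e. cauchy_transform f (a - \<i> * complex_of_real e)) \<longlongrightarrow> cauchy_transform g a) (at_right 0)"
  proof (rule Lim_transform_eventually[OF ct])
    show "\<forall>\<^sub>F e in at_right 0. cauchy_transform (u e) a = cauchy_transform f (a - \<i> * complex_of_real e)"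
      using ev by eventually_elim (use a f in \<open>simp add: u_def cauchy_transform_hardy\<close>)
  qed (use a in simp)
  then show "cauchy_transform g a = cauchy_transform f a"
    using tendsto_unique[OF trivial_limit_at_right_real _ cauchy_transform_vertical_limit[OF f a]] by blast
  have "((\<lambda>e::real. 0) \<longlongrightarrow> cauchy_transform g (cnj a)) (at_right 0)"
  proof (rule Lim_transform_eventually[OF ct])
    show "\<forall>\<^sub>F e in at_right 0. cauchy_transform (u e) (cnj a) = 0"
      using ev by eventually_elim (use a f in \<open>simp add: u_def cauchy_transform_hardy\<close>)
  qed (use a in simp)
  then show "cauchy_transform g (cnj a) = 0"
    using tendsto_unique[OF trivial_limit_at_right_real _ tendsto_const] by blast
qed

text \<open>
  The Poisson integral of a complex function, written as the jump of its Cauchy integral; the bound below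
  identifies it with the integral against the Poisson kernel.
\<close>

definition poisson_integral :: "real \<Rightarrow> (real \<Rightarrow> complex) \<Rightarrow> real \<Rightarrow> complex" where
  "poisson_integral e u z = (cauchy_transform u (complex_of_real z + \<i> * e)
     - cauchy_transform u (complex_of_real z - \<i> * e)) / (2 * pi * \<i>)"

lemma poisson_integral_bound:
  assumes u: "L2 lborel u" and e: "e > 0"
  shows "ennreal (norm (poisson_integral e u z)) \<le> poisson e (\<lambda>s. ennreal (norm (u s))) z"
proof -
  let ?p = "complex_of_real z + \<i> * e" and ?m = "complex_of_real z - \<i> * e"
  have int: "integrable lborel (\<lambda>s. u s * cauchy_kernel ?p s)" "integrable lborel (\<lambda>s. u s * cauchy_kernel ?m s)"
    using e by (auto intro!: L2_times_integrable(1) u L2_cauchy_kernel)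
  have k: "(u s * cauchy_kernel ?p s - u s * cauchy_kernel ?m s) / (2 * pi * \<i>)
      = complex_of_real (poisson_kernel e (z - s)) * u s" for s
    unfolding poisson_kernel_cauchy[OF e] by (simp add: algebra_simps diff_divide_distrib)
  have "poisson_integral e u z = (LINT s|lborel. (u s * cauchy_kernel ?p s - u s * cauchy_kernel ?m s) / (2 * pi * \<i>))"
    unfolding poisson_integral_def cauchy_transform_def using int by simp
  also have "\<dots> = (LINT s|lborel. complex_of_real (poisson_kernel e (z - s)) * u s)" unfolding k ..
  finally have eq: "poisson_integral e u z = (LINT s|lborel. complex_of_real (poisson_kernel e (z - s)) * u s)" .
  have "integrable lborel (\<lambda>s. complex_of_real (poisson_kernel e (z - s)) * u s)"
    unfolding k[symmetric] by (intro integrable_divide Bochner_Integration.integrable_diff int)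
  from integral_norm_bound_ennreal[OF this]
  show ?thesis
    unfolding eq poisson_def using e by (simp add: norm_mult ennreal_mult poisson_kernel_nonneg)
qed

lemma poisson_integral_add:
  assumes "L2 lborel u" "L2 lborel v" "e > 0"
  shows "poisson_integral e (\<lambda>s. u s + v s) z = poisson_integral e u z + poisson_integral e v z"
  using assms by (simp add: poisson_integral_def cauchy_transform_add add_divide_distrib[symmetric] algebra_simps)

lemma poisson_integral_hardy:
  assumes f: "L2 lborel f" and "e > 0" "d > 0"
  shows "poisson_integral e (hardy d f) z = hardy (e + d) f z"
proof -
  have *: "complex_of_real z - \<i> * e - \<i> * d = complex_of_real z - \<i> * complex_of_real (e + d)"
    by (simp add: algebra_simps)
  show ?thesis
    using cauchy_transform_hardy[OF f \<open>d > 0\<close>, of "complex_of_real z - \<i> * e"]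
      cauchy_transform_hardy[OF f \<open>d > 0\<close>, of "complex_of_real z + \<i> * e"] assms
    unfolding poisson_integral_def hardy_def[of "e + d"] * by (simp add: divide_simps)
qed

lemma poisson_integral_limit:
  assumes f: "L2 lborel f" and g: "L2 lborel g" and e: "e > 0"
    and lim: "((\<lambda>e. N2 lborel (\<lambda>z. hardy e f z - g z)) \<longlongrightarrow> 0) (at_right 0)"
  shows "poisson_integral e g z = hardy e f z"
  using cauchy_transform_hardy_limit[OF f g _ lim, of "complex_of_real z - \<i> * e"] e
  unfolding poisson_integral_def hardy_def by (simp add: divide_simps)

text \<open>
  Let \<open>w n\<close> be \<open>g\<close> minus \<open>hardy (\<eta> n) f\<close>, which tends to \<open>0\<close> in mean square. As \<open>hardy e f\<close> is the Poisson integral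
  of \<open>g\<close>, it differs from \<open>g\<close> by the Poisson integral of \<open>w n\<close>, by \<open>w n\<close> itself, and by
  \<open>hardy (e + \<eta> n) f - hardy (\<eta> n) f\<close>, which vanishes with \<open>e\<close>. The first two terms are controlled, for all \<open>e\<close>
  at once, by \<open>D n\<close>, whose integral tends to \<open>0\<close> by the maximal inequality; hence almost everywhere \<open>D n\<close> is
  arbitrarily small for suitable \<open>n\<close>.
\<close>

lemma hardy_limit_AE:
  assumes f: "L2 lborel f" and g: "L2 lborel g"
    and lim: "((\<lambda>e. N2 lborel (\<lambda>z. hardy e f z - g z)) \<longlongrightarrow> 0) (at_right 0)"
  shows "AE z in lborel. ((\<lambda>e. hardy e f z) \<longlongrightarrow> g z) (at_right 0)"
proof -
  define \<eta> where "\<eta> n = 1 / real (Suc n)" for n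
  have \<eta>: "\<eta> n > 0" for n by (simp add: \<eta>_def)
  have "\<eta> \<longlonglongrightarrow> 0" unfolding \<eta>_def by (rule LIMSEQ_Suc[OF lim_1_over_n])
  then have "filterlim \<eta> (at_right 0) sequentially"
    using \<eta> by (intro tendsto_imp_filterlim_at_right) auto
  then have l: "(\<lambda>n. N2 lborel (\<lambda>z. hardy (\<eta> n) f z - g z)) \<longlonglongrightarrow> 0"
    by (rule filterlim_compose[OF lim])
  define w where "w n z = g z - hardy (\<eta> n) f z" for n z
  have w: "L2 lborel (w n)" for n unfolding w_def by (intro L2_diff g hardy_contraction f \<eta>)
  note [measurable] = L2_measurable[OF w]
  have w0: "(\<lambda>n. N2 lborel (w n)) \<longlonglongrightarrow> 0"
    using l unfolding w_def by (simp add: N2_minus_commute[of _ g])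
  have "\<forall>n. \<exists>H\<in>borel_measurable lborel. (\<forall>x e. 0 < e \<and> e \<le> 1 \<longrightarrow> (poisson e (\<lambda>s. ennreal (norm (w n s))) x)\<^sup>2 \<le> 4 * H x)
     \<and> (\<integral>\<^sup>+x. H x \<partial>lborel) \<le> 16 * (\<integral>\<^sup>+x. (ennreal (norm (w n x)))\<^sup>2 \<partial>lborel)"
    by (intro allI poisson_maximal) measurable
  then obtain H where H [measurable]: "\<And>n. H n \<in> borel_measurable lborel"
    and H_max: "\<And>n x e. 0 < e \<Longrightarrow> e \<le> 1 \<Longrightarrow> (poisson e (\<lambda>s. ennreal (norm (w n s))) x)\<^sup>2 \<le> 4 * H n x"
    and H_int: "\<And>n. (\<integral>\<^sup>+x. H n x \<partial>lborel) \<le> 16 * (\<integral>\<^sup>+x. (ennreal (norm (w n x)))\<^sup>2 \<partial>lborel)"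
    by metis
  define D where "D n x = 4 * H n x + ennreal ((norm (w n x))\<^sup>2)" for n x
  have [measurable]: "D n \<in> borel_measurable lborel" for n unfolding D_def by measurable
  have D_int: "(\<integral>\<^sup>+x. D n x \<partial>lborel) \<le> ennreal (65 * (N2 lborel (w n))\<^sup>2)" for n
  proof -
    have "(\<integral>\<^sup>+x. D n x \<partial>lborel) = 4 * (\<integral>\<^sup>+x. H n x \<partial>lborel) + ennreal ((N2 lborel (w n))\<^sup>2)"
      unfolding D_def by (simp add: nn_integral_add nn_integral_cmult nn_integral_N2[OF w])
    also have "\<dots> \<le> 4 * (16 * ennreal ((N2 lborel (w n))\<^sup>2)) + ennreal ((N2 lborel (w n))\<^sup>2)"
      using H_int[of n] by (intro add_mono mult_left_mono) (simp_all add: ennreal_power nn_integral_N2[OF w])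
    also have "\<dots> = ennreal (65 * (N2 lborel (w n))\<^sup>2)"
    proof -
      have "64 * X + X = (64 + 1) * X" for X :: ennreal unfolding distrib_right by simp
      then show ?thesis by (simp add: ennreal_mult mult.assoc[symmetric])
    qed
    finally show ?thesis .
  qed
  have "(\<integral>\<^sup>+x. (INF n. D n x) \<partial>lborel) = 0"
  proof -
    have "(\<integral>\<^sup>+x. (INF n. D n x) \<partial>lborel) \<le> ennreal (65 * (N2 lborel (w n))\<^sup>2)" for n
      by (rule order_trans[OF nn_integral_mono D_int]) (rule INF_lower, simp)
    moreover have "(\<lambda>n. ennreal (65 * (N2 lborel (w n))\<^sup>2)) \<longlonglongrightarrow> ennreal (65 * 0\<^sup>2)"
      by (intro tendsto_ennrealI tendsto_intros w0)
    ultimately have "(\<integral>\<^sup>+x. (INF n. D n x) \<partial>lborel) \<le> ennreal (65 * 0\<^sup>2)"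
      by (intro LIMSEQ_le_const) auto
    then show ?thesis by simp
  qed
  then have "AE x in lborel. (INF n. D n x) = 0"
    by (subst (asm) nn_integral_0_iff_AE) auto
  then show ?thesis
  proof eventually_elim
    case (elim z)
    show ?case
    proof (rule tendstoI)
      fix r :: real assume "r > 0"
      define \<rho> where "\<rho> = r / 3"
      have \<rho>: "\<rho> > 0" using \<open>r > 0\<close> by (simp add: \<rho>_def)
      have "(INF n. D n z) < ennreal (\<rho>\<^sup>2)" using elim \<rho> by simp
      then obtain n where n: "D n z < ennreal (\<rho>\<^sup>2)" by (auto simp: INF_less_iff)
      have wz: "norm (w n z) < \<rho>"
      proof (rule power2_less_imp_less)
        have "ennreal ((norm (w n z))\<^sup>2) \<le> D n z" by (simp add: D_def)
        also note n
        finally show "(norm (w n z))\<^sup>2 < \<rho>\<^sup>2" by (simp add: ennreal_less_iff)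
      qed (use \<rho> in simp)
      have Pz: "norm (poisson_integral e (w n) z) < \<rho>" if e: "0 < e" "e \<le> 1" for e
      proof (rule power2_less_imp_less)
        have "ennreal ((norm (poisson_integral e (w n) z))\<^sup>2) = (ennreal (norm (poisson_integral e (w n) z)))\<^sup>2"
          by (simp add: ennreal_power)
        also have "\<dots> \<le> (poisson e (\<lambda>s. ennreal (norm (w n s))) z)\<^sup>2"
          by (intro power_mono poisson_integral_bound w e) simp
        also have "\<dots> \<le> 4 * H n z" by (rule H_max[OF e])
        also have "\<dots> \<le> D n z" by (simp add: D_def)
        also note n
        finally show "(norm (poisson_integral e (w n) z))\<^sup>2 < \<rho>\<^sup>2" by (simp add: ennreal_less_iff)
      qed (use \<rho> in simp)
      have ev: "\<forall>\<^sub>F e in at_right 0. dist (hardy (e + \<eta> n) f z) (hardy (\<eta> n) f z) < \<rho>"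
        using tendstoD[OF hardy_vertical_limit[OF f \<eta>] \<rho>] .
      have "\<forall>\<^sub>F e in at_right (0::real). 0 < e \<and> e < 1"
        unfolding eventually_at_right_field by (intro exI[of _ 1]) auto
      with ev show "\<forall>\<^sub>F e in at_right 0. dist (hardy e f z) (g z) < r"
      proof eventually_elim
        case (elim e)
        then have e: "0 < e" "e \<le> 1" by auto
        have "hardy e f z = poisson_integral e (\<lambda>s. w n s + hardy (\<eta> n) f s) z"
          using poisson_integral_limit[OF f g e(1) lim] by (simp add: w_def)
        also have "\<dots> = poisson_integral e (w n) z + hardy (e + \<eta> n) f z"
          using poisson_integral_add[OF w hardy_contraction(1)[OF f \<eta>] e(1)] poisson_integral_hardy[OF f e(1) \<eta>] by simp
        finally have "hardy e f z - g z = poisson_integral e (w n) z + (hardy (e + \<eta> n) f z - hardy (\<eta> n) f z) - w n z"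
          by (simp add: w_def)
        also have "norm \<dots> \<le> norm (poisson_integral e (w n) z) + norm (hardy (e + \<eta> n) f z - hardy (\<eta> n) f z) + norm (w n z)"
          by (intro order_trans[OF norm_triangle_ineq4] add_mono norm_triangle_ineq order_refl)
        finally show ?case using Pz[OF e] elim wz by (simp add: dist_norm \<rho>_def)
      qed
    qed
  qed
qed

section \<open>The Szego projection on Lebesgue square-integrable functions\<close>

text \<open>
  The sign turns the boundary value from below into a projection.
\<close>

definition szego :: "(real \<Rightarrow> complex) \<Rightarrow> real \<Rightarrow> complex" where
  "szego f z = - plemelj_minus f z"

lemma hardy_tendsto_szego:
  assumes "L2 lborel f" and "((\<lambda>e. hardy e f z) \<longlongrightarrow> l) (at_right 0)"
  shows "szego f z = l"
proof -
  have [measurable]: "f \<in> borel_measurable lborel" using assms(1) by (rule L2_measurable)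
  have "cauchy_integral f (complex_of_real z - \<i> * complex_of_real e) = - hardy e f z" for e
  proof -
    have "(LINT s|lebesgue. f s / (complex_of_real s - (complex_of_real z - \<i> * complex_of_real e)))
        = (LINT s|lebesgue. f s * cauchy_kernel (complex_of_real z - \<i> * complex_of_real e) s)"
      by (simp add: cauchy_kernel_def)
    also have "\<dots> = cauchy_transform f (complex_of_real z - \<i> * complex_of_real e)"
      unfolding cauchy_transform_def by (rule integral_completion) measurable
    finally have "(LINT s|lebesgue. f s / (complex_of_real s - (complex_of_real z - \<i> * complex_of_real e)))
        = cauchy_transform f (complex_of_real z - \<i> * complex_of_real e)" .
    then show ?thesis unfolding cauchy_integral_def hardy_def by (simp add: divide_simps)
  qed
  then have "((\<lambda>e. cauchy_integral f (complex_of_real z - \<i> * complex_of_real e)) \<longlongrightarrow> - l) (at_right 0)"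
    using tendsto_minus[OF assms(2)] by simp
  then have "plemelj_minus f z = - l"
    unfolding plemelj_minus_def by (intro tendsto_Lim) auto
  then show ?thesis by (simp add: szego_def)
qed

lemma szego_cong_AE:
  assumes "f \<in> borel_measurable lebesgue" "g \<in> borel_measurable lebesgue" "AE z in lebesgue. f z = g z"
  shows "szego f = szego g"
proof -
  have [measurable]: "(\<lambda>s. complex_of_real s - w) \<in> borel_measurable lebesgue" for w
    by (rule measurable_completion) measurable
  have "cauchy_integral f w = cauchy_integral g w" for w
    unfolding cauchy_integral_def using assms
    by (intro arg_cong2[where f = times] refl integral_cong_AE borel_measurable_divide)
       (auto elim: eventually_mono)
  then show ?thesis by (simp add: szego_def plemelj_minus_def fun_eq_iff)
qed

lemma L2_borel_representative:
  fixes f :: "real \<Rightarrow> complex"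
  assumes f: "L2 lebesgue f"
  shows "\<exists>g. L2 lborel g \<and> (AE z in lebesgue. f z = g z)"
proof -
  have m: "f \<in> borel_measurable lebesgue" using f by (rule L2_measurable)
  then have "(\<lambda>z. Re (f z)) \<in> borel_measurable lebesgue" "(\<lambda>z. Im (f z)) \<in> borel_measurable lebesgue"
    by measurable
  from this[THEN completion_ex_borel_measurable_real] obtain u v
    where [measurable]: "u \<in> borel_measurable lborel" "v \<in> borel_measurable lborel"
      and uv: "AE z in lborel. Re (f z) = u z" "AE z in lborel. Im (f z) = v z" by blast
  define g where "g z = Complex (u z) (v z)" for z
  have gm [measurable]: "g \<in> borel_measurable lborel" unfolding g_def Complex_eq by measurable
  have "AE z in lborel. f z = g z" using uv by eventually_elim (simp add: g_def complex_eq_iff)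
  then have ae: "AE z in lebesgue. f z = g z" by (rule AE_completion)
  have "AE z in lebesgue. g z = f z" using ae by eventually_elim simp
  then have "L2 lebesgue g" by (rule L2_cong_AE[OF f measurable_completion[OF gm]])
  then have "L2 lborel g"
    unfolding L2_def using integrable_completion[of "\<lambda>x. (norm (g x))\<^sup>2" lborel] gm by simp
  with ae show ?thesis by blast
qed

lemma L2_lebesgue:
  assumes f: "L2 lborel f" shows "L2 lebesgue f"
proof -
  have [measurable]: "f \<in> borel_measurable lborel" using f by (rule L2_measurable)
  have "integrable lebesgue (\<lambda>x. (norm (f x))\<^sup>2)"
    by (subst integrable_completion) (use L2_integrable[OF f] in auto)
  moreover have "f \<in> borel_measurable lebesgue" by (rule measurable_completion) measurable
  ultimately show ?thesis by (simp add: L2_def)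
qed

lemma ip_lebesgue: "L2 lborel f \<Longrightarrow> L2 lborel g \<Longrightarrow> ip lebesgue f g = ip lborel f g"
  unfolding ip_def by (rule integral_completion) (intro borel_measurable_inner L2_measurable)

text \<open>
  Everything that later proofs need to know about the boundary values of \<open>f\<close>: a Borel representative \<open>f'\<close>,
  on which the results for \<open>lborel\<close> apply, and the limit \<open>g\<close>, both in mean square and almost everywhere.
\<close>

lemma szego_limit:
  assumes f: "L2 lebesgue f"
  obtains f' g where "L2 lborel f'" "AE z in lebesgue. f z = f' z" "L2 lborel g"
    "((\<lambda>e. N2 lborel (\<lambda>z. hardy e f' z - g z)) \<longlongrightarrow> 0) (at_right 0)"
    "AE z in lebesgue. ((\<lambda>e. hardy e f' z) \<longlongrightarrow> g z) (at_right 0)"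
    "szego f = szego f'" "AE z in lebesgue. szego f z = g z"
proof -
  obtain f' where f': "L2 lborel f'" "AE z in lebesgue. f z = f' z"
    using L2_borel_representative[OF f] by blast
  obtain g where g: "L2 lborel g" "((\<lambda>e. N2 lborel (\<lambda>z. hardy e f' z - g z)) \<longlongrightarrow> 0) (at_right 0)"
    using hardy_limit_L2[OF f'(1)] by blast
  have ae: "AE z in lebesgue. ((\<lambda>e. hardy e f' z) \<longlongrightarrow> g z) (at_right 0)"
    by (rule AE_completion) (rule hardy_limit_AE[OF f'(1) g])
  have eq: "szego f = szego f'"
    using f f' by (intro szego_cong_AE) (auto intro: L2_measurable L2_lebesgue)
  have "AE z in lebesgue. szego f z = g z"
    unfolding eq using ae by eventually_elim (rule hardy_tendsto_szego[OF f'(1)])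
  then show thesis by (rule that[OF f' g ae eq])
qed

lemma szego_L2:
  assumes f: "L2 lebesgue f" shows "L2 lebesgue (szego f)"
proof -
  obtain f' g where Df: "L2 lborel f'" "AE z in lebesgue. f z = f' z" "L2 lborel g"
    "((\<lambda>e. N2 lborel (\<lambda>z. hardy e f' z - g z)) \<longlongrightarrow> 0) (at_right 0)"
    "AE z in lebesgue. ((\<lambda>e. hardy e f' z) \<longlongrightarrow> g z) (at_right 0)"
    "szego f = szego f'" "AE z in lebesgue. szego f z = g z"
    by (rule szego_limit[OF f])
  have "AE z in lebesgue. g z = szego f z" using Df(7) by eventually_elim simp
  then have "szego f \<in> borel_measurable lebesgue"
    by (rule borel_measurable_AE[OF L2_measurable[OF L2_lebesgue[OF Df(3)]]])
  then show ?thesis using L2_cong_AE[OF L2_lebesgue[OF Df(3)]] Df(7) by blast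
qed

lemma szego_add:
  assumes f: "L2 lebesgue f" and g: "L2 lebesgue g"
  shows "AE z in lebesgue. szego (\<lambda>s. f s + g s) z = szego f z + szego g z"
proof -
  obtain f' u where Df: "L2 lborel f'" "AE z in lebesgue. f z = f' z" "L2 lborel u"
    "((\<lambda>e. N2 lborel (\<lambda>z. hardy e f' z - u z)) \<longlongrightarrow> 0) (at_right 0)"
    "AE z in lebesgue. ((\<lambda>e. hardy e f' z) \<longlongrightarrow> u z) (at_right 0)"
    "szego f = szego f'" "AE z in lebesgue. szego f z = u z"
    by (rule szego_limit[OF f])
  obtain g' v where Dg: "L2 lborel g'" "AE z in lebesgue. g z = g' z" "L2 lborel v"
    "((\<lambda>e. N2 lborel (\<lambda>z. hardy e g' z - v z)) \<longlongrightarrow> 0) (at_right 0)"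
    "AE z in lebesgue. ((\<lambda>e. hardy e g' z) \<longlongrightarrow> v z) (at_right 0)"
    "szego g = szego g'" "AE z in lebesgue. szego g z = v z"
    by (rule szego_limit[OF g])
  have "AE z in lebesgue. f z + g z = f' z + g' z" using Df(2) Dg(2) by eventually_elim simp
  then have eq: "szego (\<lambda>s. f s + g s) = szego (\<lambda>s. f' s + g' s)"
    using f g Df(1) Dg(1) by (intro szego_cong_AE) (auto intro!: L2_measurable L2_lebesgue L2_add)
  show ?thesis
    using Df(5,7) Dg(5,7) unfolding eq
  proof eventually_elim
    case (elim z)
    have "((\<lambda>e. hardy e (\<lambda>s. f' s + g' s) z) \<longlongrightarrow> u z + v z) (at_right 0)"
    proof (rule Lim_transform_eventually[OF tendsto_add[OF elim(1,3)]])
      show "\<forall>\<^sub>F e in at_right 0. hardy e f' z + hardy e g' z = hardy e (\<lambda>s. f' s + g' s) z"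
        using eventually_at_right_less[of "0::real"] by eventually_elim (simp add: hardy_add Df(1) Dg(1))
    qed
    then show ?case
      using elim hardy_tendsto_szego[OF L2_add[OF Df(1) Dg(1)]] by simp
  qed
qed

lemma szego_cmult:
  assumes f: "L2 lebesgue f"
  shows "AE z in lebesgue. szego (\<lambda>s. c * f s) z = c * szego f z"
proof -
  obtain f' u where Df: "L2 lborel f'" "AE z in lebesgue. f z = f' z" "L2 lborel u"
    "((\<lambda>e. N2 lborel (\<lambda>z. hardy e f' z - u z)) \<longlongrightarrow> 0) (at_right 0)"
    "AE z in lebesgue. ((\<lambda>e. hardy e f' z) \<longlongrightarrow> u z) (at_right 0)"
    "szego f = szego f'" "AE z in lebesgue. szego f z = u z"
    by (rule szego_limit[OF f])
  have L: "L2 lborel (\<lambda>s. c * f' s)"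
    by (rule L2_mono(1)[OF _ Df(1), of _ "norm c"]) (use L2_measurable[OF Df(1)] in \<open>auto simp: norm_mult\<close>)
  have "AE z in lebesgue. c * f z = c * f' z" using Df(2) by eventually_elim simp
  then have eq: "szego (\<lambda>s. c * f s) = szego (\<lambda>s. c * f' s)"
    using L2_measurable[OF f] L2_measurable[OF L2_lebesgue[OF L]] by (intro szego_cong_AE) auto
  show ?thesis
    using Df(5,7) unfolding eq
  proof eventually_elim
    case (elim z)
    have "((\<lambda>e. hardy e (\<lambda>s. c * f' s) z) \<longlongrightarrow> c * u z) (at_right 0)"
      unfolding hardy_cmult by (intro tendsto_intros elim)
    then show ?case using elim hardy_tendsto_szego[OF L] by simp
  qed
qed

text \<open>
  By \<open>cauchy_transform_hardy_limit\<close> the regularised projections of \<open>f'\<close> and of its boundary function \<open>g\<close>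
  coincide, hence so do their limits.
\<close>

lemma szego_idempotent:
  assumes f: "L2 lebesgue f"
  shows "AE z in lebesgue. szego (szego f) z = szego f z"
proof -
  obtain f' g where Df: "L2 lborel f'" "AE z in lebesgue. f z = f' z" "L2 lborel g"
    "((\<lambda>e. N2 lborel (\<lambda>z. hardy e f' z - g z)) \<longlongrightarrow> 0) (at_right 0)"
    "AE z in lebesgue. ((\<lambda>e. hardy e f' z) \<longlongrightarrow> g z) (at_right 0)"
    "szego f = szego f'" "AE z in lebesgue. szego f z = g z"
    by (rule szego_limit[OF f])
  have "szego (szego f) = szego g"
    using Df(7) by (intro szego_cong_AE) (auto intro: L2_measurable szego_L2 L2_lebesgue f Df(3))
  moreover have "AE z in lebesgue. szego g z = g z"
    using Df(5)
  proof eventually_elim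
    case (elim z)
    have "((\<lambda>e. hardy e g z) \<longlongrightarrow> g z) (at_right 0)"
    proof (rule Lim_transform_eventually[OF elim])
      show "\<forall>\<^sub>F e in at_right 0. hardy e f' z = hardy e g z"
        using eventually_at_right_less[of "0::real"]
        by eventually_elim (simp add: hardy_def cauchy_transform_hardy_limit(1)[OF Df(1,3) _ Df(4)])
    qed
    then show ?case by (rule hardy_tendsto_szego[OF Df(3)])
  qed
  ultimately show ?thesis using Df(7) by (auto elim: eventually_elim2)
qed

lemma szego_selfadjoint:
  assumes f: "L2 lebesgue f" and g: "L2 lebesgue g"
  shows "ip lebesgue (szego f) g = ip lebesgue f (szego g)"
proof -
  obtain f' u where Df: "L2 lborel f'" "AE z in lebesgue. f z = f' z" "L2 lborel u"
    "((\<lambda>e. N2 lborel (\<lambda>z. hardy e f' z - u z)) \<longlongrightarrow> 0) (at_right 0)"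
    "AE z in lebesgue. ((\<lambda>e. hardy e f' z) \<longlongrightarrow> u z) (at_right 0)"
    "szego f = szego f'" "AE z in lebesgue. szego f z = u z"
    by (rule szego_limit[OF f])
  obtain g' v where Dg: "L2 lborel g'" "AE z in lebesgue. g z = g' z" "L2 lborel v"
    "((\<lambda>e. N2 lborel (\<lambda>z. hardy e g' z - v z)) \<longlongrightarrow> 0) (at_right 0)"
    "AE z in lebesgue. ((\<lambda>e. hardy e g' z) \<longlongrightarrow> v z) (at_right 0)"
    "szego g = szego g'" "AE z in lebesgue. szego g z = v z"
    by (rule szego_limit[OF g])
  note M = L2_measurable[OF f] L2_measurable[OF g] L2_measurable[OF szego_L2[OF f]] L2_measurable[OF szego_L2[OF g]]
     L2_measurable[OF L2_lebesgue[OF Df(1)]] L2_measurable[OF L2_lebesgue[OF Dg(1)]]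
     L2_measurable[OF L2_lebesgue[OF Df(3)]] L2_measurable[OF L2_lebesgue[OF Dg(3)]]
  \<comment> \<open>Extending the regularised projections by their limit to \<open>e \<le> 0\<close> makes them square-integrable for all \<open>e\<close>.\<close>
  define h where "h k d e = (if e > 0 then hardy e k else d)" for k d :: "real \<Rightarrow> complex" and e :: real
  have ev: "\<forall>\<^sub>F e in at_right 0. (e::real) > 0" by (simp add: eventually_at_right_less)
  have h: "L2 lborel (h f' u e)" "L2 lborel (h g' v e)" for e
    unfolding h_def using Df(1,3) Dg(1,3) by (simp_all add: hardy_contraction)
  have h0: "((\<lambda>e. N2 lborel (\<lambda>z. h k d e z - d z)) \<longlongrightarrow> 0) (at_right 0)"
    if "((\<lambda>e. N2 lborel (\<lambda>z. hardy e k z - d z)) \<longlongrightarrow> 0) (at_right 0)" for k d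
    by (rule Lim_transform_eventually[OF that], use ev in eventually_elim) (simp add: h_def)
  have l1: "((\<lambda>e. ip lborel (h f' u e) g') \<longlongrightarrow> ip lborel u g') (at_right 0)"
    by (intro ip_tendsto_left h h0 Df(1,3,4) Dg(1,3,4))
  have l2: "((\<lambda>e. ip lborel (h g' v e) f') \<longlongrightarrow> ip lborel v f') (at_right 0)"
    by (intro ip_tendsto_left h h0 Df(1,3,4) Dg(1,3,4))
  have "\<forall>\<^sub>F e in at_right 0. ip lborel (h g' v e) f' = ip lborel (h f' u e) g'"
    using ev by eventually_elim (simp add: h_def hardy_selfadjoint Df(1) Dg(1) ip_commute[of lborel _ f'])
  from Lim_transform_eventually[OF l2 this] have "ip lborel u g' = ip lborel v f'"
    using tendsto_unique[OF trivial_limit_at_right_real l1] by blast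
  moreover have "ip lebesgue (szego f) g = ip lborel u g'"
    unfolding ip_lebesgue[OF Df(3) Dg(1), symmetric]
    using ip_cong_AE[OF M(3,7,2) Df(7)] ip_cong_AE[OF M(2,6,7) Dg(2)] by (simp add: ip_commute)
  moreover have "ip lebesgue f (szego g) = ip lborel v f'"
    unfolding ip_lebesgue[OF Dg(3) Df(1), symmetric]
    using ip_cong_AE[OF M(1,5,4) Df(2)] ip_cong_AE[OF M(4,8,5) Dg(7)] by (simp add: ip_commute)
  ultimately show ?thesis by simp
qed

section \<open>Coercive equations compressed by an orthogonal projection\<close>

text \<open>
  An orthogonal projection acting on functions rather than on classes, so its laws hold almost everywhere only.
\<close>

locale L2_projection =
  fixes M :: "'b measure" and Q :: "('b \<Rightarrow> 'a::euclidean_space) \<Rightarrow> 'b \<Rightarrow> 'a"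
  assumes Q_L2: "L2 M f \<Longrightarrow> L2 M (Q f)"
    and Q_add: "L2 M f \<Longrightarrow> L2 M g \<Longrightarrow> AE z in M. Q (\<lambda>s. f s + g s) z = Q f z + Q g z"
    and Q_scaleR: "L2 M f \<Longrightarrow> AE z in M. Q (\<lambda>s. c *\<^sub>R f s) z = c *\<^sub>R Q f z"
    and Q_cong: "L2 M f \<Longrightarrow> L2 M g \<Longrightarrow> AE z in M. f z = g z \<Longrightarrow> AE z in M. Q f z = Q g z"
    and Q_idempotent: "L2 M f \<Longrightarrow> AE z in M. Q (Q f) z = Q f z"
    and Q_selfadjoint: "L2 M f \<Longrightarrow> L2 M g \<Longrightarrow> ip M (Q f) g = ip M f (Q g)"
begin

lemma Q_diff:
  assumes "L2 M f" "L2 M g"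
  shows "AE z in M. Q (\<lambda>s. f s - g s) z = Q f z - Q g z"
  using Q_add[OF assms(1) L2_minus[OF assms(2)]] Q_scaleR[OF assms(2), of "-1"]
  by eventually_elim simp

lemma Q_contraction:
  assumes f: "L2 M f" shows "N2 M (Q f) \<le> N2 M f"
proof -
  note [simp] = Q_L2 f
  have "(N2 M (Q f))\<^sup>2 = ip M f (Q (Q f))" by (simp add: ip_self[symmetric] Q_selfadjoint)
  also have "\<dots> = ip M f (Q f)"
    unfolding ip_commute[of M f]
    by (intro ip_cong_AE Q_idempotent L2_measurable) simp_all
  also have "\<dots> \<le> N2 M f * N2 M (Q f)" using ip_bound[of M f "Q f"] by simp
  finally have "N2 M (Q f) * N2 M (Q f) \<le> N2 M f * N2 M (Q f)" by (simp add: power2_eq_square)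
  then show ?thesis by (cases "N2 M (Q f) = 0") (auto simp: mult_le_cancel_right less_le)
qed

text \<open>
  On the range of \<open>Q\<close> the equation says \<open>Q (A G) = Q b\<close>, and there \<open>Q A\<close> is bounded and coercive because
  \<open>\<langle>Q A D, D\<rangle> = \<langle>A D, Q D\<rangle> = \<langle>A D, D\<rangle>\<close>. Existence follows from the iteration \<open>G \<mapsto> G - t (Q (A G) - Q b)\<close>, a
  contraction for small \<open>t\<close>; uniqueness from coercivity applied to the difference of two solutions. The function
  \<open>w\<close> is the weight required by completeness.
\<close>

lemma coercive_equation_unique_solution:
  fixes A :: "'b \<Rightarrow> 'a \<Rightarrow> 'a" and b :: "'b \<Rightarrow> 'a" and w :: "'b \<Rightarrow> real"
  assumes lin: "\<And>z. linear (A z)"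
    and meas: "\<And>f. f \<in> borel_measurable M \<Longrightarrow> (\<lambda>z. A z (f z)) \<in> borel_measurable M"
    and bnd: "AE z in M. \<forall>v. norm (A z v) \<le> B * norm v" and B: "B \<ge> 0"
    and coercive: "AE z in M. \<forall>v. c * (norm v)\<^sup>2 \<le> A z v \<bullet> v" and c: "c > 0"
    and b: "L2 M b" and w: "L2 M w" "\<And>z. w z > 0"
  shows "\<exists>G. L2 M G \<and> (AE z in M. G z + Q (\<lambda>s. A s (G s) - G s) z = Q b z) \<and>
    (\<forall>G'. L2 M G' \<and> (AE z in M. G' z + Q (\<lambda>s. A s (G' s) - G' s) z = Q b z) \<longrightarrow> (AE z in M. G' z = G z))"
proof -
  define AA where "AA f z = A z (f z)" for f z
  have AA: "L2 M (AA f)" "N2 M (AA f) \<le> B * N2 M f" if f: "L2 M f" for f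
  proof -
    have "AA f \<in> borel_measurable M" unfolding AA_def[abs_def] by (rule meas[OF L2_measurable[OF f]])
    moreover have "AE z in M. norm (AA f z) \<le> B * norm (f z)"
      using bnd by eventually_elim (simp add: AA_def)
    ultimately show "L2 M (AA f)" "N2 M (AA f) \<le> B * N2 M f"
      using L2_mono[OF _ f B] by auto
  qed
  have AA_diff: "AA (\<lambda>s. f s - g s) = (\<lambda>s. AA f s - AA g s)" for f g
    by (simp add: AA_def fun_eq_iff linear_diff[OF lin])
  have AA_coercive: "c * (N2 M f)\<^sup>2 \<le> ip M (AA f) f" if f: "L2 M f" for f
  proof -
    have "c * (N2 M f)\<^sup>2 = (LINT z|M. c * (norm (f z))\<^sup>2)" by (simp add: N2_squared)
    also have "\<dots> \<le> ip M (AA f) f"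
      unfolding ip_def
    proof (rule integral_mono_AE)
      show "AE z in M. c * (norm (f z))\<^sup>2 \<le> AA f z \<bullet> f z"
        using coercive by eventually_elim (simp add: AA_def)
    qed (auto intro: L2_inner_integrable AA f L2_integrable)
    finally show ?thesis .
  qed
  note L2_intros = L2_diff L2_add L2_scaleR Q_L2 AA(1) b

  \<comment> \<open>The step size \<open>c / K\<close> nearly minimises \<open>1 - 2 t c + t\<^sup>2 B\<^sup>2\<close>; the extra summands of \<open>K\<close> keep \<open>\<rho>\<close> positive.\<close>
  define K where "K = B\<^sup>2 + c\<^sup>2 + 1"
  define t where "t = c / K"
  define \<rho> where "\<rho> = 1 - c\<^sup>2 / K"
  have K: "K > 0" "B\<^sup>2 \<le> K" "c\<^sup>2 < K" by (simp_all add: K_def add_nonneg_pos)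
  have t: "t > 0" using K c by (simp add: t_def)
  have \<rho>: "0 < \<rho>" "\<rho> < 1" using K c by (simp_all add: \<rho>_def)
  have contract: "N2 M (\<lambda>z. D z - t *\<^sub>R Q (AA D) z) \<le> sqrt \<rho> * N2 M D"
    if D: "L2 M D" and QD: "AE z in M. Q D z = D z" for D
  proof (rule power2_le_imp_le)
    have "c * (N2 M D)\<^sup>2 \<le> ip M D (AA D)"
      using AA_coercive[OF D] by (simp add: ip_commute)
    also have "\<dots> = ip M (Q D) (AA D)"
      using QD by (intro ip_cong_AE L2_measurable L2_intros D) (auto elim: eventually_mono)
    also have "\<dots> = ip M D (Q (AA D))" by (intro Q_selfadjoint L2_intros D)
    finally have 1: "c * (N2 M D)\<^sup>2 \<le> ip M D (Q (AA D))" .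
    have "N2 M (Q (AA D)) \<le> B * N2 M D"
      by (rule order_trans[OF Q_contraction AA(2)]) (intro AA D)+
    then have 2: "(N2 M (Q (AA D)))\<^sup>2 \<le> (B * N2 M D)\<^sup>2" by (intro power_mono) auto
    have "(N2 M (\<lambda>z. D z - t *\<^sub>R Q (AA D) z))\<^sup>2 = (N2 M D)\<^sup>2 - 2 * t * ip M D (Q (AA D)) + t\<^sup>2 * (N2 M (Q (AA D)))\<^sup>2"
      by (subst N2_diff_squared)
        (auto intro: L2_intros D simp: ip_commute[of M D] ip_scaleR_left N2_scaleR power_mult_distrib)
    also have "\<dots> \<le> (N2 M D)\<^sup>2 - 2 * t * (c * (N2 M D)\<^sup>2) + t\<^sup>2 * (B * N2 M D)\<^sup>2"
      using 1 2 t by (intro add_mono diff_mono mult_left_mono order_refl) auto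
    also have "\<dots> = (1 - 2 * t * c + t\<^sup>2 * B\<^sup>2) * (N2 M D)\<^sup>2" by (simp add: algebra_simps power_mult_distrib)
    also have "\<dots> \<le> \<rho> * (N2 M D)\<^sup>2"
    proof (rule mult_right_mono)
      have "t\<^sup>2 * B\<^sup>2 \<le> t\<^sup>2 * K" using K by (intro mult_left_mono) auto
      also have "\<dots> = c\<^sup>2 / K" using K by (simp add: t_def power2_eq_square)
      finally show "1 - 2 * t * c + t\<^sup>2 * B\<^sup>2 \<le> \<rho>" by (simp add: \<rho>_def t_def power2_eq_square)
    qed simp
    finally show "(N2 M (\<lambda>z. D z - t *\<^sub>R Q (AA D) z))\<^sup>2 \<le> (sqrt \<rho> * N2 M D)\<^sup>2"
      using \<rho> by (simp add: power_mult_distrib)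
  qed (use \<rho> in simp)

  define G where "G = rec_nat (\<lambda>z. 0) (\<lambda>n g z. g z - t *\<^sub>R (Q (AA g) z - Q b z))"
  have G_0: "G 0 = (\<lambda>z. 0)" and G_Suc: "G (Suc n) = (\<lambda>z. G n z - t *\<^sub>R (Q (AA (G n)) z - Q b z))" for n
    by (simp_all add: G_def)
  have GL: "L2 M (G n)" for n
  proof (induction n)
    case (Suc n)
    then show ?case unfolding G_Suc by (intro L2_intros)
  qed (simp add: G_0)
  define D where "D n z = G (Suc n) z - G n z" for n z
  have DL: "L2 M (D n)" for n unfolding D_def by (intro L2_diff GL)
  have D_eq: "D n z = - (t *\<^sub>R (Q (AA (G n)) z - Q b z))" for n z by (simp add: D_def G_Suc)
  have QD: "AE z in M. Q (D n) z = D n z" for n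
  proof -
    have "AE z in M. Q (\<lambda>s. (- t) *\<^sub>R (Q (AA (G n)) s - Q b s)) z = (- t) *\<^sub>R Q (\<lambda>s. Q (AA (G n)) s - Q b s) z"
      by (intro Q_scaleR L2_intros GL)
    moreover have "AE z in M. Q (\<lambda>s. Q (AA (G n)) s - Q b s) z = Q (Q (AA (G n))) z - Q (Q b) z"
      by (intro Q_diff L2_intros GL)
    moreover have "AE z in M. Q (Q (AA (G n))) z = Q (AA (G n)) z" "AE z in M. Q (Q b) z = Q b z"
      by (intro Q_idempotent L2_intros GL)+
    ultimately have "AE z in M. Q (\<lambda>s. (- t) *\<^sub>R (Q (AA (G n)) s - Q b s)) z = D n z"
      by eventually_elim (simp add: D_eq)
    then show ?thesis by (simp add: D_eq[abs_def])
  qed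
  have QG: "AE z in M. Q (G n) z = G n z" for n
  proof (induction n)
    case 0
    show ?case using Q_scaleR[of "\<lambda>z. 0" 0] by (simp add: G_0)
  next
    case (Suc n)
    have "AE z in M. Q (\<lambda>s. G n s + D n s) z = Q (G n) z + Q (D n) z" by (rule Q_add[OF GL DL])
    then show ?case using Suc QD[of n] by eventually_elim (simp add: D_def)
  qed
  have D_decay: "N2 M (D n) \<le> sqrt \<rho> ^ n * N2 M (D 0)" for n
  proof (induction n)
    case (Suc n)
    have "AE z in M. Q (\<lambda>s. AA (G (Suc n)) s - AA (G n) s) z = Q (AA (G (Suc n))) z - Q (AA (G n)) z"
      by (intro Q_diff AA GL)
    moreover have "AA (D n) = (\<lambda>s. AA (G (Suc n)) s - AA (G n) s)"
      unfolding D_def[abs_def] by (rule AA_diff)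
    ultimately have "AE z in M. Q (AA (D n)) z = Q (AA (G (Suc n))) z - Q (AA (G n)) z" by simp
    then have "AE z in M. D (Suc n) z = D n z - t *\<^sub>R Q (AA (D n)) z"
      by eventually_elim (simp add: D_eq scaleR_right_diff_distrib)
    then have "N2 M (D (Suc n)) = N2 M (\<lambda>z. D n z - t *\<^sub>R Q (AA (D n)) z)"
      by (intro N2_cong_AE L2_measurable L2_intros DL)
    also have "\<dots> \<le> sqrt \<rho> * N2 M (D n)" by (rule contract[OF DL QD])
    also have "\<dots> \<le> sqrt \<rho> * (sqrt \<rho> ^ n * N2 M (D 0))" using \<rho> by (intro mult_left_mono Suc) auto
    finally show ?case by (simp add: mult.assoc)
  qed simp
  define r where "r = sqrt \<rho>"
  have r: "0 \<le> r" "r < 1" using \<rho> by (simp_all add: r_def)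
  have pow0: "(\<lambda>n. C * r ^ n) \<longlonglongrightarrow> 0" for C
    using LIMSEQ_realpow_zero[OF r] by (rule tendsto_mult_right_zero)
  have D_0: "(\<lambda>n. N2 M (D n)) \<longlonglongrightarrow> 0"
    by (rule Lim_null_comparison[OF _ pow0[of "N2 M (D 0)"]]) (use D_decay in \<open>simp add: r_def mult.commute\<close>)
  have tail: "N2 M (\<lambda>z. G (n + k) z - G n z) \<le> N2 M (D 0) / (1 - r) * r ^ n" for n k
  proof -
    have "(1 - r) * N2 M (\<lambda>z. G (n + k) z - G n z) \<le> N2 M (D 0) * r ^ n * (1 - r ^ k)"
    proof (induction k)
      case 0 then show ?case by (simp add: N2_def)
    next
      case (Suc k)
      have "N2 M (\<lambda>z. G (n + Suc k) z - G n z) = N2 M (\<lambda>z. (G (n + k) z - G n z) + D (n + k) z)"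
        by (simp add: D_def)
      also have "\<dots> \<le> N2 M (\<lambda>z. G (n + k) z - G n z) + N2 M (D (n + k))"
        by (intro N2_triangle L2_diff GL DL)
      finally have "(1 - r) * N2 M (\<lambda>z. G (n + Suc k) z - G n z)
          \<le> (1 - r) * (N2 M (\<lambda>z. G (n + k) z - G n z) + N2 M (D (n + k)))"
        using r by (intro mult_left_mono) auto
      also have "\<dots> \<le> N2 M (D 0) * r ^ n * (1 - r ^ k) + (1 - r) * (r ^ (n + k) * N2 M (D 0))"
        unfolding distrib_left using r D_decay[of "n + k"] by (intro add_mono Suc mult_left_mono) (auto simp: r_def)
      also have "\<dots> = N2 M (D 0) * r ^ n * (1 - r ^ Suc k)" by (simp add: algebra_simps power_add)
      finally show ?case .
    qed
    also have "\<dots> \<le> N2 M (D 0) * r ^ n" using r by (intro mult_left_le) auto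
    finally show ?thesis using r by (simp add: field_simps)
  qed
  have "\<exists>N. \<forall>m\<ge>N. \<forall>n\<ge>N. N2 M (\<lambda>z. G m z - G n z) < e" if e: "e > 0" for e
  proof -
    obtain N where N: "N2 M (D 0) / (1 - r) * r ^ n < e" if "n \<ge> N" for n
      using order_tendstoD(2)[OF pow0[of "N2 M (D 0) / (1 - r)"] e] by (auto simp: eventually_sequentially)
    have *: "N2 M (\<lambda>z. G m z - G n z) < e" if "n \<ge> N" "n \<le> m" for m n
      using tail[of n "m - n"] N[OF that(1)] that by simp
    have "N2 M (\<lambda>z. G m z - G n z) < e" if "m \<ge> N" "n \<ge> N" for m n
      using *[of n m] *[of m n] that N2_minus_commute[of M "G m" "G n"] by (cases "n \<le> m") auto
    then show ?thesis by blast
  qed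
  from L2_complete[OF GL w this] obtain g where g: "L2 M g" and lim: "(\<lambda>n. N2 M (\<lambda>z. G n z - g z)) \<longlonglongrightarrow> 0" by blast

  have zero_AE: "AE z in M. u z = 0" if u: "L2 M u" and le: "\<And>n. N2 M u \<le> x n" and x: "x \<longlonglongrightarrow> 0" for u :: "'b \<Rightarrow> 'a" and x
  proof -
    have "N2 M u \<le> 0" by (rule LIMSEQ_le_const[OF x]) (use le in auto)
    then show ?thesis using N2_nonneg[of M u] by (intro N2_zero_AE u) simp
  qed
  have Qg: "AE z in M. Q g z - g z = 0"
  proof (rule zero_AE)
    show "N2 M (\<lambda>z. Q g z - g z) \<le> 2 * N2 M (\<lambda>z. G n z - g z)" for n
    proof -
      have "AE z in M. Q g z - g z = (G n z - g z) - Q (\<lambda>s. G n s - g s) z"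
        using Q_diff[OF GL g, of n] QG[of n] by eventually_elim simp
      then have "N2 M (\<lambda>z. Q g z - g z) = N2 M (\<lambda>z. (G n z - g z) - Q (\<lambda>s. G n s - g s) z)"
        by (intro N2_cong_AE L2_measurable L2_intros GL g)
      also have "\<dots> \<le> N2 M (\<lambda>z. G n z - g z) + N2 M (Q (\<lambda>s. G n s - g s))"
        by (intro N2_triangle_diff L2_intros GL g)
      also have "N2 M (Q (\<lambda>s. G n s - g s)) \<le> N2 M (\<lambda>z. G n z - g z)"
        by (intro Q_contraction L2_intros GL g)
      finally show ?thesis by simp
    qed
    show "(\<lambda>n. 2 * N2 M (\<lambda>z. G n z - g z)) \<longlonglongrightarrow> 0" by (rule tendsto_mult_right_zero[OF lim])
  qed (intro L2_intros g)
  have QAg: "AE z in M. Q (AA g) z - Q b z = 0"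
  proof (rule zero_AE)
    show "N2 M (\<lambda>z. Q (AA g) z - Q b z) \<le> B * N2 M (\<lambda>z. G n z - g z) + 1 / t * N2 M (D n)" for n
    proof -
      have "AE z in M. Q (AA g) z - Q b z = - Q (AA (\<lambda>s. G n s - g s)) z - (1 / t) *\<^sub>R D n z"
        unfolding AA_diff using Q_diff[OF AA(1)[OF GL] AA(1)[OF g], of n]
        by eventually_elim (use t in \<open>simp add: D_eq\<close>)
      then have "N2 M (\<lambda>z. Q (AA g) z - Q b z) = N2 M (\<lambda>z. - Q (AA (\<lambda>s. G n s - g s)) z - (1 / t) *\<^sub>R D n z)"
        by (intro N2_cong_AE L2_measurable L2_intros L2_minus GL DL g)
      also have "\<dots> \<le> N2 M (\<lambda>z. - Q (AA (\<lambda>s. G n s - g s)) z) + N2 M (\<lambda>z. (1 / t) *\<^sub>R D n z)"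
        by (intro N2_triangle_diff L2_intros L2_minus GL DL g)
      also have "N2 M (\<lambda>z. - Q (AA (\<lambda>s. G n s - g s)) z) = N2 M (Q (AA (\<lambda>s. G n s - g s)))"
        by (simp add: N2_def)
      also have "\<dots> \<le> B * N2 M (\<lambda>z. G n z - g z)"
        by (rule order_trans[OF Q_contraction AA(2)]) (intro L2_intros GL g)+
      finally show ?thesis using t by (simp add: N2_scaleR)
    qed
    have "(\<lambda>n. B * N2 M (\<lambda>z. G n z - g z) + 1 / t * N2 M (D n)) \<longlonglongrightarrow> B * 0 + 1 / t * 0"
      by (intro tendsto_intros lim D_0)
    then show "(\<lambda>n. B * N2 M (\<lambda>z. G n z - g z) + 1 / t * N2 M (D n)) \<longlonglongrightarrow> 0" by simp
  qed (intro L2_intros g)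
  have solution: "AE z in M. g z + Q (\<lambda>s. A s (g s) - g s) z = Q b z"
  proof -
    have "AE z in M. Q (\<lambda>s. AA g s - g s) z = Q (AA g) z - Q g z" by (intro Q_diff AA g)
    then show ?thesis using Qg QAg unfolding AA_def by eventually_elim simp
  qed
  have unique: "AE z in M. g' z = g z"
    if g': "L2 M g'" and s': "AE z in M. g' z + Q (\<lambda>s. A s (g' s) - g' s) z = Q b z" for g'
  proof -
    define d where "d z = g' z - g z" for z
    have d: "L2 M d" unfolding d_def by (intro L2_diff g g')
    have "AE z in M. Q (\<lambda>s. (AA g' s - g' s) - (AA g s - g s)) z
        = Q (\<lambda>s. AA g' s - g' s) z - Q (\<lambda>s. AA g s - g s) z"
      by (intro Q_diff L2_intros g g')
    moreover have "(\<lambda>s. (AA g' s - g' s) - (AA g s - g s)) = (\<lambda>s. AA d s - d s)"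
      by (simp add: AA_def d_def linear_diff[OF lin] fun_eq_iff)
    ultimately have diff: "AE z in M. Q (\<lambda>s. AA d s - d s) z = Q (\<lambda>s. AA g' s - g' s) z - Q (\<lambda>s. AA g s - g s) z"
      by simp
    define h where "h s = AA d s - d s" for s
    have h: "L2 M h" unfolding h_def by (intro L2_intros d)
    \<comment> \<open>The difference of two solutions lies in the range of \<open>Q\<close>, and \<open>Q A\<close> annihilates it.\<close>
    have d_eq: "AE z in M. d z = (- 1) *\<^sub>R Q h z"
      using s' solution diff unfolding AA_def[symmetric] h_def[abs_def] AA_def[abs_def, symmetric]
    proof eventually_elim
      case (elim z)
      have "d z = (Q b z - Q (\<lambda>s. AA g' s - g' s) z) - (Q b z - Q (\<lambda>s. AA g s - g s) z)"
        unfolding d_def using elim(1,2) by (metis add_diff_cancel_right')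
      then show ?case using elim(3) by simp
    qed
    have Qd: "AE z in M. Q d z = d z"
      using Q_cong[OF d L2_scaleR[OF Q_L2[OF h], of "- 1"] d_eq] Q_scaleR[OF Q_L2[OF h], of "- 1"]
        Q_idempotent[OF h] d_eq by eventually_elim simp
    have "AE z in M. Q (\<lambda>s. h s + d s) z = Q h z + Q d z" by (rule Q_add[OF h d])
    then have QAd: "AE z in M. Q (AA d) z = 0"
      using Qd d_eq by eventually_elim (simp add: h_def)
    have "c * (N2 M d)\<^sup>2 \<le> ip M (AA d) d" by (rule AA_coercive[OF d])
    also have "\<dots> = ip M (Q d) (AA d)"
      unfolding ip_commute[of M "AA d"]
      using Qd by (intro ip_cong_AE L2_measurable L2_intros d) (auto elim: eventually_mono)
    also have "\<dots> = ip M (Q (AA d)) d"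
      using Q_selfadjoint[OF AA(1)[OF d] d] by (simp add: ip_commute)
    also have "\<dots> = ip M (\<lambda>z. 0) d"
      using QAd by (intro ip_cong_AE L2_measurable L2_intros d) auto
    also have "\<dots> = 0" by (simp add: ip_def)
    finally have "N2 M d = 0" using c by (simp add: mult_le_0_iff)
    then show ?thesis using N2_zero_AE[OF d] by (simp add: d_def)
  qed
  show ?thesis using g solution unique by blast
qed
end

section \<open>The jump matrix and the Riemann-Hilbert equation\<close>

lemma borel_measurable_matrix:
  fixes F :: "'b \<Rightarrow> complex^2^2"
  assumes "\<And>i j. (\<lambda>z. F z $ i $ j) \<in> borel_measurable M"
  shows "F \<in> borel_measurable M"
proof (subst borel_measurable_euclidean_space, intro ballI)
  fix k :: "complex^2^2" assume "k \<in> Basis"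
  then obtain i j u where k: "k = axis i (axis j u)" by (auto simp: Basis_vec_def)
  have "(\<lambda>z. F z \<bullet> k) = (\<lambda>z. F z $ i $ j \<bullet> u)" by (simp add: k inner_axis)
  then show "(\<lambda>z. F z \<bullet> k) \<in> borel_measurable M" using assms[of i j] by simp
qed

lemma borel_measurable_entry:
  fixes F :: "'b \<Rightarrow> complex^2^2"
  assumes "F \<in> borel_measurable M"
  shows "(\<lambda>z. F z $ i $ j) \<in> borel_measurable M"
proof -
  have "continuous_on UNIV (\<lambda>x :: complex^2^2. x $ i $ j)" by (intro continuous_intros)
  from borel_measurable_continuous_onI[OF this] show ?thesis
    using assms by (rule measurable_compose[rotated])
qed

lemma norm_matrix_squared:
  fixes X :: "complex^2^2"
  shows "(norm X)\<^sup>2 = (\<Sum>i\<in>UNIV. \<Sum>j\<in>UNIV. (norm (X $ i $ j))\<^sup>2)"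
  by (simp add: norm_vec_def L2_set_def sum_nonneg)

lemma norm_entry_le: "norm (X $ i $ j) \<le> norm X" for X :: "complex^2^2"
  by (rule order_trans[OF Finite_Cartesian_Product.norm_nth_le Finite_Cartesian_Product.norm_nth_le])

lemma L2_matrix_iff:
  fixes F :: "'b \<Rightarrow> complex^2^2"
  shows "L2 M F \<longleftrightarrow> (\<forall>i j. L2 M (\<lambda>z. F z $ i $ j))"
proof
  assume F: "L2 M F"
  show "\<forall>i j. L2 M (\<lambda>z. F z $ i $ j)"
  proof (intro allI)
    fix i j
    show "L2 M (\<lambda>z. F z $ i $ j)"
      by (rule L2_mono(1)[OF borel_measurable_entry[OF L2_measurable[OF F]] F, of 1]) (simp_all add: norm_entry_le)
  qed
next
  assume "\<forall>i j. L2 M (\<lambda>z. F z $ i $ j)"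
  then show "L2 M F"
    unfolding L2_def norm_matrix_squared by (auto intro!: borel_measurable_matrix)
qed

lemma ip_matrix:
  fixes F G :: "'b \<Rightarrow> complex^2^2"
  assumes "L2 M F" "L2 M G"
  shows "ip M F G = (\<Sum>i\<in>UNIV. \<Sum>j\<in>UNIV. ip M (\<lambda>z. F z $ i $ j) (\<lambda>z. G z $ i $ j))"
proof -
  have "integrable M (\<lambda>z. F z $ i $ j \<bullet> G z $ i $ j)" for i j
    using assms by (intro L2_inner_integrable) (auto simp: L2_matrix_iff)
  then show ?thesis unfolding ip_def inner_vec_def by simp
qed

definition szego_matrix :: "(real \<Rightarrow> complex^2^2) \<Rightarrow> real \<Rightarrow> complex^2^2" where
  "szego_matrix F z = (\<chi> i j. szego (\<lambda>s. F s $ i $ j) z)"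

lemma AE_matrix_eqI:
  assumes "\<And>i j. AE z in M. F z $ i $ j = (G z :: complex^2^2) $ i $ j"
  shows "AE z in M. F z = G z"
proof -
  have "AE z in M. \<forall>i j. F z $ i $ j = G z $ i $ j"
    using assms by (simp add: AE_all_countable)
  then show ?thesis by eventually_elim (simp add: vec_eq_iff)
qed

interpretation szego_matrix: L2_projection lebesgue szego_matrix
proof
  fix F G :: "real \<Rightarrow> complex^2^2" and c :: real
  assume F: "L2 lebesgue F"
  then have Fe: "L2 lebesgue (\<lambda>z. F z $ i $ j)" for i j by (simp add: L2_matrix_iff)
  show LF: "L2 lebesgue (szego_matrix F)"
    unfolding L2_matrix_iff szego_matrix_def using szego_L2[OF Fe] by simp
  show "AE z in lebesgue. szego_matrix (\<lambda>s. c *\<^sub>R F s) z = c *\<^sub>R szego_matrix F z"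
    by (rule AE_matrix_eqI) (use szego_cmult[OF Fe, of "complex_of_real c"] in \<open>simp add: szego_matrix_def scaleR_conv_of_real[of _ "_ :: complex"]\<close>)
  show "AE z in lebesgue. szego_matrix (szego_matrix F) z = szego_matrix F z"
    by (rule AE_matrix_eqI) (use szego_idempotent[OF Fe] in \<open>simp add: szego_matrix_def\<close>)
  assume G: "L2 lebesgue G"
  then have Ge: "L2 lebesgue (\<lambda>z. G z $ i $ j)" for i j by (simp add: L2_matrix_iff)
  have LG: "L2 lebesgue (szego_matrix G)"
    unfolding L2_matrix_iff szego_matrix_def using szego_L2[OF Ge] by simp
  show "AE z in lebesgue. szego_matrix (\<lambda>s. F s + G s) z = szego_matrix F z + szego_matrix G z"
    by (rule AE_matrix_eqI) (use szego_add[OF Fe Ge] in \<open>simp add: szego_matrix_def\<close>)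
  show "ip lebesgue (szego_matrix F) G = ip lebesgue F (szego_matrix G)"
    unfolding ip_matrix[OF LF G] ip_matrix[OF F LG]
    by (intro sum.cong refl) (use szego_selfadjoint[OF Fe Ge] in \<open>simp add: szego_matrix_def\<close>)
  assume eq: "AE z in lebesgue. F z = G z"
  have "szego (\<lambda>s. F s $ i $ j) = szego (\<lambda>s. G s $ i $ j)" for i j
    using eq by (intro szego_cong_AE L2_measurable Fe Ge) (auto elim: eventually_mono)
  then show "AE z in lebesgue. szego_matrix F z = szego_matrix G z" by (simp add: szego_matrix_def)
qed

lemma plemelj_minus_mat_szego: "plemelj_minus_mat F z = - szego_matrix F z"
  by (simp add: plemelj_minus_mat_def szego_matrix_def szego_def vec_eq_iff)

lemma kz_in_Reals: "kz z \<in> \<real> \<longleftrightarrow> z \<ge> 0"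
proof (cases "z \<ge> 0")
  case False
  then have "Im (kz z) \<noteq> 0" by (simp add: kz_neg)
  then show ?thesis using False by (auto simp: complex_is_Real_iff)
qed (simp add: kz_nonneg)

text \<open>
  The two formulas for the jump matrix differ only in signs once \<open>r\<close> and its exponential factor are combined;
  the modulus is that of \<open>r\<close>.
\<close>

definition jump_phase :: "(complex \<Rightarrow> complex) \<Rightarrow> real \<Rightarrow> real \<Rightarrow> complex" where
  "jump_phase r x z = r (kz z) * exp (2 * \<i> * complex_of_real z * complex_of_real x)"

lemma norm_jump_phase: "norm (jump_phase r x z) = norm (r (kz z))"
proof -
  have "2 * \<i> * complex_of_real z * complex_of_real x = \<i> * complex_of_real (2 * z * x)" by simp
  then show ?thesis unfolding jump_phase_def norm_mult by (simp only: norm_exp_i_times mult_1_right)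
qed

lemma J_kz:
  "J r x (kz z) = (if z \<ge> 0
     then vector [vector [complex_of_real ((norm (jump_phase r x z))\<^sup>2), cnj (jump_phase r x z)], vector [jump_phase r x z, 0]]
     else vector [vector [- complex_of_real ((norm (jump_phase r x z))\<^sup>2), - cnj (jump_phase r x z)], vector [jump_phase r x z, 0]])"
proof -
  have "cnj (exp (2 * \<i> * complex_of_real z * complex_of_real x)) = exp (- 2 * \<i> * complex_of_real z * complex_of_real x)"
    by (simp add: exp_cnj)
  then show ?thesis
    unfolding J_def kz_in_Reals kz_squared norm_jump_phase
    by (simp add: jump_phase_def)
qed

lemma J_entries:
  "J r x (kz z) $ 1 $ 1 = (if z \<ge> 0 then complex_of_real ((norm (jump_phase r x z))\<^sup>2) else - complex_of_real ((norm (jump_phase r x z))\<^sup>2))"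
  "J r x (kz z) $ 1 $ 2 = (if z \<ge> 0 then cnj (jump_phase r x z) else - cnj (jump_phase r x z))"
  "J r x (kz z) $ 2 $ 1 = jump_phase r x z"
  "J r x (kz z) $ 2 $ 2 = 0"
  by (simp_all add: J_kz)

lemma matrix_mult_entries:
  fixes X Y :: "complex^2^2"
  shows "(X ** Y) $ i $ j = X $ i $ 1 * Y $ 1 $ j + X $ i $ 2 * Y $ 2 $ j"
  by (simp add: matrix_matrix_mult_def sum_2)

lemma inner_matrix_rows:
  fixes X Y :: "complex^2^2"
  shows "X \<bullet> Y = (\<Sum>i\<in>UNIV. X $ i $ 1 \<bullet> Y $ i $ 1 + X $ i $ 2 \<bullet> Y $ i $ 2)"
  by (simp add: inner_vec_def sum_2)

text \<open>
  For a row \<open>(a, b)\<close> and \<open>p\<close> the phase factor, the quadratic form is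
  \<open>\<bar>a\<bar>\<^sup>2 + \<bar>p\<bar>\<^sup>2 \<bar>a\<bar>\<^sup>2 + \<bar>b\<bar>\<^sup>2 + 2 Re (b p a\<^sup>*)\<close>, at least \<open>\<bar>a\<bar>\<^sup>2 + (\<bar>p\<bar> \<bar>a\<bar> - \<bar>b\<bar>)\<^sup>2\<close>. This is coercive
  as long as \<open>p\<close> is bounded.
\<close>

lemma J_coercive_nonneg:
  fixes X :: "complex^2^2"
  assumes z: "z \<ge> 0" and R: "norm (r (kz z)) \<le> R"
  shows "1 / (3 + 2 * R\<^sup>2) * (norm X)\<^sup>2 \<le> (X ** (J r x (kz z) + mat 1)) \<bullet> X"
proof -
  define p where "p = jump_phase r x z"
  define q where "q = norm p"
  have q: "0 \<le> q" "q \<le> R" using R by (simp_all add: q_def p_def norm_jump_phase)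
  then have q2: "q\<^sup>2 \<le> R\<^sup>2" by (intro power_mono) auto
  have K: "3 + 2 * R\<^sup>2 > 0" by (simp add: add_pos_nonneg)
  have row: "1 / (3 + 2 * R\<^sup>2) * ((norm a)\<^sup>2 + (norm b)\<^sup>2)
     \<le> (a * (complex_of_real (q\<^sup>2) + 1) + b * p) \<bullet> a + (a * cnj p + b) \<bullet> b" for a b :: complex
  proof -
    have "(a * (complex_of_real (q\<^sup>2) + 1) + b * p) \<bullet> a + (a * cnj p + b) \<bullet> b
      = (norm a)\<^sup>2 * (1 + q\<^sup>2) + (norm b)\<^sup>2 + 2 * ((b * p) \<bullet> a)"
      unfolding inner_complex_def cmod_power2 by (simp add: power2_eq_square algebra_simps)
    moreover have "- ((b * p) \<bullet> a) \<le> norm b * q * norm a"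
      using Cauchy_Schwarz_ineq2[of "b * p" a] by (simp add: norm_mult q_def)
    ultimately have 1: "(norm a)\<^sup>2 + (q * norm a - norm b)\<^sup>2 \<le> (a * (complex_of_real (q\<^sup>2) + 1) + b * p) \<bullet> a + (a * cnj p + b) \<bullet> b"
      by (simp add: power2_eq_square algebra_simps)
    define u v where "u = norm a" and "v = norm b"
    have "0 \<le> (v - 2 * (q * u))\<^sup>2" by simp
    then have "v\<^sup>2 \<le> 2 * (q * u - v)\<^sup>2 + 2 * (q\<^sup>2 * u\<^sup>2)" by (simp add: power2_eq_square algebra_simps)
    also have "\<dots> \<le> 2 * (q * u - v)\<^sup>2 + 2 * (R\<^sup>2 * u\<^sup>2)" using q2 by (simp add: mult_right_mono)
    finally have v: "v\<^sup>2 \<le> 2 * (q * u - v)\<^sup>2 + 2 * (R\<^sup>2 * u\<^sup>2)" .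
    have "(3 + 2 * R\<^sup>2) * (u\<^sup>2 + (q * u - v)\<^sup>2) = u\<^sup>2 + (2 * (q * u - v)\<^sup>2 + 2 * (R\<^sup>2 * u\<^sup>2)) + (2 * u\<^sup>2 + (q * u - v)\<^sup>2 + 2 * (R\<^sup>2 * (q * u - v)\<^sup>2))"
      by (simp add: algebra_simps)
    moreover have "0 \<le> 2 * u\<^sup>2 + (q * u - v)\<^sup>2 + 2 * (R\<^sup>2 * (q * u - v)\<^sup>2)" by simp
    ultimately have "u\<^sup>2 + v\<^sup>2 \<le> (3 + 2 * R\<^sup>2) * (u\<^sup>2 + (q * u - v)\<^sup>2)" using v by linarith
    then have "1 / (3 + 2 * R\<^sup>2) * (u\<^sup>2 + v\<^sup>2) \<le> u\<^sup>2 + (q * u - v)\<^sup>2"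
      using K by (simp add: field_simps)
    with 1 show ?thesis unfolding u_def v_def by linarith
  qed
  have "1 / (3 + 2 * R\<^sup>2) * (norm X)\<^sup>2 = (\<Sum>i\<in>UNIV. 1 / (3 + 2 * R\<^sup>2) * ((norm (X $ i $ 1))\<^sup>2 + (norm (X $ i $ 2))\<^sup>2))"
    unfolding norm_matrix_squared sum_2 distrib_left by simp
  also have "\<dots> \<le> (\<Sum>i\<in>UNIV. (X $ i $ 1 * (complex_of_real (q\<^sup>2) + 1) + X $ i $ 2 * p) \<bullet> X $ i $ 1 + (X $ i $ 1 * cnj p + X $ i $ 2) \<bullet> X $ i $ 2)"
    by (intro sum_mono row)
  also have "\<dots> = (X ** (J r x (kz z) + mat 1)) \<bullet> X"
    unfolding inner_matrix_rows matrix_mult_entries J_kz using z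
    by (intro sum.cong refl) (simp add: p_def[symmetric] q_def mat_def)
  finally show ?thesis .
qed

text \<open>
  Here the off-diagonal terms of the quadratic form are purely imaginary and only the diagonal
  \<open>(1 - \<bar>r\<bar>\<^sup>2, 1)\<close> of \<open>1 + J\<close> remains.
\<close>

lemma J_coercive_neg:
  fixes X :: "complex^2^2"
  assumes z: "z < 0" and c: "c \<le> 1" "c \<le> 1 - (norm (r (kz z)))\<^sup>2"
  shows "c * (norm X)\<^sup>2 \<le> (X ** (J r x (kz z) + mat 1)) \<bullet> X"
proof -
  define p where "p = jump_phase r x z"
  define q where "q = norm p"
  have q: "c \<le> 1 - q\<^sup>2" using c(2) by (simp add: q_def p_def norm_jump_phase)
  have row: "c * ((norm a)\<^sup>2 + (norm b)\<^sup>2)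
     \<le> (a * (- complex_of_real (q\<^sup>2) + 1) + b * p) \<bullet> a + (a * (- cnj p) + b) \<bullet> b" for a b :: complex
  proof -
    have "(a * (- complex_of_real (q\<^sup>2) + 1) + b * p) \<bullet> a + (a * (- cnj p) + b) \<bullet> b
      = (1 - q\<^sup>2) * (norm a)\<^sup>2 + 1 * (norm b)\<^sup>2"
      unfolding inner_complex_def cmod_power2 by (simp add: power2_eq_square algebra_simps)
    moreover have "c * (norm a)\<^sup>2 \<le> (1 - q\<^sup>2) * (norm a)\<^sup>2" "c * (norm b)\<^sup>2 \<le> 1 * (norm b)\<^sup>2"
      by (intro mult_right_mono q c; simp)+
    ultimately show ?thesis by (simp add: distrib_left)
  qed
  have "c * (norm X)\<^sup>2 = (\<Sum>i\<in>UNIV. c * ((norm (X $ i $ 1))\<^sup>2 + (norm (X $ i $ 2))\<^sup>2))"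
    unfolding norm_matrix_squared sum_2 distrib_left by simp
  also have "\<dots> \<le> (\<Sum>i\<in>UNIV. (X $ i $ 1 * (- complex_of_real (q\<^sup>2) + 1) + X $ i $ 2 * p) \<bullet> X $ i $ 1 + (X $ i $ 1 * (- cnj p) + X $ i $ 2) \<bullet> X $ i $ 2)"
    by (intro sum_mono row)
  also have "\<dots> = (X ** (J r x (kz z) + mat 1)) \<bullet> X"
    unfolding inner_matrix_rows matrix_mult_entries J_kz using z
    by (intro sum.cong refl) (simp add: p_def[symmetric] q_def mat_def)
  finally show ?thesis .
qed

text \<open>
  Square-integrability of \<open>J\<close> follows from this: the entry \<open>\<bar>r\<bar>\<^sup>2\<close> is square-integrable because \<open>r\<close> is also
  essentially bounded.
\<close>

lemma J_entry_bound:
  assumes "norm (r (kz z)) \<le> R"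
  shows "norm (J r x (kz z) $ i $ j) \<le> (1 + R) * norm (r (kz z))"
proof -
  have R: "0 \<le> R" using assms norm_ge_zero order_trans by blast
  have sq: "(norm (r (kz z)))\<^sup>2 \<le> (1 + R) * norm (r (kz z))"
    unfolding power2_eq_square using assms by (intro mult_right_mono) auto
  have id: "norm (r (kz z)) \<le> (1 + R) * norm (r (kz z))"
    using R by (simp add: algebra_simps)
  show ?thesis
    using exhaust_2[of i] exhaust_2[of j] sq id R unfolding J_kz
    by (auto simp: norm_jump_phase norm_power)
qed

lemma J_measurable:
  assumes r: "(\<lambda>z. r (kz z)) \<in> borel_measurable lebesgue"
  shows "(\<lambda>z. J r x (kz z)) \<in> borel_measurable lebesgue"
proof -
  have [measurable]: "(\<lambda>z. exp (2 * \<i> * complex_of_real z * complex_of_real x)) \<in> borel_measurable lebesgue"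
    by (rule measurable_completion) measurable
  have p [measurable]: "jump_phase r x \<in> borel_measurable lebesgue"
    unfolding jump_phase_def using r by measurable
  have [measurable]: "(\<lambda>z. cnj (jump_phase r x z)) \<in> borel_measurable lebesgue"
    by (rule measurable_compose[OF p borel_measurable_continuous_onI[OF continuous_on_cnj[OF continuous_on_id]]])
  have [measurable]: "Measurable.pred lebesgue (\<lambda>z::real. 0 \<le> z)"
    by (rule measurable_completion) measurable
  show ?thesis
  proof (rule borel_measurable_matrix)
    fix i j :: 2
    show "(\<lambda>z. J r x (kz z) $ i $ j) \<in> borel_measurable lebesgue"
      using exhaust_2[of i] exhaust_2[of j] by (auto simp: J_entries)
  qed
qed

lemma norm_matrix_le_sum: "norm X \<le> (\<Sum>i\<in>UNIV. \<Sum>j\<in>UNIV. norm (X $ i $ j))" for X :: "complex^2^2"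
proof -
  have "norm X \<le> (\<Sum>i\<in>UNIV. norm (X $ i))" unfolding norm_vec_def[of X] by (rule L2_set_le_sum) simp
  also have "\<dots> \<le> (\<Sum>i\<in>UNIV. \<Sum>j\<in>UNIV. norm (X $ i $ j))"
    unfolding norm_vec_def[of "X $ _"] by (intro sum_mono L2_set_le_sum) simp
  finally show ?thesis .
qed

lemma norm_matrix_mult_le:
  fixes X Y :: "complex^2^2"
  assumes "\<And>i j. norm (Y $ i $ j) \<le> \<beta>"
  shows "norm (X ** Y) \<le> 8 * \<beta> * norm X"
proof -
  have \<beta>: "0 \<le> \<beta>" using assms[of 1 1] norm_ge_zero order_trans by blast
  have "norm (X ** Y) \<le> (\<Sum>i\<in>UNIV. \<Sum>j\<in>UNIV. norm ((X ** Y) $ i $ j))" by (rule norm_matrix_le_sum)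
  also have "\<dots> \<le> (\<Sum>i\<in>(UNIV::2 set). \<Sum>j\<in>(UNIV::2 set). 2 * (norm X * \<beta>))"
  proof (intro sum_mono)
    fix i j :: 2
    have "norm ((X ** Y) $ i $ j) \<le> norm (X $ i $ 1 * Y $ 1 $ j) + norm (X $ i $ 2 * Y $ 2 $ j)"
      unfolding matrix_mult_entries by (rule norm_triangle_ineq)
    also have "\<dots> \<le> norm X * \<beta> + norm X * \<beta>"
      unfolding norm_mult by (intro add_mono mult_mono norm_entry_le assms) auto
    finally show "norm ((X ** Y) $ i $ j) \<le> 2 * (norm X * \<beta>)" by linarith
  qed
  also have "\<dots> = 8 * \<beta> * norm X" by simp
  finally show ?thesis .
qed

theorem proposition5:
  fixes r :: "complex \<Rightarrow> complex" and c0 :: real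
  assumes "in_L2 (\<lambda>z. r (kz z))"
    and "in_Linf (\<lambda>z. r (kz z))"
    and "c0 > 0"
    and "\<And>k. Re k = 0 \<Longrightarrow> 1 - (norm (r k))\<^sup>2 \<ge> c0\<^sup>2"
  shows "\<forall>x::real. \<exists>G :: real \<Rightarrow> complex^2^2.
           in_L2 G \<and> solves_RH_equation r x G \<and>
           (\<forall>G'. in_L2 G' \<and> solves_RH_equation r x G' \<longrightarrow> (AE z in lebesgue. G' z = G z))"
proof
  fix x :: real
  have in_L2: "in_L2 f \<longleftrightarrow> L2 lebesgue f" for f :: "real \<Rightarrow> 'c::euclidean_space"
    by (simp add: in_L2_def L2_def)
  have rL: "L2 lebesgue (\<lambda>z. r (kz z))" using assms(1) by (simp add: in_L2)
  obtain R0 where "AE z in lebesgue. norm (r (kz z)) \<le> R0" using assms(2) by (auto simp: in_Linf_def)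
  then have R: "AE z in lebesgue. norm (r (kz z)) \<le> \<bar>R0\<bar>" by eventually_elim simp
  define R where "R = \<bar>R0\<bar>"
  have R0: "R \<ge> 0" and R: "AE z in lebesgue. norm (r (kz z)) \<le> R" using R by (simp_all add: R_def)
  define j where "j z = J r x (kz z)" for z
  have jm: "j \<in> borel_measurable lebesgue"
    unfolding j_def[abs_def] by (rule J_measurable[OF L2_measurable[OF rL]])
  have jL: "L2 lebesgue j"
    unfolding L2_matrix_iff
  proof (intro allI)
    fix a b
    have "AE z in lebesgue. norm (j z $ a $ b) \<le> (1 + R) * norm (r (kz z))"
      using R by eventually_elim (simp add: j_def J_entry_bound)
    then show "L2 lebesgue (\<lambda>z. j z $ a $ b)"
      by (rule L2_mono(1)[OF borel_measurable_entry[OF jm] rL, rotated]) (use R0 in simp)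
  qed
  define A where "A z X = X ** (j z + mat 1)" for z and X :: "complex^2^2"
  have A_j: "A z X - X = X ** j z" for z X
    by (simp add: A_def matrix_add_ldistrib)
  define c where "c = min (1 / (3 + 2 * R\<^sup>2)) (c0\<^sup>2)"
  have c: "c > 0" using \<open>c0 > 0\<close> by (simp add: c_def add_pos_nonneg)
  \<comment> \<open>The point \<open>k = 0\<close> lies on the imaginary axis.\<close>
  have c1: "c0\<^sup>2 \<le> 1" using assms(4)[of 0] by (simp add: algebra_simps) (smt (verit) zero_le_power2)
  let ?\<beta> = "(1 + R) * R + 1"
  have "\<exists>G. L2 lebesgue G \<and> (AE z in lebesgue. G z + szego_matrix (\<lambda>s. A s (G s) - G s) z = szego_matrix (\<lambda>s. - j s) z) \<and>
    (\<forall>G'. L2 lebesgue G' \<and> (AE z in lebesgue. G' z + szego_matrix (\<lambda>s. A s (G' s) - G' s) z = szego_matrix (\<lambda>s. - j s) z)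
      \<longrightarrow> (AE z in lebesgue. G' z = G z))"
  proof (rule szego_matrix.coercive_equation_unique_solution)
    show "linear (A z)" for z
      by (rule linearI) (simp_all add: A_def vec_eq_iff matrix_mult_entries algebra_simps)
    show "(\<lambda>z. A z (f z)) \<in> borel_measurable lebesgue" if "f \<in> borel_measurable lebesgue" for f
    proof (rule borel_measurable_matrix)
      fix a b
      note [measurable] = borel_measurable_entry[OF that] borel_measurable_entry[OF jm]
      show "(\<lambda>z. A z (f z) $ a $ b) \<in> borel_measurable lebesgue"
        unfolding A_def matrix_mult_entries by simp
    qed
    show "AE z in lebesgue. \<forall>X. norm (A z X) \<le> 8 * ?\<beta> * norm X"
      using R
    proof eventually_elim
      case (elim z)
      have "norm ((j z + mat 1) $ a $ b) \<le> ?\<beta>" for a b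
      proof -
        have "norm ((j z + mat 1) $ a $ b) \<le> norm (j z $ a $ b) + norm ((mat 1 :: complex^2^2) $ a $ b)"
          by (simp add: norm_triangle_ineq)
        also have "\<dots> \<le> (1 + R) * R + 1"
        proof (rule add_mono)
          have "norm (j z $ a $ b) \<le> (1 + R) * norm (r (kz z))"
            unfolding j_def by (rule J_entry_bound[where r = r and z = z, OF elim])
          also have "\<dots> \<le> (1 + R) * R" using elim R0 by (intro mult_left_mono) auto
          finally show "norm (j z $ a $ b) \<le> (1 + R) * R" .
        qed (simp add: mat_def)
        finally show ?thesis .
      qed
      then show ?case unfolding A_def by (intro allI norm_matrix_mult_le)
    qed
    show "0 \<le> 8 * ?\<beta>" using R0 by simp
    show "AE z in lebesgue. \<forall>X. c * (norm X)\<^sup>2 \<le> A z X \<bullet> X"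
      using R
    proof eventually_elim
      case (elim z)
      show ?case
      proof
        fix X
        show "c * (norm X)\<^sup>2 \<le> A z X \<bullet> X"
        proof (cases "z \<ge> 0")
          case True
          have "c * (norm X)\<^sup>2 \<le> 1 / (3 + 2 * R\<^sup>2) * (norm X)\<^sup>2"
            by (intro mult_right_mono) (simp_all add: c_def)
          also have "\<dots> \<le> A z X \<bullet> X" unfolding A_def j_def by (rule J_coercive_nonneg[where r = r and z = z, OF True elim])
          finally show ?thesis .
        next
          case False
          then have "Re (kz z) = 0" by (simp add: kz_neg)
          from assms(4)[OF this] c1 have "c \<le> 1 - (norm (r (kz z)))\<^sup>2" "c \<le> 1" by (auto simp: c_def)
          then show ?thesis unfolding A_def j_def using False by (intro J_coercive_neg) auto
        qed
      qed
    qed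
    show "c > 0" by (rule c)
    show "L2 lebesgue (\<lambda>s. - j s)" by (rule L2_minus[OF jL])
    show "L2 lebesgue (\<lambda>z. norm (cauchy_kernel \<i> z))"
      by (intro L2_norm L2_lebesgue L2_cauchy_kernel) simp
    show "norm (cauchy_kernel \<i> z) > 0" for z
    proof -
      have "complex_of_real z - \<i> \<noteq> 0" by (simp add: complex_eq_iff)
      then show ?thesis by (simp add: cauchy_kernel_def)
    qed
  qed
  moreover have "solves_RH_equation r x G \<longleftrightarrow>
     (AE z in lebesgue. G z + szego_matrix (\<lambda>s. A s (G s) - G s) z = szego_matrix (\<lambda>s. - j s) z)" for G
  proof -
    have "AE z in lebesgue. szego_matrix (\<lambda>s. - j s) z = - szego_matrix j z"
      using szego_matrix.Q_scaleR[OF jL, of "- 1"] by simp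
    then have "AE z in lebesgue. (G z + szego_matrix (\<lambda>s. A s (G s) - G s) z = szego_matrix (\<lambda>s. - j s) z)
        = (G z = - szego_matrix (\<lambda>s. G s ** j s) z + - szego_matrix j z)"
    proof eventually_elim
      case (elim z)
      have "u + v = - w \<longleftrightarrow> u = - v + - w" for u v w :: "complex^2^2"
      proof -
        have "u + v = - w \<longleftrightarrow> u = - w - v" by (rule eq_diff_eq[symmetric])
        also have "- w - v = - v + - w" by simp
        finally show ?thesis .
      qed
      then show ?case unfolding A_j elim .
    qed
    from eventually_subst[OF this] show ?thesis
      unfolding solves_RH_equation_def plemelj_minus_mat_szego j_def by simp
  qed
  ultimately show "\<exists>G. in_L2 G \<and> solves_RH_equation r x G \<and>
           (\<forall>G'. in_L2 G' \<and> solves_RH_equation r x G' \<longrightarrow> (AE z in lebesgue. G' z = G z))"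
    by (simp add: in_L2)
qed

end
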